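(* For any $k\ge1$ and any element $P\in\mathcal P_k$, we have $$\mathbb P(P_0=P)=2^{-4k-2}\sum_{\ell_0,\dots,\ell_{2k-1}\ge0}\left(\prod_{F\in\mathcal F(P)}\mathrm{Cat}_{\ell_{I(F)}}\,2^{-2\ell_{I(F)}}\right)\times\binom{2\ell_{I(F_0)}}{\ell_{I(F_0)}}2^{-2\ell_{I(F_0)}}\times\binom{2\ell_{I(F_\infty)}}{\ell_{I(F_\infty)}}2^{-2\ell_{I(F_\infty)}},$$ where $\ell_I=\sum_{i\in I}\ell_i$ for a set $I$ of indices and, by convention, $\ell_{-1}=\ell_{2k}=0$.
   Context: Infinite noodle: let $\boldsymbol w^a_\infty,\boldsymbol w^b_\infty\in\{L,R\}^{\mathbb Z}$ be two independent random words with i.i.d. uniform letters in $\{L,R\}$. Almost surely there is a unique non-crossing partition of $\mathbb Z$ into pairs (no two pairs $\{i,k\},\{j,\ell\}$ with $i<j<k<\ell$) such that, for all $i$, $i$ is the smaller element of its pair iff $\boldsymbol w^a_\infty(i)=L$ (upper matching), and similarly for $\boldsymbol w^b_\infty$ (lower matching). The infinite noodle $\boldsymbol M_\infty$ consists of these two matchings, viewed as a (multi-)graph on $\mathbb Z$; $C_0(\boldsymbol M_\infty)$ is the component of $0$. Partial meandric systems: for an integer interval $A$, a partial matching on $A$ is a partition of $A$ into pairs and singletons, each singleton decorated with $L$ or $R$. It is non-crossing if it contains none of: two pairs $\{i,k\},\{j,\ell\}$ with $i<j<k<\ell$; a pair $\{i,k\}$ and a singleton $\{j\}$ with $i<j<k$;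 two singletons $\{i\},\{j\}$ with $i<j$, $i$ decorated $L$, $j$ decorated $R$. It is encoded by the word $w\in\{L,R\}^A$ with $w(i)=L$ iff $\{i\}$ is a singleton decorated $L$ or $i$ is the smaller element of its pair; this is a bijection between non-crossing partial matchings on $A$ and $\{L,R\}^A$. A partial meandric system on $A$ is an ordered pair (upper, lower) of non-crossing partial matchings on $A$; its connected components are those of the multigraph on $A$ formed by the pairs of both. A partial meander is a partial meandric system with only one connected component. The restriction to a subinterval $B$ keeps pairs and decorated singletons inside $B$, and turns each $i\in B$ paired with $i'\notin B$ into a singleton decorated $L$ if $i'>i$, $R$ if $i'<i$; it is denoted $M/B$. Events: $L_0$ is the event that $0$ is the leftmost point of $C_0(\boldsymbol M_\infty)$, and $\overline{L_0}$ its complement. For $k\ge0$, $E_k$ is the event that $0$ is not the leftmost point of its connected component in the restriction of $\boldsymbol M_\infty$ to $(-\infty,k]$. One has $\overline{L_0}=\bigcup_{k\ge0}E_k$; on $\overline{L_0}$ set $K=\inf\{k\ge0:E_k\text{ holds}\}$. Partial shape: on $\overline{L_0}\cap\{K\ge1\}$, let $E$ be the set of points of the connected component of $0$ in $\boldsymbol M_\infty/\{0,\dots,K\}$, and $g:E\to\{0,\dots,|E|-1\}$ the increasing bijection. The partial shape $P_0$ is the partial meandric system on $\{0,\dots,|E|-1\}$ with upper and lower words $\boldsymbol w^a(i)=\boldsymbol w^a_\infty(g^{-1}(i))$, $\boldsymbol w^b(i)=\boldsymbol w^b_\infty(g^{-1}(i))$. The event $\{P_0=P\}$ includes that $\overline{L_0}$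 holds and $K\ge1$. The set $\mathcal P_k$ ($k\ge1$): the set of partial meanders $P$ on $\{0,\dots,2k\}$ such that (i) the restriction of $P$ to $\{0,\dots,2k-1\}$ does not have $0$ and a singleton decorated $R$ in the same connected component; (ii) each of the upper and lower partial matchings of $P$ has exactly one singleton, one of these two singletons being decorated $L$ and the other $R$. Faces: draw the pairs of the upper (lower) partial matching of $P$ as non-crossing arcs above (below) the real axis. $\mathcal F(P)$ is the set of bounded regions delimited by these arcs and the real axis. Let $s_1$ be the position of the singleton decorated $L$ and $s_2$ that of the singleton decorated $R$. Complete $P$ by adding, on the side (upper or lower) of the singleton $s_1$, an arc from $s_1$ to $2k+1$, and, on the side of the singleton $s_2$, an arc from $-1$ to $s_2$. This creates two new bounded faces, denoted respectively $F_\infty$ (just under the arc $\{s_1,2k+1\}$) and $F_0$ (just under the arc $\{-1,s_2\}$); they are not elements of $\mathcal F(P)$. For any of these faces $F$, $I(F)$ is the set of integers $i$ such that $F$ is incident to the segment $[i;i+1]$. (Equivalently, the face of an arc $\{a<b\}$ has $I(F)=\{i:a\le i<b$ and there is no other arc $\{c<d\}$ on the same side with $a<c\le i<d<b\}$.) $\mathrm{Cat}_n=\frac1{n+1}\binom{2n}n$. *)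

theory Defs
  imports "HOL-Probability.Probability"
begin

datatype letter = L | R

datatype side = Upper | Lower

text \<open>
  Singletons carry their decoration: \<open>sing m i = Some l\<close> iff \<open>{i}\<close> is a singleton decorated \<open>l\<close>.
\<close>

datatype pmatching = PMatching (pairs: "int set set") (sing: "int \<Rightarrow> letter option")

definition partial_matching :: "int set \<Rightarrow> pmatching \<Rightarrow> bool" where
  "partial_matching A m \<longleftrightarrow>
     partition_on A (pairs m \<union> (\<lambda>i. {i}) ` dom (sing m)) \<and> (\<forall>p\<in>pairs m. card p = 2)"

definition noncrossing :: "pmatching \<Rightarrow> bool" where
  "noncrossing m \<longleftrightarrow>
     (\<nexists>i j k l. i < j \<and> j < k \<and> k < l \<and> {i, k} \<in> pairs m \<and> {j, l} \<in> pairs m) \<and>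
     (\<nexists>i j k. i < j \<and> j < k \<and> {i, k} \<in> pairs m \<and> sing m j \<noteq> None) \<and>
     (\<nexists>i j. i < j \<and> sing m i = Some L \<and> sing m j = Some R)"

definition encoded_by :: "int set \<Rightarrow> (int \<Rightarrow> letter) \<Rightarrow> pmatching \<Rightarrow> bool" where
  "encoded_by A w m \<longleftrightarrow>
     (\<forall>i\<in>A. w i = L \<longleftrightarrow> sing m i = Some L \<or> (\<exists>j>i. {i, j} \<in> pairs m))"

definition decode :: "int set \<Rightarrow> (int \<Rightarrow> letter) \<Rightarrow> pmatching" where
  "decode A w = (THE m. partial_matching A m \<and> noncrossing m \<and> encoded_by A w m)"

text \<open>
  If \<open>i \<in> B\<close> is paired outside \<open>B\<close>, its partner is unique, so the inner conditional
  compares \<open>i\<close> with that partner.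
\<close>

definition restrict_pmatching :: "int set \<Rightarrow> pmatching \<Rightarrow> pmatching" where
  "restrict_pmatching B m =
     PMatching {p \<in> pairs m. p \<subseteq> B}
       (\<lambda>i. if i \<notin> B then None
            else if \<exists>j. j \<notin> B \<and> {i, j} \<in> pairs m
            then Some (if \<exists>j. j \<notin> B \<and> {i, j} \<in> pairs m \<and> i < j then L else R)
            else sing m i)"


text \<open>An ordered pair (upper, lower) is a function on the two-element type \<^typ>\<open>side\<close>.\<close>

type_synonym msystem = "side \<Rightarrow> pmatching"

definition partial_meandric_system :: "int set \<Rightarrow> msystem \<Rightarrow> bool" where
  "partial_meandric_system A M \<longleftrightarrow> (\<forall>s. partial_matching A (M s) \<and> noncrossing (M s))"

definition restrict_system :: "int set \<Rightarrow> msystem \<Rightarrow> msystem" where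
  "restrict_system B M = (\<lambda>s. restrict_pmatching B (M s))"

definition edge_rel :: "msystem \<Rightarrow> (int \<times> int) set" where
  "edge_rel M = {(i, j). \<exists>s. {i, j} \<in> pairs (M s)}"

definition conn_comp :: "msystem \<Rightarrow> int \<Rightarrow> int set" where
  "conn_comp M i = {j. (i, j) \<in> (edge_rel M)\<^sup>*}"

definition partial_meander :: "int set \<Rightarrow> msystem \<Rightarrow> bool" where
  "partial_meander A M \<longleftrightarrow> partial_meandric_system A M \<and> card (conn_comp M ` A) = 1"

definition leftmost_in_comp :: "msystem \<Rightarrow> int \<Rightarrow> bool" where
  "leftmost_in_comp M i \<longleftrightarrow> (\<forall>j\<in>conn_comp M i. i \<le> j)"


definition noodle_matching :: "(int \<Rightarrow> letter) \<Rightarrow> pmatching \<Rightarrow> bool" where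
  "noodle_matching w m \<longleftrightarrow>
     partial_matching UNIV m \<and> sing m = Map.empty \<and> noncrossing m \<and> encoded_by UNIV w m"

text \<open>Only almost every pair of words defines a noodle.\<close>

definition noodle_exists :: "(side \<Rightarrow> int \<Rightarrow> letter) \<Rightarrow> bool" where
  "noodle_exists w \<longleftrightarrow> (\<forall>s. \<exists>!m. noodle_matching (w s) m)"

definition noodle :: "(side \<Rightarrow> int \<Rightarrow> letter) \<Rightarrow> msystem" where
  "noodle w = (\<lambda>s. THE m. noodle_matching (w s) m)"

definition event_E :: "msystem \<Rightarrow> nat \<Rightarrow> bool" where
  "event_E M k \<longleftrightarrow> \<not> leftmost_in_comp (restrict_system {..int k} M) 0"

definition time_K :: "msystem \<Rightarrow> nat" where
  "time_K M = (LEAST k. event_E M k)"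

definition shape_set :: "msystem \<Rightarrow> int set" where
  "shape_set M = conn_comp (restrict_system {0..int (time_K M)} M) 0"

text \<open>
  The list \<open>sorted_list_of_set E\<close> enumerates \<open>E\<close> increasingly, starting at index 0; it is the
  inverse of the increasing bijection from \<open>E\<close> onto \<open>{0, \<dots>, |E| - 1}\<close>.
  The value \<open>None\<close> means that the partial shape is undefined.
\<close>

definition partial_shape :: "(side \<Rightarrow> int \<Rightarrow> letter) \<Rightarrow> msystem option" where
  "partial_shape w =
     (let M = noodle w; E = shape_set M in
      if noodle_exists w \<and> \<not> leftmost_in_comp M 0 \<and> time_K M \<ge> 1
      then Some (\<lambda>s. decode {0..int (card E) - 1} (\<lambda>i. w s (sorted_list_of_set E ! nat i)))
      else None)"


definition shapes :: "nat \<Rightarrow> msystem set" where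
  "shapes k =
     {P. partial_meander {0..2 * int k} P \<and>
         (let Q = restrict_system {0..2 * int k - 1} P
          in \<nexists>i s. i \<in> conn_comp Q 0 \<and> sing (Q s) i = Some R) \<and>
         (\<exists>s1 s2. (sing (P Upper) = [s1 \<mapsto> L] \<and> sing (P Lower) = [s2 \<mapsto> R]) \<or>
                  (sing (P Upper) = [s2 \<mapsto> R] \<and> sing (P Lower) = [s1 \<mapsto> L]))}"


text \<open>
  Each bounded face lies in one half-plane and is the region just under a unique arc.
  A face is represented by the side and that arc, so equal pairs occurring on both
  sides give two distinct faces.
\<close>

type_synonym face = "side \<times> int set"

definition faces :: "msystem \<Rightarrow> face set" where
  "faces P = {(s, e). e \<in> pairs (P s)}"

definition singleton_of :: "letter \<Rightarrow> msystem \<Rightarrow> side \<times> int" where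
  "singleton_of l P = (THE (s, i). sing (P s) i = Some l)"

definition face_inf :: "nat \<Rightarrow> msystem \<Rightarrow> face" where
  "face_inf k P = (case singleton_of L P of (s, s1) \<Rightarrow> (s, {s1, 2 * int k + 1}))"

definition face_zero :: "msystem \<Rightarrow> face" where
  "face_zero P = (case singleton_of R P of (s, s2) \<Rightarrow> (s, {-1, s2}))"

definition all_faces :: "nat \<Rightarrow> msystem \<Rightarrow> face set" where
  "all_faces k P = faces P \<union> {face_zero P, face_inf k P}"

definition incident :: "nat \<Rightarrow> msystem \<Rightarrow> face \<Rightarrow> int set" where
  "incident k P = (\<lambda>(s, e).
     {i. Min e \<le> i \<and> i < Max e \<and>
         (\<nexists>f. (s, f) \<in> all_faces k P \<and>
              Min e < Min f \<and> Min f \<le> i \<and> i < Max f \<and> Max f < Max e)})"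


definition catalan :: "nat \<Rightarrow> real" where
  "catalan n = real ((2 * n) choose n) / real (n + 1)"

text \<open>
  Families \<open>(\<ell>\<^sub>0, \<dots>, \<ell>\<^sub>2\<^sub>k\<^sub>-\<^sub>1)\<close> of naturals, extended by 0 to all of \<open>\<int>\<close>;
  this includes the convention that the entries at \<open>-1\<close> and \<open>2k\<close> vanish.
\<close>

definition ell_families :: "nat \<Rightarrow> (int \<Rightarrow> nat) set" where
  "ell_families k = {l. \<forall>i. i \<notin> {0..2 * int k - 1} \<longrightarrow> l i = 0}"

definition shape_weight :: "nat \<Rightarrow> msystem \<Rightarrow> (int \<Rightarrow> nat) \<Rightarrow> real" where
  "shape_weight k P l =
     (let lsum = (\<lambda>F. \<Sum>i\<in>incident k P F. l i);
          central = (\<lambda>n. real ((2 * n) choose n) / 2 ^ (2 * n))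
      in (\<Prod>F\<in>faces P. catalan (lsum F) / 2 ^ (2 * lsum F)) *
         central (lsum (face_zero P)) * central (lsum (face_inf k P)))"

end

(*
  Matched pairs are excursions of the walk with step +1 at L and -1 at R. On the event that the noodle exists, the
  partial shape equals P iff there is a family l such that, with g(i) = i + 2 (l_0 + ... + l_{i-1}), the arcs of P
  are carried by g to arcs of the noodle, and the arcs starting at the images of the two singletons leave the
  interval [0, g(2k)]; the gaps have even length because the parity of g(i) + i is constant along the connected
  meander P. Removing the intervals below the arcs nested in a face does not affect the walk condition on that face,
  so the event for l splits into independent conditions: the letters at the 2k + 1 points on each side, a Dyck word
  of length 2 l_{I(F)} for each bounded face F, and for F_infinity and F_0 a word whose prefix sums are nonnegative,
  respectively whose suffix sums are nonpositive. The ballot numbers count these words, and the walk is recurrent,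
  so the noodle exists almost surely.
*)
theory Submission
  imports Defs "HOL-Real_Asymp.Real_Asymp"
begin

section \<open>Heights and first-return arcs\<close>

text \<open>The region of a face is in general not an interval, because the blocks below nested arcs
  are cut out of it. This is why \<open>rise\<close> and the prefix and suffix conditions are
  defined for arbitrary index sets: they make sense on every region, and on a finite set their
  probabilities depend only on its cardinality. An arc that leaves [0, g(2k)] involves letters
  arbitrarily far away. Once the noodle exists, it is equivalent to the absence of a return inside
  the window, and \<open>realizes\<close> is stated in this finite form. Condition (i) on shapes is
  what forces K to be the image of 2k: at an earlier time the visible component of 0 lies in the
  image of the component of 0 in the restricted meander, and no arc towards the negative side starts
  there. The family l is unique because the embedded points form the component that defines the
  partial shape, and sorting this component recovers g. So the events for different l are disjoint,
  and the law is a countable sum of finite products.\<close>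

definition rise :: "(int \<Rightarrow> letter) \<Rightarrow> int set \<Rightarrow> int" where
  "rise w J = (\<Sum>y\<in>J. if w y = L then 1 else -1)"

text \<open>The cut x ranges over all integers, in J or not, so that J need not be enumerated and
  may have gaps.\<close>

definition nonneg_prefixes :: "(int \<Rightarrow> letter) \<Rightarrow> int set \<Rightarrow> bool" where
  "nonneg_prefixes w J \<longleftrightarrow> (\<forall>x. 0 \<le> rise w (J \<inter> {..x}))"

definition nonpos_suffixes :: "(int \<Rightarrow> letter) \<Rightarrow> int set \<Rightarrow> bool" where
  "nonpos_suffixes w J \<longleftrightarrow> (\<forall>x. rise w (J \<inter> {x..}) \<le> 0)"

definition balanced :: "(int \<Rightarrow> letter) \<Rightarrow> int set \<Rightarrow> bool" where
  "balanced w J \<longleftrightarrow> nonneg_prefixes w J \<and> rise w J = 0"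

text \<open>An excursion of the walk: after the step L at i the height does not drop below its new
  level until the step R at j.\<close>

definition matched :: "(int \<Rightarrow> letter) \<Rightarrow> int \<Rightarrow> int \<Rightarrow> bool" where
  "matched w i j \<longleftrightarrow> i < j \<and> w i = L \<and> w j = R \<and> balanced w {i<..<j}"

text \<open>The height of the two-sided walk, normalised to 0 at 0; at least one of the two
  intervals is always empty. The letter at x is the step from x - 1 to x.\<close>

definition potential :: "(int \<Rightarrow> letter) \<Rightarrow> int \<Rightarrow> int" where
  "potential w x = rise w {0<..x} - rise w {x<..0}"

lemma not_L [simp]: "w \<noteq> L \<longleftrightarrow> w = R"
  by (cases w) auto

lemma not_R: "w \<noteq> R \<longleftrightarrow> w = L"
  by (cases w) auto

lemma rise_empty [simp]: "rise w {} = 0"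
  by (simp add: rise_def)

lemma rise_Un_disjoint:
  "\<lbrakk>finite A; finite B; A \<inter> B = {}\<rbrakk> \<Longrightarrow> rise w (A \<union> B) = rise w A + rise w B"
  by (simp add: rise_def sum.union_disjoint)

lemma rise_insert:
  "\<lbrakk>finite A; x \<notin> A\<rbrakk> \<Longrightarrow> rise w (insert x A) = (if w x = L then 1 else -1) + rise w A"
  by (simp add: rise_def)

lemma rise_interval:
  assumes "i \<le> x"
  shows "rise w {i<..x} = potential w x - potential w i"
proof -
  have split: "rise w {a<..c} = rise w {a<..b} + rise w {b<..c}" if "a \<le> b" "b \<le> c" for a b c
  proof -
    have "{a<..c} = {a<..b} \<union> {b<..c}" using that by auto
    then show ?thesis by (simp add: rise_Un_disjoint)
  qed
  consider "0 \<le> i" | "i < 0" "0 \<le> x" | "x < 0" by linarith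
  then show ?thesis
  proof cases
    case 1
    then show ?thesis using split[of 0 i x] assms by (simp add: potential_def)
  next
    case 2
    then show ?thesis using split[of i 0 x] assms by (simp add: potential_def)
  next
    case 3
    then show ?thesis using split[of i x 0] assms by (simp add: potential_def)
  qed
qed

lemma potential_step: "potential w x = potential w (x - 1) + (if w x = L then 1 else -1)"
proof -
  have "{x - 1<..x} = {x}" by auto
  then show ?thesis
    using rise_interval[of "x - 1" x w] by (simp add: rise_def)
qed

lemma potential_letter:
  "w x = L \<longleftrightarrow> potential w (x - 1) = potential w x - 1"
  "w x = R \<longleftrightarrow> potential w (x - 1) = potential w x + 1"
  using potential_step[of w x] by (cases "w x"; simp)+

section \<open>Prefix and suffix conditions as bounds on heights; uniqueness and non-crossing of
  excursions\<close>

lemma nonneg_prefixes_interval: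
  assumes "i \<le> k"
  shows "nonneg_prefixes w {i<..k} \<longleftrightarrow> (\<forall>x\<in>{i..k}. potential w i \<le> potential w x)"
proof
  assume nn: "nonneg_prefixes w {i<..k}"
  show "\<forall>x\<in>{i..k}. potential w i \<le> potential w x"
  proof
    fix x assume x: "x \<in> {i..k}"
    then have "{i<..k} \<inter> {..x} = {i<..x}" by auto
    then have "0 \<le> rise w {i<..x}" using nn unfolding nonneg_prefixes_def by metis
    then show "potential w i \<le> potential w x" using x by (simp add: rise_interval)
  qed
next
  assume pot: "\<forall>x\<in>{i..k}. potential w i \<le> potential w x"
  show "nonneg_prefixes w {i<..k}" unfolding nonneg_prefixes_def
  proof
    fix x
    have "{i<..k} \<inter> {..x} = {i<..min x k}" by auto
    then show "0 \<le> rise w ({i<..k} \<inter> {..x})"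
      using pot by (cases "i \<le> min x k") (auto simp: rise_interval)
  qed
qed

lemma nonpos_suffixes_interval:
  assumes "i \<le> k"
  shows "nonpos_suffixes w {i<..k} \<longleftrightarrow> (\<forall>x\<in>{i..k}. potential w k \<le> potential w x)"
proof
  assume nn: "nonpos_suffixes w {i<..k}"
  show "\<forall>x\<in>{i..k}. potential w k \<le> potential w x"
  proof
    fix x assume x: "x \<in> {i..k}"
    then have "{i<..k} \<inter> {x + 1..} = {x<..k}" by auto
    then have "rise w {x<..k} \<le> 0" using nn unfolding nonpos_suffixes_def by metis
    then show "potential w k \<le> potential w x" using x by (simp add: rise_interval)
  qed
next
  assume pot: "\<forall>x\<in>{i..k}. potential w k \<le> potential w x"
  show "nonpos_suffixes w {i<..k}" unfolding nonpos_suffixes_def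
  proof
    fix x
    have "{i<..k} \<inter> {x..} = {max (x - 1) i<..k}" by auto
    then show "rise w ({i<..k} \<inter> {x..}) \<le> 0"
      using pot by (cases "max (x - 1) i \<le> k") (auto simp: rise_interval)
  qed
qed

lemma matched_iff_potential:
  "matched w i j \<longleftrightarrow> i < j \<and> (\<forall>x\<in>{i..<j}. potential w i \<le> potential w x) \<and>
     potential w (i - 1) = potential w i - 1 \<and> potential w (j - 1) = potential w i \<and>
     potential w j = potential w i - 1"
proof (cases "i < j")
  case True
  then have e: "{i<..<j} = {i<..j - 1}" "{i..<j} = {i..j - 1}" by auto
  show ?thesis
    using True unfolding matched_def balanced_def potential_letter e
    by (auto simp: nonneg_prefixes_interval rise_interval)
qed (simp add: matched_def)

lemma matched_potential_ge: "\<lbrakk>matched w i j; i \<le> x; x < j\<rbrakk> \<Longrightarrow> potential w i \<le> potential w x"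
  by (simp add: matched_iff_potential)

text \<open>The earlier of two right ends would lie inside the longer excursion, where the height
  may not drop below its start.\<close>

lemma matched_unique_right: "\<lbrakk>matched w i j; matched w i j'\<rbrakk> \<Longrightarrow> j = j'"
proof -
  have False if "matched w i j" "matched w i j'" "j < j'" for j j'
  proof -
    have "potential w i \<le> potential w j"
      using that matched_potential_ge[of w i j' j] by (simp add: matched_def)
    then show False using that unfolding matched_iff_potential by auto
  qed
  then show "matched w i j \<Longrightarrow> matched w i j' \<Longrightarrow> j = j'" by (metis linorder_neqE)
qed

lemma matched_unique_left: "\<lbrakk>matched w i j; matched w i' j\<rbrakk> \<Longrightarrow> i = i'"
proof -
  have False if "matched w i j" "matched w i' j" "i < i'" for i i'
  proof -
    have "potential w i \<le> potential w (i' - 1)"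
      using that matched_potential_ge[of w i j "i' - 1"] by (simp add: matched_def)
    then show False using that unfolding matched_iff_potential by auto
  qed
  then show "matched w i j \<Longrightarrow> matched w i' j \<Longrightarrow> i = i'" by (metis linorder_neqE)
qed

lemma matched_not_both: "\<lbrakk>matched w i j; matched w j k\<rbrakk> \<Longrightarrow> False"
  by (simp add: matched_def)

text \<open>For crossing arcs, k lies in the excursion of j and j - 1 in that of i. So the height at
  k is at least that at j, which exceeds that at i; but k ends the excursion of i one level
  lower.\<close>

lemma matched_noncrossing:
  assumes "matched w i k" "matched w j l" "i < j" "j < k" "k < l"
  shows False
proof -
  have "potential w j \<le> potential w k" "potential w i \<le> potential w (j - 1)"
    using assms matched_potential_ge[of w j l k] matched_potential_ge[of w i k "j - 1"] by auto
  then show False using assms unfolding matched_iff_potential by auto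
qed

text \<open>The existence of some partner stays on the right-hand side: nonnegative prefixes up to k
  only exclude a return before k. A partner at or before k would be a point of the window with
  height below that of i.\<close>

lemma matched_beyond_iff:
  assumes "i \<le> k"
  shows "(\<exists>j>k. matched w i j) \<longleftrightarrow> (\<exists>j. matched w i j) \<and> w i = L \<and> nonneg_prefixes w {i<..k}"
proof
  assume "\<exists>j>k. matched w i j"
  then show "(\<exists>j. matched w i j) \<and> w i = L \<and> nonneg_prefixes w {i<..k}"
    using assms by (auto simp: nonneg_prefixes_interval matched_iff_potential potential_letter)
next
  assume asm: "(\<exists>j. matched w i j) \<and> w i = L \<and> nonneg_prefixes w {i<..k}"
  then obtain j where j: "matched w i j" by auto
  have "j > k"
  proof (rule ccontr)
    assume "\<not> j > k"
    moreover have "i \<le> j" "potential w j = potential w i - 1" using j by (simp_all add: matched_iff_potential)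
    ultimately show False
      using asm assms bspec[of "{i..k}" "\<lambda>x. potential w i \<le> potential w x" j]
      by (simp add: nonneg_prefixes_interval)
  qed
  then show "\<exists>j>k. matched w i j" using j by auto
qed

lemma matched_before_iff:
  assumes "k \<le> i"
  shows "(\<exists>j<k. matched w j i) \<longleftrightarrow> (\<exists>j. matched w j i) \<and> w i = R \<and> nonpos_suffixes w {k..<i}"
proof -
  have e: "{k..<i} = {k - 1<..i - 1}" by auto
  show ?thesis
  proof
    assume "\<exists>j<k. matched w j i"
    then show "(\<exists>j. matched w j i) \<and> w i = R \<and> nonpos_suffixes w {k..<i}"
      using assms unfolding e
      by (auto simp: nonpos_suffixes_interval matched_iff_potential potential_letter)
  next
    assume asm: "(\<exists>j. matched w j i) \<and> w i = R \<and> nonpos_suffixes w {k..<i}"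
    then obtain j where j: "matched w j i" by auto
    have "j < k"
    proof (rule ccontr)
      assume "\<not> j < k"
      moreover have "j < i" "potential w (j - 1) = potential w (i - 1) - 1"
        using j by (simp_all add: matched_iff_potential)
      ultimately show False
        using asm assms bspec[of "{k - 1..i - 1}" "\<lambda>x. potential w (i - 1) \<le> potential w x" "j - 1"]
        unfolding e by (simp add: nonpos_suffixes_interval)
    qed
    then show "\<exists>j<k. matched w j i" using j by auto
  qed
qed

text \<open>By contraposition: the first time that the height falls below its value at i is a
  partner of i. With the recurrence of the walk this yields the almost sure existence of the
  noodle.\<close>

lemma unmatched_nonneg_prefixes:
  assumes L: "w i = L" and un: "\<nexists>j. matched w i j" and "i \<le> k"
  shows "nonneg_prefixes w {i<..k}"
proof (rule ccontr)
  assume "\<not> nonneg_prefixes w {i<..k}"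
  then obtain x where x: "i \<le> x" "potential w x < potential w i"
    using \<open>i \<le> k\<close> by (auto simp: nonneg_prefixes_interval)
  define n where "n = (LEAST n. potential w (i + int n) < potential w i)"
  have "potential w (i + int (nat (x - i))) < potential w i" using x by simp
  then have n: "potential w (i + int n) < potential w i"
    unfolding n_def by (rule LeastI)
  have least: "potential w i \<le> potential w (i + int m)" if "m < n" for m
    using not_less_Least[of m "\<lambda>n. potential w (i + int n) < potential w i"] that
    unfolding n_def by force
  have pos: "n > 0" using n by (cases n) auto
  have pre: "potential w i \<le> potential w (i + int n - 1)"
    using least[of "n - 1"] pos by (simp add: algebra_simps of_nat_diff)
  \<comment> \<open>Steps have size one, so the first lower value is exactly one below, and it is
    reached from the level of i.\<close>
  have eq: "potential w (i + int n) = potential w i - 1" "potential w (i + int n - 1) = potential w i"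
    using pre n potential_step[of w "i + int n"] by (auto split: if_splits)
  have "matched w i (i + int n)" unfolding matched_iff_potential
  proof (intro conjI ballI)
    fix y assume "y \<in> {i..<i + int n}"
    then show "potential w i \<le> potential w y" using least[of "nat (y - i)"] by auto
  qed (use pos eq L in \<open>simp_all add: potential_letter\<close>)
  then show False using un by blast
qed

lemma unmatched_nonpos_suffixes:
  assumes R: "w i = R" and un: "\<nexists>j. matched w j i" and "k \<le> i"
  shows "nonpos_suffixes w {k..<i}"
proof (rule ccontr)
  have e: "{k..<i} = {k - 1<..i - 1}" by auto
  assume "\<not> nonpos_suffixes w {k..<i}"
  then obtain x where x: "x \<le> i - 1" "potential w x < potential w (i - 1)"
    using \<open>k \<le> i\<close> unfolding e by (auto simp: nonpos_suffixes_interval)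
  define n where "n = (LEAST n. potential w (i - 1 - int n) < potential w (i - 1))"
  have "potential w (i - 1 - int (nat (i - 1 - x))) < potential w (i - 1)" using x by simp
  then have n: "potential w (i - 1 - int n) < potential w (i - 1)"
    unfolding n_def by (rule LeastI)
  have least: "potential w (i - 1) \<le> potential w (i - 1 - int m)" if "m < n" for m
    using not_less_Least[of m "\<lambda>n. potential w (i - 1 - int n) < potential w (i - 1)"] that
    unfolding n_def by force
  have pos: "n > 0" using n by (cases n) auto
  have pre: "potential w (i - 1) \<le> potential w (i - int n)"
    using least[of "n - 1"] pos by (simp add: algebra_simps of_nat_diff)
  have eq: "potential w (i - int n) = potential w (i - 1)" "w (i - int n) = L"
    using pre n potential_step[of w "i - int n"] by (auto simp: algebra_simps split: if_splits)
  \<comment> \<open>The lower height is found at i - 1 - n, that is, just before the letter at i -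
    n. This is why the partner of i sits at i - n.\<close>
  have "matched w (i - int n) i" unfolding matched_iff_potential
  proof (intro conjI ballI)
    fix y assume y: "y \<in> {i - int n..<i}"
    have "potential w (i - 1) \<le> potential w (i - 1 - int (nat (i - 1 - y)))"
      by (rule least) (use y in auto)
    then show "potential w (i - int n) \<le> potential w y" using y eq by simp
  qed (use pos eq R in \<open>simp_all add: potential_letter\<close>)
  then show False using un by blast
qed

section \<open>Non-crossing matchings are read off from the word\<close>

lemma partial_matchingD:
  assumes "partial_matching A m"
  shows pair_in: "\<And>i j. {i, j} \<in> pairs m \<Longrightarrow> i \<in> A \<and> j \<in> A"
    and pair_distinct: "\<And>i j. {i, j} \<in> pairs m \<Longrightarrow> i \<noteq> j"
    and pair_unique: "\<And>i j k. {i, j} \<in> pairs m \<Longrightarrow> {i, k} \<in> pairs m \<Longrightarrow> j = k"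
    and pair_or_sing: "\<And>i. i \<in> A \<Longrightarrow> (\<exists>j. {i, j} \<in> pairs m) \<or> (\<exists>l. sing m i = Some l)"
    and sing_in: "\<And>i l. sing m i = Some l \<Longrightarrow> i \<in> A"
    and sing_unpaired: "\<And>i j l. sing m i = Some l \<Longrightarrow> {i, j} \<notin> pairs m"
    and pair_elements: "\<And>p. p \<in> pairs m \<Longrightarrow> \<exists>i j. i < j \<and> p = {i, j}"
proof -
  have part: "partition_on A (pairs m \<union> (\<lambda>i. {i}) ` dom (sing m))"
    and card: "\<And>p. p \<in> pairs m \<Longrightarrow> card p = 2"
    using assms by (auto simp: partial_matching_def)
  let ?Q = "pairs m \<union> (\<lambda>i. {i}) ` dom (sing m)"
  have U: "\<Union>?Q = A" using partition_onD1[OF part] by simp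
  have disj: "\<And>p q. p \<in> ?Q \<Longrightarrow> q \<in> ?Q \<Longrightarrow> p \<inter> q \<noteq> {} \<Longrightarrow> p = q"
    using disjointD[OF partition_onD2[OF part]] by blast
  show "{i, j} \<in> pairs m \<Longrightarrow> i \<in> A \<and> j \<in> A" for i j using U by blast
  show dist: "{i, j} \<in> pairs m \<Longrightarrow> i \<noteq> j" for i j using card[of "{i, j}"] by auto
  show "{i, j} \<in> pairs m \<Longrightarrow> {i, k} \<in> pairs m \<Longrightarrow> j = k" for i j k
    using disj[of "{i, j}" "{i, k}"] by (auto simp: doubleton_eq_iff)
  show elts: "\<exists>i j. i < j \<and> p = {i, j}" if p: "p \<in> pairs m" for p
  proof -
    obtain i j where ij: "p = {i, j}" "i \<noteq> j" using card[OF p] by (auto simp: card_2_iff)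
    then show ?thesis by (metis insert_commute linorder_neqE)
  qed
  show "(\<exists>j. {i, j} \<in> pairs m) \<or> (\<exists>l. sing m i = Some l)" if "i \<in> A" for i
  proof -
    have "i \<in> \<Union>?Q" using that U by (simp only:)
    then obtain p where "p \<in> ?Q" "i \<in> p" by (rule UnionE)
    show ?thesis
    proof (rule UnE[OF \<open>p \<in> ?Q\<close>])
      assume p: "p \<in> pairs m"
      obtain a b where "p = {a, b}" using elts[OF p] by blast
      then have "p = {i, if i = a then b else a}" using \<open>i \<in> p\<close> by auto
      then show ?thesis using p by metis
    qed (use \<open>i \<in> p\<close> in auto)
  qed
  show "sing m i = Some l \<Longrightarrow> i \<in> A" for i l unfolding U[symmetric] by (auto intro: domI)
  show "sing m i = Some l \<Longrightarrow> {i, j} \<notin> pairs m" for i j l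
    using disj[of "{i, j}" "{i}"] dist[of i j] by (auto simp: domI)
qed

lemma partial_matchingI:
  assumes "\<And>p. p \<in> pairs m \<Longrightarrow> \<exists>i j. i \<noteq> j \<and> p = {i, j} \<and> i \<in> A \<and> j \<in> A"
    and "\<And>i j k. {i, j} \<in> pairs m \<Longrightarrow> {i, k} \<in> pairs m \<Longrightarrow> j = k"
    and "\<And>i. i \<in> A \<Longrightarrow> sing m i = None \<Longrightarrow> \<exists>j. {i, j} \<in> pairs m"
    and "\<And>i l. sing m i = Some l \<Longrightarrow> i \<in> A"
    and "\<And>i j l. sing m i = Some l \<Longrightarrow> {i, j} \<notin> pairs m"
  shows "partial_matching A m"
proof -
  let ?Q = "pairs m \<union> (\<lambda>i. {i}) ` dom (sing m)"
  have pp: "p = q" if pq: "p \<in> pairs m" "q \<in> pairs m" "x \<in> p" "x \<in> q" for p q x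
  proof -
    obtain a b where p: "p = {x, a}" using assms(1)[OF pq(1)] pq(3) by auto
    obtain c where q: "q = {x, c}" using assms(1)[OF pq(2)] pq(4) by auto
    show ?thesis using assms(2)[of x a c] pq p q by auto
  qed
  have ps: False if pq: "p \<in> pairs m" "sing m x = Some l" "x \<in> p" for p x l
  proof -
    obtain a where p: "p = {x, a}" using assms(1)[OF pq(1)] pq(3) by auto
    show False using assms(5)[OF pq(2)] pq p by auto
  qed
  have "partition_on A ?Q" unfolding partition_on_def
  proof (intro conjI)
    show "\<Union>?Q = A"
    proof
      have "p \<subseteq> A" if "p \<in> pairs m" for p using assms(1)[OF that] by auto
      then show "\<Union>?Q \<subseteq> A" using assms(4) by auto
      show "A \<subseteq> \<Union>?Q"
      proof
        fix i assume i: "i \<in> A"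
        show "i \<in> \<Union>?Q"
        proof (cases "sing m i")
          case None
          then show ?thesis using assms(3)[OF i] by auto
        qed auto
      qed
    qed
    show "disjoint ?Q" unfolding disjoint_def using pp ps by blast
    show "{} \<notin> ?Q" using assms(1)[of "{}"] by auto
  qed
  moreover have "card p = 2" if "p \<in> pairs m" for p using assms(1)[OF that] by auto
  ultimately show ?thesis unfolding partial_matching_def by blast
qed

lemma encoded_pair:
  assumes "partial_matching A m" "encoded_by A w m" "{i, j} \<in> pairs m"
  shows "w i = L \<longleftrightarrow> i < j"
proof -
  have "i \<in> A" using pair_in[OF assms(1,3)] by simp
  then show ?thesis
    using assms(2,3) pair_unique[OF assms(1)] sing_unpaired[OF assms(1)]
    unfolding encoded_by_def by metis
qed

lemma encoded_sing:
  assumes "partial_matching A m" "encoded_by A w m" "sing m i = Some l"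
  shows "w i = l"
proof -
  have "i \<in> A" using sing_in[OF assms(1,3)] .
  then have "w i = L \<longleftrightarrow> l = L"
    using assms sing_unpaired[OF assms(1,3)] unfolding encoded_by_def by simp
  then show ?thesis by (cases l; cases "w i") auto
qed

text \<open>Partners inject the letters a into the letters b. Comparing letter counts bounds the
  rise without following the nesting of the pairs.\<close>

lemma card_letter_le:
  assumes pm: "partial_matching A m" and "finite J"
    and "\<And>y. y \<in> J \<Longrightarrow> w y = a \<Longrightarrow> \<exists>z\<in>J. {y, z} \<in> pairs m \<and> w z = b"
  shows "card {y \<in> J. w y = a} \<le> card {y \<in> J. w y = b}"
proof -
  obtain f where f: "\<And>y. y \<in> J \<Longrightarrow> w y = a \<Longrightarrow> f y \<in> J \<and> {y, f y} \<in> pairs m \<and> w (f y) = b"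
    using assms(3) by metis
  have "inj_on f {y \<in> J. w y = a}"
  proof (rule inj_onI)
    fix x y assume xy: "x \<in> {y \<in> J. w y = a}" "y \<in> {y \<in> J. w y = a}" "f x = f y"
    have "{f x, x} \<in> pairs m" "{f x, y} \<in> pairs m"
      using f[of x] f[of y] xy by (auto simp: insert_commute)
    then show "x = y" using pair_unique[OF pm] by blast
  qed
  then show ?thesis using f \<open>finite J\<close> by (intro card_inj_on_le[of f]) auto
qed

lemma rise_card:
  assumes "finite J"
  shows "rise w J = int (card {y \<in> J. w y = L}) - int (card {y \<in> J. w y = R})"
proof -
  have "rise w J = (\<Sum>y\<in>J. (if w y = L then 1 else 0) - (if w y = R then 1 else 0))"
    unfolding rise_def by (rule sum.cong) auto
  also have "\<dots> = int (card {y \<in> J. w y = L}) - int (card {y \<in> J. w y = R})"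
    using assms by (simp add: sum_subtractf sum.If_cases Int_def conj_commute)
  finally show ?thesis .
qed

text \<open>By non-crossing, each point strictly between i and j has its partner strictly between
  them. In a prefix every R comes after its partner L, so the prefix has nonnegative rise; on the
  whole interior every L also has its partner R, so the rise is not positive either.\<close>

lemma pair_matched:
  assumes pm: "partial_matching A m" and nc: "noncrossing m" and enc: "encoded_by A w m"
    and conv: "\<forall>x\<in>A. \<forall>z\<in>A. {x..z} \<subseteq> A"
    and ij: "{i, j} \<in> pairs m" "i < j"
  shows "matched w i j"
proof -
  have inner: "\<exists>z. {y, z} \<in> pairs m \<and> i < z \<and> z < j" if y: "i < y" "y < j" for y
  proof -
    have "y \<in> A" using conv pair_in[OF pm ij(1)] y by (meson atLeastAtMost_iff less_imp_le subsetD)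
    moreover have "sing m y = None" using nc ij y unfolding noncrossing_def by blast
    ultimately obtain z where z: "{y, z} \<in> pairs m" using pair_or_sing[OF pm] by fastforce
    have "z \<noteq> i" "z \<noteq> j"
      using pair_unique[OF pm, of i j y] pair_unique[OF pm, of j i y] ij z y
      by (auto simp: insert_commute)
    moreover have "\<not> z < i" using nc ij z y unfolding noncrossing_def by (metis insert_commute)
    moreover have "\<not> z > j" using nc ij z y unfolding noncrossing_def by (metis insert_commute)
    ultimately show ?thesis using z by force
  qed
  have nn: "0 \<le> rise w {i<..x}" if "x < j" for x
  proof -
    have "card {y \<in> {i<..x}. w y = R} \<le> card {y \<in> {i<..x}. w y = L}"
    proof (rule card_letter_le[OF pm])
      fix y assume y: "y \<in> {i<..x}" "w y = R"
      then obtain z where z: "{y, z} \<in> pairs m" "i < z" using inner[of y] \<open>x < j\<close> by auto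
      have "z < y" using encoded_pair[OF pm enc z(1)] y pair_distinct[OF pm z(1)] by auto
      moreover have "w z = L" using encoded_pair[OF pm enc, of z y] z calculation by (simp add: insert_commute)
      ultimately show "\<exists>z\<in>{i<..x}. {y, z} \<in> pairs m \<and> w z = L" using z y by auto
    qed simp
    then show ?thesis by (simp add: rise_card)
  qed
  have "card {y \<in> {i<..<j}. w y = L} \<le> card {y \<in> {i<..<j}. w y = R}"
  proof (rule card_letter_le[OF pm])
    fix y assume y: "y \<in> {i<..<j}" "w y = L"
    then obtain z where z: "{y, z} \<in> pairs m" "i < z" "z < j" using inner[of y] by auto
    have "y < z" using encoded_pair[OF pm enc z(1)] y by auto
    then have "w z = R" using encoded_pair[OF pm enc, of z y] z by (auto simp: insert_commute simp flip: not_L)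
    then show "\<exists>z\<in>{i<..<j}. {y, z} \<in> pairs m \<and> w z = R" using z by auto
  qed simp
  then have np: "rise w {i<..<j} \<le> 0" by (simp add: rise_card)
  have e: "{i<..<j} = {i<..j - 1}" by auto
  have "\<forall>x\<in>{i..j - 1}. potential w i \<le> potential w x"
  proof
    fix x assume "x \<in> {i..j - 1}"
    then show "potential w i \<le> potential w x" using nn[of x] by (simp add: rise_interval)
  qed
  then have "balanced w {i<..<j}" unfolding balanced_def
    using np nn[of "j - 1"] ij(2) unfolding e by (simp add: nonneg_prefixes_interval)
  moreover have "w i = L" "w j = R"
    using encoded_pair[OF pm enc, of i j] encoded_pair[OF pm enc, of j i] ij
    by (auto simp: insert_commute simp flip: not_L)
  ultimately show ?thesis using ij by (simp add: matched_def)
qed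

lemma pairs_iff_matched:
  assumes pm: "partial_matching A m" and nc: "noncrossing m" and enc: "encoded_by A w m"
    and conv: "\<forall>x\<in>A. \<forall>z\<in>A. {x..z} \<subseteq> A"
    and "i < j"
  shows "{i, j} \<in> pairs m \<longleftrightarrow> i \<in> A \<and> j \<in> A \<and> matched w i j"
proof
  show "{i, j} \<in> pairs m \<Longrightarrow> i \<in> A \<and> j \<in> A \<and> matched w i j"
    using pair_matched[OF pm nc enc conv] \<open>i < j\<close> pair_in[OF pm] by blast
next
  assume asm: "i \<in> A \<and> j \<in> A \<and> matched w i j"
  then have "w i = L" by (simp add: matched_def)
  then consider "sing m i = Some L" | j' where "j' > i" "{i, j'} \<in> pairs m"
    using enc asm unfolding encoded_by_def by blast
  then show "{i, j} \<in> pairs m"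
  proof cases
    case 2
    then have "matched w i j'" using pair_matched[OF pm nc enc conv] by blast
    then show ?thesis using 2 asm matched_unique_right by blast
  next
    case 1
    \<comment> \<open>Were i a singleton decorated L, no singleton decorated R could follow it and
      no pair could straddle it. So every R in (i, j] has its partner L in (i, j], and the rise
      there is nonnegative, whereas the excursion ending at j gives -1.\<close>
    have "card {y \<in> {i<..j}. w y = R} \<le> card {y \<in> {i<..j}. w y = L}"
    proof (rule card_letter_le[OF pm])
      fix y assume y: "y \<in> {i<..j}" "w y = R"
      then have yA: "y \<in> A" using conv asm by (meson atLeastAtMost_iff greaterThanAtMost_iff less_imp_le subsetD)
      have "sing m y \<noteq> Some L" using y encoded_sing[OF pm enc, of y L] by auto
      moreover have "sing m y \<noteq> Some R" using nc 1 y unfolding noncrossing_def by force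
      ultimately have "sing m y = None" by (metis not_None_eq letter.exhaust)
      then obtain z where z: "{y, z} \<in> pairs m" using pair_or_sing[OF pm yA] by auto
      have zy: "z < y" using encoded_pair[OF pm enc z] y pair_distinct[OF pm z] by auto
      have "z \<noteq> i" using sing_unpaired[OF pm 1, of y] z by (auto simp: insert_commute)
      moreover have "\<not> z < i" using nc 1 z y zy unfolding noncrossing_def
        by (metis greaterThanAtMost_iff insert_commute option.distinct(1))
      ultimately have "z > i" by simp
      moreover have "w z = L" using encoded_pair[OF pm enc, of z y] z zy by (simp add: insert_commute)
      ultimately show "\<exists>z\<in>{i<..j}. {y, z} \<in> pairs m \<and> w z = L" using z zy y by auto
    qed simp
    then have "0 \<le> rise w {i<..j}" by (simp add: rise_card)
    then show ?thesis using asm \<open>i < j\<close> by (simp add: rise_interval matched_iff_potential)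
  qed
qed

lemma matching_unique:
  assumes m: "partial_matching A m" "noncrossing m" "encoded_by A w m"
    and m': "partial_matching A m'" "noncrossing m'" "encoded_by A w m'"
    and conv: "\<forall>x\<in>A. \<forall>z\<in>A. {x..z} \<subseteq> A"
  shows "m = m'"
proof -
  have "{i, j} \<in> pairs m \<longleftrightarrow> {i, j} \<in> pairs m'" if "i < j" for i j
    using pairs_iff_matched[OF m conv that] pairs_iff_matched[OF m' conv that] by simp
  then have p: "pairs m = pairs m'"
    using pair_elements[OF m(1)] pair_elements[OF m'(1)] by blast
  have s: "sing m i = sing m' i" for i
  proof (cases "i \<in> A \<and> (\<nexists>j. {i, j} \<in> pairs m)")
    case True
    then have "\<exists>l. sing m i = Some l" "\<exists>l. sing m' i = Some l"
      using pair_or_sing[OF m(1), of i] pair_or_sing[OF m'(1), of i] p by auto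
    then show ?thesis using encoded_sing[OF m(1,3)] encoded_sing[OF m'(1,3)] by metis
  next
    case False
    then have "sing m i = None" "sing m' i = None"
      using sing_in[OF m(1)] sing_in[OF m'(1)] sing_unpaired[OF m(1)] sing_unpaired[OF m'(1)] p
      by (metis not_None_eq)+
    then show ?thesis by simp
  qed
  then have "sing m = sing m'" by blast
  then show ?thesis using p by (simp add: pmatching.expand)
qed

lemma decode_eqI:
  assumes "partial_matching {a..b} m" "noncrossing m" "encoded_by {a..b} w m"
  shows "decode {a..b} w = m"
  unfolding decode_def
  by (rule the_equality) (use assms matching_unique[where A = "{a..b}"] in auto)

lemma noodle_matching_pairs:
  assumes "noodle_matching w m" "i < j"
  shows "{i, j} \<in> pairs m \<longleftrightarrow> matched w i j"
  using assms pairs_iff_matched[where A = UNIV] unfolding noodle_matching_def by auto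

lemma noodle_matching_unique: "noodle_matching w m \<Longrightarrow> noodle_matching w m' \<Longrightarrow> m = m'"
  unfolding noodle_matching_def using matching_unique[where A = UNIV] by blast

lemma noodle_matching_matched:
  assumes "noodle_matching w m"
  shows "\<exists>j. matched w i j \<or> matched w j i"
proof -
  have pm: "partial_matching UNIV m" and "sing m i = None"
    using assms by (auto simp: noodle_matching_def)
  then obtain j where j: "{i, j} \<in> pairs m" using pair_or_sing[OF pm, of i] by auto
  then have "i < j \<or> j < i" using pair_distinct[OF pm] by force
  then show ?thesis using noodle_matching_pairs[OF assms] j by (metis insert_commute)
qed

text \<open>The first-return pairs of a word never cross; covering every integer is the only
  property that can fail, and it is the assumption.\<close>

lemma matched_noodle_matching:
  assumes "\<And>i. \<exists>j. matched w i j \<or> matched w j i"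
  shows "noodle_matching w (PMatching {{i, j} | i j. matched w i j} Map.empty)"
    (is "noodle_matching w ?m")
proof -
  have pr: "{i, j} \<in> pairs ?m \<longleftrightarrow> matched w i j \<or> matched w j i" for i j
    by (auto simp: doubleton_eq_iff)
  have lt: "matched w i j \<Longrightarrow> i < j" for i j by (simp add: matched_def)
  have "partial_matching UNIV ?m"
  proof (rule partial_matchingI)
    fix p assume "p \<in> pairs ?m"
    then obtain i j where "p = {i, j}" "matched w i j" by auto
    then show "\<exists>i j. i \<noteq> j \<and> p = {i, j} \<and> i \<in> UNIV \<and> j \<in> UNIV"
      using lt by (intro exI[of _ i] exI[of _ j]) force
  next
    show "j = k" if "{i, j} \<in> pairs ?m" "{i, k} \<in> pairs ?m" for i j k
      using that unfolding pr
      by (meson matched_unique_left matched_unique_right matched_not_both)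
    show "\<exists>j. {i, j} \<in> pairs ?m" for i using assms[of i] unfolding pr .
  qed simp_all
  moreover have "noncrossing ?m"
  proof -
    have "\<not> ({i, k} \<in> pairs ?m \<and> {j, l} \<in> pairs ?m)" if "i < j" "j < k" "k < l" for i j k l
      using matched_noncrossing[of w i k j l] that lt[of k i] lt[of l j] unfolding pr by auto
    then show ?thesis unfolding noncrossing_def pmatching.sel(2) by blast
  qed
  moreover have "encoded_by UNIV w ?m" unfolding encoded_by_def
  proof
    fix i
    have "w i = L \<longleftrightarrow> (\<exists>j>i. {i, j} \<in> pairs ?m)"
    proof
      assume "w i = L"
      moreover obtain j where j: "matched w i j \<or> matched w j i" using assms by blast
      ultimately have "matched w i j" by (auto simp: matched_def)
      then show "\<exists>j>i. {i, j} \<in> pairs ?m" using lt pr by blast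
    next
      assume "\<exists>j>i. {i, j} \<in> pairs ?m"
      then obtain j where "j > i" "matched w i j" unfolding pr using lt by (metis order_less_asym)
      then show "w i = L" by (simp add: matched_def)
    qed
    then show "w i = L \<longleftrightarrow> sing ?m i = Some L \<or> (\<exists>j>i. {i, j} \<in> pairs ?m)"
      unfolding pmatching.sel(2) by simp
  qed
  ultimately show ?thesis unfolding noodle_matching_def by simp
qed

text \<open>Existence and uniqueness of a global matching become countably many conditions, each on
  a single point. In this form they are measurable and can be shown almost surely one at a
  time.\<close>

lemma noodle_exists_iff:
  "noodle_exists w \<longleftrightarrow> (\<forall>s i. \<exists>j. matched (w s) i j \<or> matched (w s) j i)"
proof
  assume "noodle_exists w"
  then show "\<forall>s i. \<exists>j. matched (w s) i j \<or> matched (w s) j i"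
    unfolding noodle_exists_def using noodle_matching_matched by blast
next
  assume "\<forall>s i. \<exists>j. matched (w s) i j \<or> matched (w s) j i"
  then have "\<exists>m. noodle_matching (w s) m" for s
    using matched_noodle_matching[of "w s"] by (intro exI) blast
  then show "noodle_exists w"
    unfolding noodle_exists_def using noodle_matching_unique by (metis (full_types))
qed

lemma noodle_matching_noodle:
  assumes "noodle_exists w"
  shows "noodle_matching (w s) (noodle w s)"
  using assms theI'[of "noodle_matching (w s)"] unfolding noodle_exists_def noodle_def by auto

section \<open>Independent uniform letters\<close>

text \<open>The set S of coordinates does double duty: finiteness of S gives measurability, and
  disjoint sets S give independence.\<close>

definition depends_on :: "'i set \<Rightarrow> (('i \<Rightarrow> letter) \<Rightarrow> bool) \<Rightarrow> bool" where
  "depends_on S Q \<longleftrightarrow> (\<forall>v v'. (\<forall>i\<in>S. v i = v' i) \<longrightarrow> Q v = Q v')"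

lemma depends_onD: "depends_on S Q \<Longrightarrow> (\<And>i. i \<in> S \<Longrightarrow> v i = v' i) \<Longrightarrow> Q v = Q v'"
  unfolding depends_on_def by blast

lemma UNIV_letter: "(UNIV :: letter set) = {L, R}"
  by (auto intro: letter.exhaust)

instance letter :: finite
  by standard (simp add: UNIV_letter)

lemma UNIV_side: "(UNIV :: side set) = {Upper, Lower}"
  by (auto intro: side.exhaust)

instance side :: finite
  by standard (simp add: UNIV_side)

text \<open>With finitely many coordinates and two letters the product space is finite, and each of
  its points is a measurable box.\<close>

lemma sets_PiM_letter:
  assumes "finite S" "A \<subseteq> (\<Pi>\<^sub>E i\<in>S. UNIV :: letter set)"
  shows "A \<in> sets (\<Pi>\<^sub>M i\<in>S. count_space UNIV)"
proof -
  have fin: "finite A" using assms finite_PiE[of S "\<lambda>_. UNIV :: letter set"] finite_subset by auto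
  have "{v} \<in> sets (\<Pi>\<^sub>M i\<in>S. count_space UNIV)" if "v \<in> A" for v
  proof -
    have "v \<in> extensional S" using that assms(2) by (auto simp: PiE_def)
    then have "{v} = (\<Pi>\<^sub>E i\<in>S. {v i})" by (auto simp: PiE_def extensional_def fun_eq_iff Pi_def) metis
    then show ?thesis using assms(1) by (auto intro!: sets_PiM_I_finite)
  qed
  then have "(\<Union>v\<in>A. {v}) \<in> sets (\<Pi>\<^sub>M i\<in>S. count_space UNIV)" using fin by (intro sets.finite_UN)
  then show ?thesis by simp
qed

text \<open>A single independent family indexed by side and position covers both the letters within
  a word and the independence of the two words.\<close>

locale iid_letters = prob_space M for M :: "'w measure" +
  fixes X :: "side \<times> int \<Rightarrow> 'w \<Rightarrow> letter"
  assumes indep: "indep_vars (\<lambda>_. count_space UNIV) X UNIV"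
    and unif: "\<And>p. distr M (count_space UNIV) (X p) = uniform_count_measure {L, R}"
begin

abbreviation letters :: "'w \<Rightarrow> side \<times> int \<Rightarrow> letter" where
  "letters \<omega> \<equiv> \<lambda>p. X p \<omega>"

lemma letter_measurable: "X p \<in> measurable M (count_space UNIV)"
  using indep unfolding indep_vars_def by blast

lemma prob_letter: "prob {\<omega> \<in> space M. X p \<omega> = a} = 1 / 2"
proof -
  have "prob {\<omega> \<in> space M. X p \<omega> = a} = measure (distr M (count_space UNIV) (X p)) {a}"
    using letter_measurable by (subst measure_distr) (auto intro!: arg_cong[where f = prob])
  also have "\<dots> = 1 / 2"
    unfolding unif by (subst measure_uniform_count_measure) (cases a; simp)+
  finally show ?thesis .
qed

lemma depends_on_restrict:
  assumes "depends_on S Q"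
  shows "{\<omega> \<in> space M. Q (letters \<omega>)} =
    (\<lambda>\<omega>. restrict (letters \<omega>) S) -` {v \<in> (\<Pi>\<^sub>E i\<in>S. UNIV). Q v} \<inter> space M"
proof -
  have "Q (restrict (letters \<omega>) S) = Q (letters \<omega>)" for \<omega>
    by (rule depends_onD[OF assms]) simp
  then show ?thesis by auto
qed

lemma depends_on_event:
  assumes "finite S" "depends_on S Q"
  shows "{\<omega> \<in> space M. Q (letters \<omega>)} \<in> events"
proof -
  have "(\<lambda>\<omega>. restrict (letters \<omega>) S) \<in> measurable M (\<Pi>\<^sub>M i\<in>S. count_space UNIV)"
    by (intro measurable_restrict letter_measurable)
  moreover have "{v \<in> (\<Pi>\<^sub>E i\<in>S. UNIV). Q v} \<in> sets (\<Pi>\<^sub>M i\<in>S. count_space UNIV)"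
    by (rule sets_PiM_letter) (use assms in auto)
  ultimately show ?thesis unfolding depends_on_restrict[OF assms(2)] by (rule measurable_sets)
qed

lemma prob_all_disjoint:
  assumes "finite J" and fin: "\<And>j. j \<in> J \<Longrightarrow> finite (S j)"
    and dep: "\<And>j. j \<in> J \<Longrightarrow> depends_on (S j) (Q j)"
    and disj: "disjoint_family_on S J"
  shows "prob {\<omega> \<in> space M. \<forall>j\<in>J. Q j (letters \<omega>)} =
    (\<Prod>j\<in>J. prob {\<omega> \<in> space M. Q j (letters \<omega>)})"
\<comment> \<open>Both the product rule for independent variables and the rewriting as an
  intersection need a nonempty index set.\<close>
proof (cases "J = {}")
  case True
  then show ?thesis by (simp add: prob_space)
next
  case False
  let ?A = "\<lambda>j. {v \<in> (\<Pi>\<^sub>E i\<in>S j. UNIV). Q j v}"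
  let ?Y = "\<lambda>j \<omega>. restrict (letters \<omega>) (S j)"
  have ind: "indep_vars (\<lambda>j. PiM (S j) (\<lambda>_. count_space UNIV)) ?Y J"
    by (rule indep_vars_restrict[OF indep _ disj]) simp
  have eq: "{\<omega> \<in> space M. Q j (letters \<omega>)} = ?Y j -` ?A j \<inter> space M" if "j \<in> J" for j
    by (rule depends_on_restrict[OF dep[OF that]])
  have "{\<omega> \<in> space M. \<forall>j\<in>J. Q j (letters \<omega>)} = (\<Inter>j\<in>J. {\<omega> \<in> space M. Q j (letters \<omega>)})"
    using False by auto
  also have "\<dots> = (\<Inter>j\<in>J. ?Y j -` ?A j \<inter> space M)"
    using eq by (intro INF_cong refl) simp
  also have "prob \<dots> = (\<Prod>j\<in>J. prob (?Y j -` ?A j \<inter> space M))"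
    by (rule indep_varsD_finite[OF ind False assms(1)]) (use fin in \<open>auto intro: sets_PiM_letter\<close>)
  also have "\<dots> = (\<Prod>j\<in>J. prob {\<omega> \<in> space M. Q j (letters \<omega>)})"
    using eq by (intro prod.cong) auto
  finally show ?thesis .
qed

lemma prob_conj_disjoint:
  assumes "finite S" "finite T" "depends_on S Q" "depends_on T Q'" "S \<inter> T = {}"
  shows "prob {\<omega> \<in> space M. Q (letters \<omega>) \<and> Q' (letters \<omega>)} =
    prob {\<omega> \<in> space M. Q (letters \<omega>)} * prob {\<omega> \<in> space M. Q' (letters \<omega>)}"
proof -
  let ?S = "\<lambda>b. if b then S else T" and ?Q = "\<lambda>b. if b then Q else Q'"
  have "prob {\<omega> \<in> space M. \<forall>b\<in>UNIV. ?Q b (letters \<omega>)} =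
      (\<Prod>b\<in>UNIV. prob {\<omega> \<in> space M. ?Q b (letters \<omega>)})"
    by (rule prob_all_disjoint[of UNIV ?S ?Q])
      (use assms in \<open>auto simp: disjoint_family_on_def\<close>)
  moreover have "(\<forall>b\<in>UNIV. ?Q b v) \<longleftrightarrow> Q v \<and> Q' v" for v by (simp add: all_bool_eq)
  ultimately show ?thesis by (simp add: UNIV_bool mult.commute)
qed

end

section \<open>Ballot numbers\<close>

text \<open>\<open>walks n x\<close> counts the \<open>\<plusminus>1\<close> walks of length \<open>n\<close> from \<open>0\<close> to \<open>x\<close>.\<close>

fun walks :: "nat \<Rightarrow> int \<Rightarrow> real" where
  "walks 0 x = (if x = 0 then 1 else 0)"
| "walks (Suc n) x = walks n (x - 1) + walks n (x + 1)"

lemma walks_outside: "int n < \<bar>x\<bar> \<Longrightarrow> walks n x = 0"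
  by (induction n arbitrary: x) auto

lemma walks_parity: "odd (int n + x) \<Longrightarrow> walks n x = 0"
  by (induction n arbitrary: x) (auto simp: algebra_simps)

lemma walks_uminus: "walks n (- x) = walks n x"
proof (induction n arbitrary: x)
  case (Suc n)
  have "- x - 1 = - (x + 1)" "- x + 1 = - (x - 1)" by auto
  then show ?case unfolding walks.simps using Suc by (metis add.commute)
qed simp

text \<open>Here j is the number of up-steps.\<close>

lemma walks_binomial: "walks n (2 * int j - int n) = real (n choose j)"
proof (induction n arbitrary: j)
  case (Suc n)
  show ?case
  proof (cases j)
    case 0
    then show ?thesis using Suc[of 0] walks_outside[of n "- int n - 2"]
      by (simp add: algebra_simps)
  next
    case (Suc i)
    have "2 * int j - int (Suc n) - 1 = 2 * int i - int n" "2 * int j - int (Suc n) + 1 = 2 * int j - int n"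
      using Suc by auto
    then show ?thesis unfolding walks.simps by (simp only: Suc.IH) (simp add: Suc)
  qed
qed auto

lemma walks_central: "walks (2 * m) 0 = real ((2 * m) choose m)"
  using walks_binomial[of "2 * m" m] by simp

text \<open>The reflection principle in numbers: walks from 0 to 0 that visit -1 are as many as
  walks from 0 to 2. Absorption identities give the ratio m / (m + 1) between the two
  binomials.\<close>

lemma catalan_walks: "walks (2 * m) 0 - walks (2 * m) 2 = catalan m"
proof -
  have w2: "walks (2 * m) 2 = real ((2 * m) choose (Suc m))"
    using walks_binomial[of "2 * m" "Suc m"] by (simp add: algebra_simps)
  have "Suc m * ((2 * m) choose Suc m) = (2 * m - m) * ((2 * m) choose m)"
    unfolding binomial_absorption binomial_absorb_comp ..
  then have "real (Suc m) * walks (2 * m) 2 = real m * walks (2 * m) 0"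
    unfolding w2 walks_central by (metis add_diff_cancel_left' mult_2 of_nat_mult)
  then show ?thesis unfolding catalan_def walks_central by (simp add: field_simps)
qed

text \<open>Used to sum ballot numbers over all final heights; the differences are at distance two,
  so two terms survive at each end.\<close>

lemma sum_telescope2:
  fixes f :: "int \<Rightarrow> real"
  shows "(\<Sum>h\<le>n. f (int h) - f (int h + 2)) = f 0 + f 1 - f (int n + 1) - f (int n + 2)"
  by (induction n) (auto simp: algebra_simps)

text \<open>A Wallis-type bound. The factor 2m + 1 makes the induction close: passing from m to m +
  1 multiplies the left side by (2m + 1)(2m + 3) / (2m + 2)^2, which is less than 1.\<close>

lemma central_binomial_decay: "(real ((2 * m) choose m) / 2 ^ (2 * m))\<^sup>2 * (2 * real m + 1) \<le> 1"
proof (induction m)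
  case (Suc m)
  let ?a = "\<lambda>m. real ((2 * m) choose m) / 2 ^ (2 * m)"
  have f: "fact (2 * Suc m) = (2 * real m + 2) * (2 * real m + 1) * fact (2 * m)"
    "fact (Suc m) = (real m + 1) * fact m"
    by (simp_all add: algebra_simps)
  have "real ((2 * Suc m) choose Suc m) = fact (2 * Suc m) / (fact (Suc m) * fact (Suc m))"
    by (subst binomial_fact) (simp_all del: fact_Suc add: mult_2)
  also have "\<dots> = (2 * (2 * real m + 1) / (real m + 1)) * (fact (2 * m) / (fact m * fact m))"
    unfolding f by (simp add: divide_simps) (simp add: algebra_simps)
  also have "fact (2 * m) / (fact m * fact m) = real ((2 * m) choose m)"
    by (subst binomial_fact) (simp_all del: fact_Suc add: mult_2)
  finally have c: "real ((2 * Suc m) choose Suc m) =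
    (2 * (2 * real m + 1) / (real m + 1)) * real ((2 * m) choose m)" .
  have a: "?a (Suc m) = ?a m * ((2 * real m + 1) / (2 * real m + 2))"
    unfolding c by (simp add: divide_simps) (simp add: algebra_simps)
  have "(?a (Suc m))\<^sup>2 * (2 * real (Suc m) + 1) =
      ((?a m)\<^sup>2 * (2 * real m + 1)) * ((2 * real m + 1) * (2 * real m + 3) / (2 * real m + 2)\<^sup>2)"
    unfolding a power_mult_distrib power_divide by (simp add: power2_eq_square algebra_simps)
  also have "\<dots> \<le> 1 * 1"
  proof (rule mult_mono[OF Suc])
    have "(2 * real m + 1) * (2 * real m + 3) \<le> (2 * real m + 2)\<^sup>2"
      by (simp add: power2_eq_square algebra_simps)
    moreover have "(0 :: real) < (2 * real m + 2)\<^sup>2" by simp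
    ultimately show "(2 * real m + 1) * (2 * real m + 3) / (2 * real m + 2)\<^sup>2 \<le> 1"
      by (subst divide_le_eq_1_pos)
  qed simp_all
  finally show ?case by simp
qed simp

lemma central_binomial_tendsto_0: "(\<lambda>m. real ((2 * m) choose m) / 2 ^ (2 * m)) \<longlonglongrightarrow> 0"
proof (rule tendsto_sandwich[OF _ _ tendsto_const])
  have "real ((2 * m) choose m) / 2 ^ (2 * m) \<le> sqrt (1 / (2 * real m + 1))" for m
    using central_binomial_decay[of m] by (intro real_le_rsqrt) (simp add: pos_le_divide_eq)
  then show "\<forall>\<^sub>F m in sequentially. real ((2 * m) choose m) / 2 ^ (2 * m) \<le> sqrt (1 / (2 * real m + 1))"
    by simp
  have "(\<lambda>m. 1 / (2 * real m + 1)) \<longlonglongrightarrow> 0" by real_asymp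
  then show "(\<lambda>m. sqrt (1 / (2 * real m + 1))) \<longlonglongrightarrow> 0" using tendsto_real_sqrt by fastforce
qed simp

section \<open>Adding a last or a first letter; the coordinates on which the conditions
  depend\<close>

lemma nonneg_prefixes_rise:
  assumes "finite J" "nonneg_prefixes w J"
  shows "0 \<le> rise w J"
proof -
  have "J \<inter> {..Max J} = J" using assms(1) by auto
  then show ?thesis using assms(2) unfolding nonneg_prefixes_def by metis
qed

lemma nonpos_suffixes_rise:
  assumes "finite J" "nonpos_suffixes w J"
  shows "rise w J \<le> 0"
proof -
  have "J \<inter> {Min J..} = J" using assms(1) by auto
  then show ?thesis using assms(2) unfolding nonpos_suffixes_def by metis
qed

lemma nonneg_prefixes_insert:
  assumes "finite J" "\<And>y. y \<in> J \<Longrightarrow> y < m"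
  shows "nonneg_prefixes w (insert m J) \<longleftrightarrow> nonneg_prefixes w J \<and> 0 \<le> rise w (insert m J)"
proof
  assume nn: "nonneg_prefixes w (insert m J)"
  have "0 \<le> rise w (J \<inter> {..x})" for x
  proof -
    \<comment> \<open>Cutting at m - 1 at the latest hides the new last point and loses no point of
      J.\<close>
    have "J \<inter> {..x} = insert m J \<inter> {..min x (m - 1)}" using assms(2) by fastforce
    then show ?thesis using nn unfolding nonneg_prefixes_def by metis
  qed
  then show "nonneg_prefixes w J \<and> 0 \<le> rise w (insert m J)"
    using nonneg_prefixes_rise[OF _ nn] assms(1) unfolding nonneg_prefixes_def by simp
next
  assume nn: "nonneg_prefixes w J \<and> 0 \<le> rise w (insert m J)"
  show "nonneg_prefixes w (insert m J)" unfolding nonneg_prefixes_def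
  proof
    fix x
    have "insert m J \<inter> {..x} = (if m \<le> x then insert m J else J \<inter> {..x})"
      by (auto intro: order.trans[OF less_imp_le[OF assms(2)]])
    then show "0 \<le> rise w (insert m J \<inter> {..x})" using nn unfolding nonneg_prefixes_def by simp
  qed
qed

lemma nonpos_suffixes_insert:
  assumes "finite J" "\<And>y. y \<in> J \<Longrightarrow> m < y"
  shows "nonpos_suffixes w (insert m J) \<longleftrightarrow> nonpos_suffixes w J \<and> rise w (insert m J) \<le> 0"
proof
  assume nn: "nonpos_suffixes w (insert m J)"
  have "rise w (J \<inter> {x..}) \<le> 0" for x
  proof -
    have "J \<inter> {x..} = insert m J \<inter> {max x (m + 1)..}" using assms(2) by fastforce
    then show ?thesis using nn unfolding nonpos_suffixes_def by metis
  qed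
  then show "nonpos_suffixes w J \<and> rise w (insert m J) \<le> 0"
    using nonpos_suffixes_rise[OF _ nn] assms(1) unfolding nonpos_suffixes_def by simp
next
  assume nn: "nonpos_suffixes w J \<and> rise w (insert m J) \<le> 0"
  show "nonpos_suffixes w (insert m J)" unfolding nonpos_suffixes_def
  proof
    fix x
    have "insert m J \<inter> {x..} = (if x \<le> m then insert m J else J \<inter> {x..})"
      by (auto intro: order.trans[OF _ less_imp_le[OF assms(2)]])
    then show "rise w (insert m J \<inter> {x..}) \<le> 0" using nn unfolding nonpos_suffixes_def by simp
  qed
qed

lemma rise_cong: "(\<And>y. y \<in> J \<Longrightarrow> w y = w' y) \<Longrightarrow> rise w J = rise w' J"
  unfolding rise_def by (rule sum.cong) auto

text \<open>Each condition in use is a functional F of the map that sends a cut I to the rise on its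
  intersection with J. One statement therefore yields all instances, the whole of J being the cut
  \<open>UNIV\<close>.\<close>

lemma depends_on_rise: "depends_on (Pair s ` J) (\<lambda>v. F (\<lambda>I. rise (\<lambda>i. v (s, i)) (J \<inter> I)))"
proof -
  have "(\<lambda>I. rise (\<lambda>i. v (s, i)) (J \<inter> I)) = (\<lambda>I. rise (\<lambda>i. v' (s, i)) (J \<inter> I))"
    if "\<forall>p\<in>Pair s ` J. v p = v' p" for v v' :: "'a \<times> int \<Rightarrow> letter"
    using that by (intro ext rise_cong) auto
  then show ?thesis unfolding depends_on_def by metis
qed

lemma depends_on_prefixes:
  "depends_on (Pair s ` J) (\<lambda>v. nonneg_prefixes (\<lambda>i. v (s, i)) J)"
  "depends_on (Pair s ` J) (\<lambda>v. nonpos_suffixes (\<lambda>i. v (s, i)) J)"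
  "depends_on (Pair s ` J) (\<lambda>v. balanced (\<lambda>i. v (s, i)) J)"
  "depends_on (Pair s ` J) (\<lambda>v. nonneg_prefixes (\<lambda>i. v (s, i)) J \<and> rise (\<lambda>i. v (s, i)) J = h)"
  "depends_on (Pair s ` J) (\<lambda>v. nonpos_suffixes (\<lambda>i. v (s, i)) J \<and> rise (\<lambda>i. v (s, i)) J = h)"
  unfolding nonneg_prefixes_def nonpos_suffixes_def balanced_def
  using depends_on_rise[of s J "\<lambda>f. \<forall>x. 0 \<le> f {..x}"] depends_on_rise[of s J "\<lambda>f. \<forall>x. f {x..} \<le> 0"]
    depends_on_rise[of s J "\<lambda>f. (\<forall>x. 0 \<le> f {..x}) \<and> f UNIV = 0"]
    depends_on_rise[of s J "\<lambda>f. (\<forall>x. 0 \<le> f {..x}) \<and> f UNIV = h"]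
    depends_on_rise[of s J "\<lambda>f. (\<forall>x. f {x..} \<le> 0) \<and> f UNIV = h"]
  by simp_all

lemma depends_on_letter: "depends_on {p} (\<lambda>v. v p = a)"
  by (simp add: depends_on_def)

context iid_letters begin

text \<open>
  The letter that is removed is the last one for conditions on prefixes and the first one for
  conditions on suffixes. Starting at \<open>h = -1\<close>, where both sides vanish, makes the recursion uniform.
\<close>

lemma prob_ballot:
  fixes \<Phi> :: "(int \<Rightarrow> letter) \<Rightarrow> int set \<Rightarrow> int \<Rightarrow> bool"
  assumes empty: "\<And>w h. \<Phi> w {} h \<longleftrightarrow> h = 0"
    and nonneg: "\<And>w J h. finite J \<Longrightarrow> \<Phi> w J h \<Longrightarrow> 0 \<le> h"
    and dep: "\<And>J h. depends_on (Pair s ` J) (\<lambda>v. \<Phi> (\<lambda>i. v (s, i)) J h)"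
    and step: "\<And>J. finite J \<Longrightarrow> J \<noteq> {} \<Longrightarrow> \<exists>m\<in>J. \<forall>w. \<forall>h\<ge>0. \<Phi> w J h \<longleftrightarrow>
      w m = a \<and> \<Phi> w (J - {m}) (h - 1) \<or> w m \<noteq> a \<and> \<Phi> w (J - {m}) (h + 1)"
    and "finite J" "card J = n" "h \<ge> -1"
  shows "prob {\<omega> \<in> space M. \<Phi> (\<lambda>i. X (s, i) \<omega>) J h} = (walks n h - walks n (h + 2)) / 2 ^ n"
  using assms(5-)
proof (induction n arbitrary: J h)
  case 0
  then have "J = {}" by simp
  then show ?case using 0 by (cases "h = 0") (auto simp: empty prob_space)
next
  case (Suc n)
  show ?case
  proof (cases "h = -1")
    case True
    then have e: "{\<omega> \<in> space M. \<Phi> (\<lambda>i. X (s, i) \<omega>) J h} = {}"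
      using nonneg[OF Suc.prems(1)] by force
    \<comment> \<open>The levels h = -1 and h + 2 = 1 are mirror images, so the two walk counts
      cancel.\<close>
    show ?thesis unfolding e using True walks_uminus[of "Suc n" 1] by (simp del: walks.simps)
  next
    case False
    then have h: "h \<ge> 0" using Suc.prems by simp
    have "J \<noteq> {}" using Suc.prems by auto
    then obtain m where m: "m \<in> J"
      and eq: "\<And>w. \<Phi> w J h \<longleftrightarrow> w m = a \<and> \<Phi> w (J - {m}) (h - 1) \<or> w m \<noteq> a \<and> \<Phi> w (J - {m}) (h + 1)"
      using step[OF Suc.prems(1)] h by blast
    obtain b where b: "\<And>x. x \<noteq> a \<longleftrightarrow> x = b" using not_L not_R by (metis letter.exhaust)
    have ab: "a \<noteq> b" using b by blast
    have fin: "finite (J - {m})" and card: "card (J - {m}) = n" using Suc.prems m by auto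
    let ?E = "\<lambda>c h. {\<omega> \<in> space M. X (s, m) \<omega> = c \<and> \<Phi> (\<lambda>i. X (s, i) \<omega>) (J - {m}) h}"
    have P: "prob (?E c h') = 1 / 2 * ((walks n h' - walks n (h' + 2)) / 2 ^ n)" if "h' \<ge> -1" for c h'
      using prob_conj_disjoint[OF _ _ depends_on_letter dep, of "(s, m)" "J - {m}" c h'] fin
        Suc.IH[OF fin card that] prob_letter by auto
    have ev: "?E c h' \<in> events" for c h'
    proof -
      have "{\<omega> \<in> space M. X (s, m) \<omega> = c} \<in> events"
        using depends_on_event[OF _ depends_on_letter] by auto
      moreover have "{\<omega> \<in> space M. \<Phi> (\<lambda>i. X (s, i) \<omega>) (J - {m}) h'} \<in> events"
        using depends_on_event[OF _ dep] fin by auto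
      ultimately show ?thesis by (rule sets.sets_Collect_conj[rotated])
    qed
    have split: "{\<omega> \<in> space M. \<Phi> (\<lambda>i. X (s, i) \<omega>) J h} = ?E a (h - 1) \<union> ?E b (h + 1)"
      unfolding eq b by auto
    have "prob {\<omega> \<in> space M. \<Phi> (\<lambda>i. X (s, i) \<omega>) J h} = prob (?E a (h - 1)) + prob (?E b (h + 1))"
      unfolding split
    proof (rule finite_measure_Union)
      show "?E a (h - 1) \<in> events" "?E b (h + 1) \<in> events" by (rule ev)+
      show "?E a (h - 1) \<inter> ?E b (h + 1) = {}" using ab by blast
    qed
    also have "\<dots> = (walks (Suc n) h - walks (Suc n) (h + 2)) / 2 ^ Suc n"
    proof -
      have le: "h - 1 \<ge> -1" "h + 1 \<ge> -1"
        using h by auto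
      have half: "1 / 2 * ((x - y) / 2 ^ n) + 1 / 2 * ((x' - y') / 2 ^ n) = (x + x' - (y + y')) / 2 ^ Suc n"
        for x y x' y' :: real
        by (simp add: field_simps)
      have "prob (?E a (h - 1)) + prob (?E b (h + 1)) =
          1 / 2 * ((walks n (h - 1) - walks n (h - 1 + 2)) / 2 ^ n) +
          1 / 2 * ((walks n (h + 1) - walks n (h + 1 + 2)) / 2 ^ n)"
        by (intro arg_cong2[where f = "(+)"] P le)
      also have "\<dots> = (walks n (h - 1) + walks n (h + 1) - (walks n (h - 1 + 2) + walks n (h + 1 + 2))) / 2 ^ Suc n"
        by (rule half)
      also have "\<dots> = (walks (Suc n) h - walks (Suc n) (h + 2)) / 2 ^ Suc n"
        by (simp add: algebra_simps)
      finally show ?thesis .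
    qed
    finally show ?thesis .
  qed
qed

text \<open>The point removed is the maximum. For h at least 0 the extra requirement that the full
  rise be nonnegative is automatic, so only the level h moves by one.\<close>

lemma prob_nonneg_rise:
  assumes "finite J" "h \<ge> 0"
  shows "prob {\<omega> \<in> space M. nonneg_prefixes (\<lambda>i. X (s, i) \<omega>) J \<and> rise (\<lambda>i. X (s, i) \<omega>) J = h} =
    (walks (card J) h - walks (card J) (h + 2)) / 2 ^ card J"
proof (rule prob_ballot[where a = L and \<Phi> = "\<lambda>w J h. nonneg_prefixes w J \<and> rise w J = h"])
  fix J :: "int set" assume J: "finite J" "J \<noteq> {}"
  have max: "Max J \<in> J" "\<And>y. y \<in> J - {Max J} \<Longrightarrow> y < Max J"
    using J by (auto simp: order_less_le)
  have J': "insert (Max J) (J - {Max J}) = J" using max by auto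
  show "\<exists>m\<in>J. \<forall>w. \<forall>h\<ge>0. nonneg_prefixes w J \<and> rise w J = h \<longleftrightarrow>
      w m = L \<and> nonneg_prefixes w (J - {m}) \<and> rise w (J - {m}) = h - 1 \<or>
      w m \<noteq> L \<and> nonneg_prefixes w (J - {m}) \<and> rise w (J - {m}) = h + 1"
  proof (intro bexI allI impI)
    fix w :: "int \<Rightarrow> letter" and h :: int assume "0 \<le> h"
    have "rise w J = (if w (Max J) = L then 1 else -1) + rise w (J - {Max J})"
      using rise_insert[of "J - {Max J}" "Max J" w] J J' by auto
    moreover have "nonneg_prefixes w J \<longleftrightarrow> nonneg_prefixes w (J - {Max J}) \<and> 0 \<le> rise w J"
      using nonneg_prefixes_insert[of "J - {Max J}" "Max J" w] J J' max by auto
    ultimately show "nonneg_prefixes w J \<and> rise w J = h \<longleftrightarrow>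
      w (Max J) = L \<and> nonneg_prefixes w (J - {Max J}) \<and> rise w (J - {Max J}) = h - 1 \<or>
      w (Max J) \<noteq> L \<and> nonneg_prefixes w (J - {Max J}) \<and> rise w (J - {Max J}) = h + 1"
      using \<open>0 \<le> h\<close> by (cases "w (Max J)") auto
  qed (rule max)
qed (use assms nonneg_prefixes_rise depends_on_prefixes in \<open>auto simp: nonneg_prefixes_def\<close>)

text \<open>The mirror image: the level h is minus the rise, so R is now the letter that increases
  it, and the minimum is removed.\<close>

lemma prob_nonpos_rise:
  assumes "finite J" "h \<ge> 0"
  shows "prob {\<omega> \<in> space M. nonpos_suffixes (\<lambda>i. X (s, i) \<omega>) J \<and> rise (\<lambda>i. X (s, i) \<omega>) J = - h} =
    (walks (card J) h - walks (card J) (h + 2)) / 2 ^ card J"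
proof (rule prob_ballot[where a = R and \<Phi> = "\<lambda>w J h. nonpos_suffixes w J \<and> rise w J = - h"])
  fix J :: "int set" assume J: "finite J" "J \<noteq> {}"
  have min: "Min J \<in> J" "\<And>y. y \<in> J - {Min J} \<Longrightarrow> Min J < y"
    using J by (auto simp: order_less_le)
  have J': "insert (Min J) (J - {Min J}) = J" using min by auto
  show "\<exists>m\<in>J. \<forall>w. \<forall>h\<ge>0. nonpos_suffixes w J \<and> rise w J = - h \<longleftrightarrow>
      w m = R \<and> nonpos_suffixes w (J - {m}) \<and> rise w (J - {m}) = - (h - 1) \<or>
      w m \<noteq> R \<and> nonpos_suffixes w (J - {m}) \<and> rise w (J - {m}) = - (h + 1)"
  proof (intro bexI allI impI)
    fix w :: "int \<Rightarrow> letter" and h :: int assume "0 \<le> h"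
    have "rise w J = (if w (Min J) = L then 1 else -1) + rise w (J - {Min J})"
      using rise_insert[of "J - {Min J}" "Min J" w] J J' by auto
    moreover have "nonpos_suffixes w J \<longleftrightarrow> nonpos_suffixes w (J - {Min J}) \<and> rise w J \<le> 0"
      using nonpos_suffixes_insert[of "J - {Min J}" "Min J" w] J J' min by auto
    ultimately show "nonpos_suffixes w J \<and> rise w J = - h \<longleftrightarrow>
      w (Min J) = R \<and> nonpos_suffixes w (J - {Min J}) \<and> rise w (J - {Min J}) = - (h - 1) \<or>
      w (Min J) \<noteq> R \<and> nonpos_suffixes w (J - {Min J}) \<and> rise w (J - {Min J}) = - (h + 1)"
      using \<open>0 \<le> h\<close> by (cases "w (Min J)") auto
  qed (rule min)
next
  show "0 \<le> h" if "finite J" "nonpos_suffixes w J \<and> rise w J = - h" for w J h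
    using nonpos_suffixes_rise[of J w] that by auto
qed (use assms depends_on_prefixes in \<open>auto simp: nonpos_suffixes_def\<close>)

lemma prob_balanced:
  assumes "finite J" "card J = 2 * m"
  shows "prob {\<omega> \<in> space M. balanced (\<lambda>i. X (s, i) \<omega>) J} = catalan m / 2 ^ (2 * m)"
  using prob_nonneg_rise[OF assms(1), of 0 s] catalan_walks[of m] assms(2)
  unfolding balanced_def by simp

text \<open>Of the four boundary terms of the telescoping sum, two lie beyond the length of the walk
  and one has the wrong parity; only the walks returning to 0 remain.\<close>

lemma sum_walks:
  "(\<Sum>h\<le>2 * m. (walks (2 * m) (int h) - walks (2 * m) (int h + 2)) / 2 ^ (2 * m)) =
     real ((2 * m) choose m) / 2 ^ (2 * m)"
proof -
  have "walks (2 * m) (int (2 * m) + 1) = 0" "walks (2 * m) (int (2 * m) + 2) = 0" "walks (2 * m) 1 = 0"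
    by (auto intro: walks_outside walks_parity)
  then show ?thesis
    using sum_telescope2[of "walks (2 * m)" "2 * m"] walks_central[of m]
    by (simp flip: sum_divide_distrib)
qed

lemma abs_rise_le: "finite J \<Longrightarrow> \<bar>rise w J\<bar> \<le> int (card J)"
  unfolding rise_def using sum_abs[of "\<lambda>y. if w y = L then 1 else - 1 :: int" J]
  by (intro order_trans[OF sum_abs]) (simp add: if_distrib cong: if_cong)

text \<open>Splitting by the final height turns the probability into the telescoping sum of ballot
  numbers.\<close>

lemma prob_nonneg_prefixes:
  assumes "finite J" "card J = 2 * m"
  shows "prob {\<omega> \<in> space M. nonneg_prefixes (\<lambda>i. X (s, i) \<omega>) J} = real ((2 * m) choose m) / 2 ^ (2 * m)"
proof -
  let ?E = "\<lambda>h. {\<omega> \<in> space M. nonneg_prefixes (\<lambda>i. X (s, i) \<omega>) J \<and> rise (\<lambda>i. X (s, i) \<omega>) J = int h}"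
  have "\<exists>h\<le>2 * m. rise w J = int h" if "nonneg_prefixes w J" for w
    using nonneg_prefixes_rise[OF assms(1) that] abs_rise_le[OF assms(1), of w] assms(2)
    by (intro exI[of _ "nat (rise w J)"]) auto
  then have split: "{\<omega> \<in> space M. nonneg_prefixes (\<lambda>i. X (s, i) \<omega>) J} = (\<Union>h\<in>{..2 * m}. ?E h)" by auto
  have "prob {\<omega> \<in> space M. nonneg_prefixes (\<lambda>i. X (s, i) \<omega>) J} = (\<Sum>h\<le>2 * m. prob (?E h))"
    unfolding split
  proof (rule finite_measure_finite_Union)
    show "?E ` {..2 * m} \<subseteq> events"
      using depends_on_event[OF _ depends_on_prefixes(4)] assms(1) by auto
  qed (auto simp: disjoint_family_on_def)
  also have "\<dots> = (\<Sum>h\<le>2 * m. (walks (2 * m) (int h) - walks (2 * m) (int h + 2)) / 2 ^ (2 * m))"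
    using prob_nonneg_rise[OF assms(1)] assms(2) by (intro sum.cong) auto
  finally show ?thesis by (simp only: sum_walks)
qed

lemma prob_nonpos_suffixes:
  assumes "finite J" "card J = 2 * m"
  shows "prob {\<omega> \<in> space M. nonpos_suffixes (\<lambda>i. X (s, i) \<omega>) J} = real ((2 * m) choose m) / 2 ^ (2 * m)"
proof -
  let ?E = "\<lambda>h. {\<omega> \<in> space M. nonpos_suffixes (\<lambda>i. X (s, i) \<omega>) J \<and> rise (\<lambda>i. X (s, i) \<omega>) J = - int h}"
  have "\<exists>h\<le>2 * m. rise w J = - int h" if "nonpos_suffixes w J" for w
    using nonpos_suffixes_rise[OF assms(1) that] abs_rise_le[OF assms(1), of w] assms(2)
    by (intro exI[of _ "nat (- rise w J)"]) auto
  then have split: "{\<omega> \<in> space M. nonpos_suffixes (\<lambda>i. X (s, i) \<omega>) J} = (\<Union>h\<in>{..2 * m}. ?E h)" by auto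
  have "prob {\<omega> \<in> space M. nonpos_suffixes (\<lambda>i. X (s, i) \<omega>) J} = (\<Sum>h\<le>2 * m. prob (?E h))"
    unfolding split
  proof (rule finite_measure_finite_Union)
    show "?E ` {..2 * m} \<subseteq> events"
      using depends_on_event[OF _ depends_on_prefixes(5)] assms(1) by auto
  qed (auto simp: disjoint_family_on_def)
  also have "\<dots> = (\<Sum>h\<le>2 * m. (walks (2 * m) (int h) - walks (2 * m) (int h + 2)) / 2 ^ (2 * m))"
    using prob_nonpos_rise[OF assms(1)] assms(2) by (intro sum.cong) auto
  finally show ?thesis by (simp only: sum_walks)
qed

text \<open>The event that all \<open>Q m\<close> hold is bounded by each single probability, and
  these tend to 0.\<close>

lemma AE_not_all:
  assumes "\<And>m. {\<omega> \<in> space M. Q m \<omega>} \<in> events"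
    and "\<And>m. prob {\<omega> \<in> space M. Q m \<omega>} = real ((2 * m) choose m) / 2 ^ (2 * m)"
  shows "AE \<omega> in M. \<exists>m. \<not> Q m \<omega>"
proof -
  let ?N = "\<Inter>m. {\<omega> \<in> space M. Q m \<omega>}"
  have N: "?N \<in> events" using assms(1) by blast
  have "prob ?N \<le> real ((2 * m) choose m) / 2 ^ (2 * m)" for m
    unfolding assms(2)[symmetric] by (rule finite_measure_mono) (use assms(1) in auto)
  then have "prob ?N \<le> 0"
    by (intro LIMSEQ_le_const[OF central_binomial_tendsto_0]) auto
  then have "emeasure M ?N = 0"
    unfolding emeasure_eq_measure by (rule ennreal_neg)
  then show ?thesis by (intro AE_I[OF _ _ N]) auto
qed

lemma AE_noodle_exists: "AE \<omega> in M. noodle_exists (\<lambda>s i. X (s, i) \<omega>)"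
proof -
  have "AE \<omega> in M. \<exists>j. matched (\<lambda>i. X (s, i) \<omega>) i j \<or> matched (\<lambda>i. X (s, i) \<omega>) j i" for s i
  proof -
    let ?w = "\<lambda>\<omega> i. X (s, i) \<omega>"
    \<comment> \<open>Windows of even length are enough to exclude an unmatched L at i, and their
      probability is exactly the central binomial ratio.\<close>
    have "AE \<omega> in M. \<exists>m. \<not> nonneg_prefixes (?w \<omega>) {i<..i + 2 * int m}"
      by (rule AE_not_all)
        (auto intro!: depends_on_event[OF _ depends_on_prefixes(1)] prob_nonneg_prefixes)
    moreover have "AE \<omega> in M. \<exists>m. \<not> nonpos_suffixes (?w \<omega>) {i - 2 * int m..<i}"
      by (rule AE_not_all)
        (auto intro!: depends_on_event[OF _ depends_on_prefixes(2)] prob_nonpos_suffixes)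
    ultimately show ?thesis
    proof eventually_elim
      case (elim \<omega>)
      obtain m n where m: "\<not> nonneg_prefixes (?w \<omega>) {i<..i + 2 * int m}"
        and n: "\<not> nonpos_suffixes (?w \<omega>) {i - 2 * int n..<i}"
        using elim by blast
      show ?case
      proof (cases "X (s, i) \<omega>")
        case L
        show ?thesis using unmatched_nonneg_prefixes[of "?w \<omega>" i "i + 2 * int m", OF L] m by auto
      next
        case R
        show ?thesis using unmatched_nonpos_suffixes[of "?w \<omega>" i "i - 2 * int n", OF R] n by auto
      qed
    qed
  qed
  then show ?thesis unfolding noodle_exists_iff by (simp add: AE_all_countable)
qed

end

section \<open>Components and embedded shapes\<close>

abbreviation arc :: "(int \<Rightarrow> letter) \<Rightarrow> int \<Rightarrow> int \<Rightarrow> bool" where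
  "arc w i j \<equiv> matched w i j \<or> matched w j i"

lemma arc_unique: "arc w i j \<Longrightarrow> arc w i j' \<Longrightarrow> j = j'"
  by (meson matched_unique_left matched_unique_right matched_not_both)

lemma arc_matched: "arc w i j \<Longrightarrow> i < j \<Longrightarrow> matched w i j"
  by (auto simp: matched_def)

lemma potential_parity: "even (potential w x + x)"
proof (induction x rule: int_induct[of _ 0])
  case base
  then show ?case by (simp add: potential_def)
next
  case (step1 i)
  then show ?case using potential_step[of w "i + 1"] by auto
next
  case (step2 i)
  then show ?case using potential_step[of w i] by (auto split: if_splits)
qed

text \<open>Applied twice below, to arcs of the noodle and to arcs in the word read along the shape;
  comparing the two makes the gaps between consecutive points of the shape even.\<close>

lemma matched_odd: "matched w i j \<Longrightarrow> odd (j - i)"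
  using potential_parity[of w i] potential_parity[of w j] by (auto simp: matched_iff_potential)

section \<open>Connected components under restriction, and edges of the noodle\<close>

lemma conn_comp_self [simp]: "i \<in> conn_comp M i"
  by (simp add: conn_comp_def)

lemma conn_comp_step: "x \<in> conn_comp M i \<Longrightarrow> (x, y) \<in> edge_rel M \<Longrightarrow> y \<in> conn_comp M i"
  unfolding conn_comp_def by (auto intro: rtrancl_into_rtrancl)

lemma conn_comp_subset:
  assumes "i \<in> C" "\<And>x y. x \<in> C \<Longrightarrow> (x, y) \<in> edge_rel M \<Longrightarrow> y \<in> C"
  shows "conn_comp M i \<subseteq> C"
proof
  fix j assume "j \<in> conn_comp M i"
  then have "(i, j) \<in> (edge_rel M)\<^sup>*" by (simp add: conn_comp_def)
  then show "j \<in> C" by (induction rule: rtrancl_induct) (use assms in auto)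
qed

lemma conn_comp_mono: "edge_rel M \<subseteq> edge_rel M' \<Longrightarrow> conn_comp M i \<subseteq> conn_comp M' i"
  unfolding conn_comp_def using rtrancl_mono by blast

lemma edge_rel_restrict:
  "(x, y) \<in> edge_rel (restrict_system B M) \<longleftrightarrow> x \<in> B \<and> y \<in> B \<and> (x, y) \<in> edge_rel M"
  unfolding edge_rel_def restrict_system_def restrict_pmatching_def by auto

lemma edge_rel_restrict_mono: "B \<subseteq> C \<Longrightarrow> edge_rel (restrict_system B M) \<subseteq> edge_rel (restrict_system C M)"
  by (auto simp: edge_rel_restrict)

lemma edge_rel_noodle:
  assumes "noodle_exists w"
  shows "(x, y) \<in> edge_rel (noodle w) \<longleftrightarrow> (\<exists>s. arc (w s) x y)"
proof -
  have "{x, y} \<in> pairs (noodle w s) \<longleftrightarrow> arc (w s) x y" for s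
  proof (cases x y rule: linorder_cases)
    case less
    then show ?thesis
      using noodle_matching_pairs[OF noodle_matching_noodle[OF assms] less] by (auto simp: matched_def)
  next
    case equal
    then have "{x, y} \<notin> pairs (noodle w s)"
      using noodle_matching_noodle[OF assms, of s] pair_distinct unfolding noodle_matching_def by blast
    then show ?thesis using equal by (simp add: matched_def)
  next
    case greater
    then show ?thesis
      using noodle_matching_pairs[OF noodle_matching_noodle[OF assms] greater]
      by (auto simp: matched_def insert_commute)
  qed
  then show ?thesis by (simp add: edge_rel_def)
qed

text \<open>For i at most 0 the sum is empty, so the artificial end -1 is mapped to itself. If l
  vanishes at 2k, the artificial end 2k + 1 is mapped to the integer right after the image of
  2k.\<close>

definition embed :: "(int \<Rightarrow> nat) \<Rightarrow> int \<Rightarrow> int" where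
  "embed l i = i + 2 * (\<Sum>t\<in>{0..<i}. int (l t))"

lemma embed_0 [simp]: "embed l 0 = 0"
  by (simp add: embed_def)

lemma embed_step: "0 \<le> i \<Longrightarrow> embed l (i + 1) = embed l i + 1 + 2 * int (l i)"
proof -
  assume "0 \<le> i"
  then have "{0..<i + 1} = insert i {0..<i}" by auto
  then show ?thesis by (simp add: embed_def)
qed

lemma embed_less_iff [simp]: "embed l i < embed l j \<longleftrightarrow> i < j"
proof -
  have "embed l i < embed l j" if "i < j" for i j
  proof -
    have "(\<Sum>t\<in>{0..<i}. int (l t)) \<le> (\<Sum>t\<in>{0..<j}. int (l t))"
      by (rule sum_mono2) (use that in auto)
    then show ?thesis using that by (simp add: embed_def)
  qed
  then show ?thesis by (metis linorder_neqE order_less_asym)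
qed

lemma embed_eq_iff [simp]: "embed l i = embed l j \<longleftrightarrow> i = j"
  using embed_less_iff[of l i j] embed_less_iff[of l j i] by (metis linorder_neqE order_less_irrefl)

lemma embed_le_iff [simp]: "embed l i \<le> embed l j \<longleftrightarrow> i \<le> j"
  by (simp flip: not_less)

text \<open>A finite set has only one increasing enumeration. This identifies the list in
  \<open>partial_shape\<close> with the embedding, and it lets the embedding be recovered from its
  image.\<close>

lemma sorted_list_embed:
  assumes "i \<in> {0..n}"
  shows "sorted_list_of_set (embed l ` {0..n}) ! nat i = embed l i"
proof -
  let ?xs = "map (embed l) [0..n]"
  have "sorted_wrt (<) ?xs"
    unfolding sorted_wrt_map using sorted_wrt_upto by (rule sorted_wrt_mono_rel[rotated]) simp
  then have "sorted_list_of_set (set ?xs) = ?xs"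
    by (simp only: sorted_list_of_set.idem_if_sorted_distinct strict_sorted_iff)
  then show ?thesis using assms by (simp add: nth_upto)
qed

definition realizes :: "msystem \<Rightarrow> nat \<Rightarrow> (side \<Rightarrow> int \<Rightarrow> letter) \<Rightarrow> (int \<Rightarrow> nat) \<Rightarrow> bool" where
  "realizes P k w l \<longleftrightarrow> (\<forall>s.
     (\<forall>c d. {c, d} \<in> pairs (P s) \<and> c < d \<longrightarrow> matched (w s) (embed l c) (embed l d)) \<and>
     (\<forall>i. sing (P s) i = Some L \<longrightarrow>
        w s (embed l i) = L \<and> nonneg_prefixes (w s) {embed l i<..embed l (2 * int k)}) \<and>
     (\<forall>i. sing (P s) i = Some R \<longrightarrow>
        w s (embed l i) = R \<and> nonpos_suffixes (w s) {0..<embed l i}))"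

locale shape =
  fixes P :: msystem and k :: nat
  assumes shape: "P \<in> shapes k" and k: "k \<ge> 1"
begin

lemma matching: "partial_matching {0..2 * int k} (P s)"
  and noncross: "noncrossing (P s)"
  using shape unfolding shapes_def partial_meander_def partial_meandric_system_def by blast+

lemma connected:
  assumes "i \<in> {0..2 * int k}"
  shows "(0, i) \<in> (edge_rel P)\<^sup>*"
proof -
  have "card (conn_comp P ` {0..2 * int k}) = 1"
    using shape unfolding shapes_def partial_meander_def by blast
  then obtain C where C: "conn_comp P ` {0..2 * int k} = {C}" by (auto simp: card_1_singleton_iff)
  have "conn_comp P i = C" using C assms by blast
  moreover have "conn_comp P 0 = C" using C by auto
  ultimately have "i \<in> conn_comp P 0" using conn_comp_self[of i P] by simp
  then show ?thesis by (simp add: conn_comp_def)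
qed

lemma no_R_in_restriction:
  assumes "i \<in> conn_comp (restrict_system {0..2 * int k - 1} P) 0"
  shows "sing (restrict_system {0..2 * int k - 1} P s) i \<noteq> Some R"
  using shape assms unfolding shapes_def Let_def by blast

lemma singletons:
  obtains sL sR s1 s2 where "sL \<noteq> sR" "\<And>s. s = sL \<or> s = sR"
    "sing (P sL) = [s1 \<mapsto> L]" "sing (P sR) = [s2 \<mapsto> R]"
    "s1 \<in> {0..2 * int k}" "s2 \<in> {0..2 * int k}"
proof -
  obtain s1 s2 where "(sing (P Upper) = [s1 \<mapsto> L] \<and> sing (P Lower) = [s2 \<mapsto> R]) \<or>
      (sing (P Upper) = [s2 \<mapsto> R] \<and> sing (P Lower) = [s1 \<mapsto> L])"
    using shape unfolding shapes_def by blast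
  then obtain sL sR where *: "sL \<noteq> sR" "sing (P sL) = [s1 \<mapsto> L]" "sing (P sR) = [s2 \<mapsto> R]"
    by (metis side.distinct(1))
  moreover have "s = sL \<or> s = sR" for s using *(1) by (cases s; cases sL; cases sR) auto
  moreover have "s1 \<in> {0..2 * int k}" by (rule sing_in[OF matching, of sL s1 L]) (simp add: *)
  moreover have "s2 \<in> {0..2 * int k}" by (rule sing_in[OF matching, of sR s2 R]) (simp add: *)
  ultimately show ?thesis using that by blast
qed

end

locale noodle_shape = shape +
  fixes w :: "side \<Rightarrow> int \<Rightarrow> letter"
  assumes noodle_exists: "noodle_exists w"
begin

lemma arc_exists: "\<exists>j. arc (w s) i j"
  using noodle_exists unfolding noodle_exists_iff by blast

text \<open>Since every point of the noodle is matched, having no partner inside the window amounts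
  to having one beyond it.\<close>

lemma realizes_iff:
  "realizes P k w l \<longleftrightarrow> (\<forall>s.
     (\<forall>c d. {c, d} \<in> pairs (P s) \<and> c < d \<longrightarrow> matched (w s) (embed l c) (embed l d)) \<and>
     (\<forall>i. sing (P s) i = Some L \<longrightarrow> (\<exists>j>embed l (2 * int k). matched (w s) (embed l i) j)) \<and>
     (\<forall>i. sing (P s) i = Some R \<longrightarrow> (\<exists>j<0. matched (w s) j (embed l i))))"
proof -
  have L: "(w s x = L \<and> nonneg_prefixes (w s) {x<..y}) \<longleftrightarrow> (\<exists>j>y. matched (w s) x j)" if "x \<le> y" for s x y
    using matched_beyond_iff[OF that, of "w s"] arc_exists[of s x] by (auto simp: matched_def)
  have R: "(w s x = R \<and> nonpos_suffixes (w s) {y..<x}) \<longleftrightarrow> (\<exists>j<y. matched (w s) j x)" if "y \<le> x" for s x y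
    using matched_before_iff[OF that, of "w s"] arc_exists[of s x] by (auto simp: matched_def)
  have sing: "embed l i \<le> embed l (2 * int k) \<and> 0 \<le> embed l i" if "sing (P s) i = Some a" for s i a
    using sing_in[OF matching that] embed_le_iff[of l 0 i] by simp
  show ?thesis unfolding realizes_def
    by (intro all_cong1 conj_cong imp_cong refl L R) (use sing in auto)
qed

text \<open>The point is to locate K: the event \<open>event_E\<close> first occurs at the image of
  2k. The window up to that point then cuts out exactly the embedded points, and their letters spell
  the word of P.\<close>

lemma shape_of_realizes:
  assumes real: "realizes P k w l"
  shows "partial_shape w = Some P" and "shape_set (noodle w) = embed l ` {0..2 * int k}"
proof -
  define N where "N = 2 * int k"
  define g where "g = embed l"
  define M where "M = noodle w"
  have N: "N \<ge> 2" using k by (simp add: N_def)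
  note pm = matching[folded N_def]
  have g0: "g 0 = 0" and gless: "\<And>i j. g i < g j \<longleftrightarrow> i < j" and gle: "\<And>i j. g i \<le> g j \<longleftrightarrow> i \<le> j"
    by (simp_all add: g_def)
  have arcs: "\<And>s c d. {c, d} \<in> pairs (P s) \<Longrightarrow> c < d \<Longrightarrow> matched (w s) (g c) (g d)"
    and sL: "\<And>s i. sing (P s) i = Some L \<Longrightarrow> \<exists>j>g N. matched (w s) (g i) j"
    and sR: "\<And>s i. sing (P s) i = Some R \<Longrightarrow> \<exists>j<0. matched (w s) j (g i)"
    using real unfolding realizes_iff N_def g_def by blast+
  have arc_g: "arc (w s) (g c) (g d)" if "{c, d} \<in> pairs (P s)" for s c d
    using arcs[of c d s] arcs[of d c s] that pair_distinct[OF pm that]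
    by (cases c d rule: linorder_cases) (auto simp: insert_commute)
  have edge: "(x, y) \<in> edge_rel M \<longleftrightarrow> (\<exists>s. arc (w s) x y)" for x y
    unfolding M_def by (rule edge_rel_noodle[OF noodle_exists])
  \<comment> \<open>P accounts for every arc at an embedded point: the arc leads to another embedded
    point, or it leaves the window on the side told by the decoration.\<close>
  have neighbour: "(\<exists>i'\<in>{0..N}. {i, i'} \<in> pairs (P s) \<and> y = g i') \<or>
      sing (P s) i = Some L \<and> y > g N \<or> sing (P s) i = Some R \<and> y < 0"
    if i: "i \<in> {0..N}" and y: "arc (w s) (g i) y" for i s y
  proof -
    consider j where "{i, j} \<in> pairs (P s)" | "sing (P s) i = Some L" | "sing (P s) i = Some R"
      using pair_or_sing[OF pm i, of s] by (metis letter.exhaust)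
    then show ?thesis
    proof cases
      case 1
      then show ?thesis using arc_unique[OF arc_g[OF 1] y] pair_in[OF pm 1] by auto
    next
      case 2
      then show ?thesis using sL[OF 2] arc_unique[OF y] by blast
    next
      case 3
      then show ?thesis using sR[OF 3] arc_unique[OF y] by blast
    qed
  qed
  let ?M0 = "restrict_system {0..g N} M"
  have comp0: "conn_comp ?M0 0 = g ` {0..N}"
  proof
    show "conn_comp ?M0 0 \<subseteq> g ` {0..N}"
    proof (rule conn_comp_subset)
      show "0 \<in> g ` {0..N}" using g0 N by force
      fix x y assume x: "x \<in> g ` {0..N}" "(x, y) \<in> edge_rel ?M0"
      obtain i where i: "i \<in> {0..N}" "x = g i" using x by blast
      obtain s where y: "arc (w s) (g i) y" "y \<in> {0..g N}"
        using x(2) unfolding i(2) edge_rel_restrict edge by blast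
      show "y \<in> g ` {0..N}" using neighbour[OF i(1) y(1)] y(2) by auto
    qed
    show "g ` {0..N} \<subseteq> conn_comp ?M0 0"
    proof
      fix x assume "x \<in> g ` {0..N}"
      then obtain i where i: "i \<in> {0..N}" "x = g i" by blast
      have "(0, i) \<in> (edge_rel P)\<^sup>*" using connected i(1) by (simp add: N_def)
      then have "g i \<in> conn_comp ?M0 0"
      proof (induction rule: rtrancl_induct)
        case base
        then show ?case by (simp add: g0)
      next
        case (step y z)
        then obtain s where s: "{y, z} \<in> pairs (P s)" by (auto simp: edge_rel_def)
        then have "g y \<in> {0..g N}" "g z \<in> {0..g N}"
          using pair_in[OF pm s] gle[of 0 y] gle[of 0 z] gle[of y N] gle[of z N] g0 by auto
        then have "(g y, g z) \<in> edge_rel ?M0" using arc_g[OF s] by (auto simp: edge_rel_restrict edge)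
        then show ?case using step conn_comp_step by blast
      qed
      then show "x \<in> conn_comp ?M0 0" using i by simp
    qed
  qed
  have K: "int (nat (g N)) = g N" using gle[of 0 N] g0 N by simp
  \<comment> \<open>The arc at the singleton decorated R ends at a negative point, and it is visible
    in the restriction to points up to g N.\<close>
  obtain tR s2 where s2: "sing (P tR) = [s2 \<mapsto> R]" "s2 \<in> {0..2 * int k}"
    by (rule singletons) (rule that, assumption+)
  obtain y where y: "y < 0" "matched (w tR) y (g s2)" using sR[of tR s2] s2(1) by auto
  have "g s2 \<in> conn_comp ?M0 0" using s2 comp0 by (auto simp: N_def)
  then have "g s2 \<in> conn_comp (restrict_system {..g N} M) 0"
    using conn_comp_mono[OF edge_rel_restrict_mono[of "{0..g N}" "{..g N}" M]] by auto
  moreover have "(g s2, y) \<in> edge_rel (restrict_system {..g N} M)"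
    using y s2 gle[of s2 N] gle[of 0 s2] g0 by (auto simp: edge_rel_restrict edge N_def)
  ultimately have yc: "y \<in> conn_comp (restrict_system {..g N} M) 0" by (rule conn_comp_step)
  then have E1: "event_E M (nat (g N))"
    unfolding event_E_def leftmost_in_comp_def K using y by force
  have E0: "\<not> event_E M j" if j: "j < nat (g N)" for j
  proof -
    let ?Q = "restrict_system {0..N - 1} P"
    let ?D = "conn_comp ?Q 0"
    have D: "?D \<subseteq> {0..N - 1}"
      by (rule conn_comp_subset) (use N in \<open>auto simp: edge_rel_restrict\<close>)
    \<comment> \<open>Before time g N, the arc of the singleton decorated L ends too far to the
      right, and the image of N itself is not visible. A step to the negative side would need the
      singleton decorated R, which condition (i) keeps out of the component of 0.\<close>
    have "conn_comp (restrict_system {..int j} M) 0 \<subseteq> g ` ?D"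
    proof (rule conn_comp_subset)
      show "0 \<in> g ` ?D" using g0 conn_comp_self by force
      fix x y assume "x \<in> g ` ?D" "(x, y) \<in> edge_rel (restrict_system {..int j} M)"
      then obtain i s where i: "i \<in> ?D" "x = g i" and y: "arc (w s) (g i) y" "y \<le> int j"
        by (auto simp: edge_rel_restrict edge)
      have iN: "i \<in> {0..N}" using i(1) D by auto
      have yN: "y < g N" using y(2) j by simp
      have "sing (P s) i \<noteq> Some R"
      proof
        assume R: "sing (P s) i = Some R"
        then have "sing (?Q s) i = Some R"
          using sing_unpaired[OF pm R] i(1) D by (auto simp: restrict_system_def restrict_pmatching_def)
        then show False using no_R_in_restriction[of i s] i(1) by (simp add: N_def)
      qed
      then obtain i' where i': "i' \<in> {0..N}" "{i, i'} \<in> pairs (P s)" "y = g i'"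
        using neighbour[OF iN y(1)] yN by auto
      have "i' < N" using yN gless i'(3) by simp
      moreover have "(i, i') \<in> edge_rel P" using i'(2) by (auto simp: edge_rel_def)
      ultimately have "(i, i') \<in> edge_rel ?Q"
        unfolding edge_rel_restrict using i'(1) i(1) D by auto
      then have "i' \<in> ?D" using i(1) conn_comp_step by blast
      then show "y \<in> g ` ?D" using i'(3) by blast
    qed
    moreover have "0 \<le> g i" if "i \<in> ?D" for i using D that gle[of 0 i] g0 by auto
    ultimately show ?thesis unfolding event_E_def leftmost_in_comp_def by force
  qed
  have time: "time_K M = nat (g N)" unfolding time_K_def
    by (rule Least_equality) (use E1 E0 not_less in blast)+
  then have time1: "time_K M \<ge> 1" using gless[of 0 N] g0 N by simp
  show E: "shape_set (noodle w) = embed l ` {0..2 * int k}"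
    using comp0 unfolding shape_set_def M_def[symmetric] time K by (simp add: g_def N_def)
  have "edge_rel (restrict_system {..g N} M) \<subseteq> edge_rel M" by (auto simp: edge_rel_restrict)
  then have "y \<in> conn_comp M 0" using conn_comp_mono yc by blast
  then have nl: "\<not> leftmost_in_comp M 0" using y unfolding leftmost_in_comp_def by force
  have card: "int (card (shape_set M)) - 1 = N"
    using E unfolding M_def[symmetric] by (simp add: card_image inj_on_def N_def)
  have "decode {0..N} (\<lambda>i. w s (sorted_list_of_set (shape_set M) ! nat i)) = P s" for s
  proof (rule decode_eqI[OF pm noncross])
    have "w s (g i) = L \<longleftrightarrow> sing (P s) i = Some L \<or> (\<exists>j>i. {i, j} \<in> pairs (P s))"
      if i: "i \<in> {0..N}" for i
    proof -
      from pair_or_sing[OF pm i, of s] show ?thesis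
      proof (elim disjE exE)
        fix j assume ij: "{i, j} \<in> pairs (P s)"
        show ?thesis
        proof (cases "i < j")
          case True
          then have "w s (g i) = L" using arcs[OF ij] by (simp add: matched_def)
          then show ?thesis using True ij by blast
        next
          case False
          then have "j < i" using pair_distinct[OF pm ij] by simp
          then have "w s (g i) = R" using arcs[of j i s] ij by (simp add: matched_def insert_commute)
          moreover have "sing (P s) i \<noteq> Some L" using sing_unpaired[OF pm] ij by blast
          moreover have "\<not> j' > i" if "{i, j'} \<in> pairs (P s)" for j'
            using pair_unique[OF pm ij that] False by simp
          ultimately show ?thesis by auto
        qed
      next
        fix a assume a: "sing (P s) i = Some a"
        show ?thesis
        proof (cases a)
          case L
          then show ?thesis using sL[of s i] a by (auto simp: matched_def)
        next
          case R
          then have "w s (g i) = R" using sR[of s i] a by (auto simp: matched_def)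
          then show ?thesis using a R sing_unpaired[OF pm a] by simp
        qed
      qed
    qed
    moreover have "sorted_list_of_set (shape_set M) ! nat i = g i" if "i \<in> {0..N}" for i
      using sorted_list_embed[OF that, of l] E unfolding M_def g_def N_def by simp
    ultimately show "encoded_by {0..N} (\<lambda>i. w s (sorted_list_of_set (shape_set M) ! nat i)) (P s)"
      unfolding encoded_by_def by simp
  qed
  then show "partial_shape w = Some P"
    unfolding partial_shape_def Let_def M_def[symmetric] card using noodle_exists nl time1 by simp
qed

text \<open>The two embeddings have the same image, hence agree on [0, 2k]; consecutive differences
  of an embedding are 1 + 2 l i.\<close>

lemma realizes_unique:
  assumes "realizes P k w l" "realizes P k w l'" "l \<in> ell_families k" "l' \<in> ell_families k"
  shows "l = l'"
proof -
  have img: "embed l ` {0..2 * int k} = embed l' ` {0..2 * int k}"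
    using shape_of_realizes(2)[OF assms(1)] shape_of_realizes(2)[OF assms(2)] by simp
  have eq: "embed l i = embed l' i" if "i \<in> {0..2 * int k}" for i
    using sorted_list_embed[OF that, of l] sorted_list_embed[OF that, of l'] img by simp
  show ?thesis
  proof
    fix i
    show "l i = l' i"
    proof (cases "i \<in> {0..2 * int k - 1}")
      case True
      then show ?thesis
        using eq[of i] eq[of "i + 1"] embed_step[of i l] embed_step[of i l'] by simp
    next
      case False
      then show ?thesis using assms(3,4) by (simp add: ell_families_def)
    qed
  qed
qed

text \<open>Here g enumerates the component E. The work is to show that g ends at K, that the arcs
  seen from E form P, and that the gaps of g are even.\<close>

lemma realizes_of_shape:
  assumes ps: "partial_shape w = Some P"
  shows "\<exists>l\<in>ell_families k. realizes P k w l"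
proof -
  define M where "M = noodle w"
  define K where "K = int (time_K M)"
  define E where "E = shape_set M"
  define n where "n = int (card E) - 1"
  define g where "g i = sorted_list_of_set E ! nat i" for i
  have nl: "\<not> leftmost_in_comp M 0" and K1: "K \<ge> 1"
    and P: "\<And>s. P s = decode {0..n} (\<lambda>i. w s (g i))"
    using ps unfolding partial_shape_def Let_def M_def[symmetric] K_def E_def[symmetric] n_def g_def
    by (auto split: if_splits)
  have edge: "(x, y) \<in> edge_rel M \<longleftrightarrow> (\<exists>s. arc (w s) x y)" for x y
    unfolding M_def by (rule edge_rel_noodle[OF noodle_exists])
  obtain y where y: "(0, y) \<in> (edge_rel M)\<^sup>*" "y < 0"
    using nl unfolding leftmost_in_comp_def conn_comp_def by auto
  \<comment> \<open>A path uses finitely many points, hence lies below some m. So the least index in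
    \<open>time_K\<close> is attained.\<close>
  have "\<exists>m. y \<in> conn_comp (restrict_system {..int m} M) 0"
    using y(1)
  proof (induction rule: rtrancl_induct)
    case base
    then show ?case by simp
  next
    case (step x z)
    then obtain m where m: "x \<in> conn_comp (restrict_system {..int m} M) 0" by blast
    define m' where "m' = max m (max (nat x) (nat z))"
    have "x \<in> conn_comp (restrict_system {..int m'} M) 0"
      using conn_comp_mono[OF edge_rel_restrict_mono[of "{..int m}" "{..int m'}" M]] m by (auto simp: m'_def)
    moreover have "(x, z) \<in> edge_rel (restrict_system {..int m'} M)"
      using step(2) by (auto simp: edge_rel_restrict m'_def)
    ultimately show ?case using conn_comp_step by blast
  qed
  then have "\<exists>m. event_E M m" unfolding event_E_def leftmost_in_comp_def using y(2) by force
  then have EK: "event_E M (time_K M)" unfolding time_K_def by (rule LeastI_ex)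
  have EK1: "\<not> event_E M (time_K M - 1)"
    using K1 not_less_Least[of "time_K M - 1" "event_E M"] unfolding time_K_def K_def by simp
  have E: "E = conn_comp (restrict_system {0..K} M) 0"
    by (simp add: E_def shape_set_def K_def)
  have E0: "0 \<in> E" and Esub: "E \<subseteq> {0..K}"
  proof -
    show "0 \<in> E" by (simp add: E)
    show "E \<subseteq> {0..K}" unfolding E
      by (rule conn_comp_subset) (use K1 in \<open>auto simp: edge_rel_restrict\<close>)
  qed
  have Eclosed: "y \<in> E" if "x \<in> E" "arc (w s) x y" "y \<in> {0..K}" for x y s
  proof -
    have "(x, y) \<in> edge_rel (restrict_system {0..K} M)"
      using that Esub by (auto simp: edge_rel_restrict edge)
    then show ?thesis using that(1) conn_comp_step unfolding E by blast
  qed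
  \<comment> \<open>Minimality of K: if K were not in E, then E would already be connected at time K
    - 1. Any arc from E to a negative point avoids K, so it would make the event occur at K -
    1.\<close>
  have KE: "K \<in> E"
  proof (rule ccontr)
    assume KE: "K \<notin> E"
    have K': "int (time_K M - 1) = K - 1" using K1 by (simp add: K_def)
    have Esub': "E \<subseteq> conn_comp (restrict_system {..K - 1} M) 0"
      unfolding E
    proof (rule subset_trans[OF _ conn_comp_mono])
      show "conn_comp (restrict_system {0..K} M) 0 \<subseteq> conn_comp (restrict_system {0..K - 1} M) 0"
      proof (rule conn_comp_subset)
        fix x z assume x: "x \<in> conn_comp (restrict_system {0..K - 1} M) 0"
          "(x, z) \<in> edge_rel (restrict_system {0..K} M)"
        then have "x \<in> E" unfolding E
          using conn_comp_mono[OF edge_rel_restrict_mono[of "{0..K - 1}" "{0..K}" M]] by auto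
        moreover have "z \<in> E" using calculation x(2) conn_comp_step unfolding E by blast
        ultimately have "x \<noteq> K" "z \<noteq> K" using KE by auto
        then have "(x, z) \<in> edge_rel (restrict_system {0..K - 1} M)"
          using x(2) by (auto simp: edge_rel_restrict)
        then show "z \<in> conn_comp (restrict_system {0..K - 1} M) 0" using x(1) conn_comp_step by blast
      qed simp
      show "edge_rel (restrict_system {0..K - 1} M) \<subseteq> edge_rel (restrict_system {..K - 1} M)"
        by (rule edge_rel_restrict_mono) auto
    qed
    have "conn_comp (restrict_system {..K} M) 0 \<subseteq> E"
    proof (rule conn_comp_subset[OF E0])
      fix x z assume x: "x \<in> E" "(x, z) \<in> edge_rel (restrict_system {..K} M)"
      show "z \<in> E"
      proof (cases "0 \<le> z")
        case True
        then show ?thesis using x Eclosed by (auto simp: edge_rel_restrict edge)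
      next
        case False
        have "x \<noteq> K" using x KE by auto
        then have "x \<le> K - 1" using x Esub by force
        then have "(x, z) \<in> edge_rel (restrict_system {..K - 1} M)"
          using x False K1 by (auto simp: edge_rel_restrict)
        then have "z \<in> conn_comp (restrict_system {..K - 1} M) 0"
          using x(1) Esub' conn_comp_step by blast
        then have "event_E M (time_K M - 1)"
          unfolding event_E_def leftmost_in_comp_def K' using False by blast
        then show ?thesis using EK1 by simp
      qed
    qed
    then show False
      using EK Esub unfolding event_E_def leftmost_in_comp_def K_def[symmetric] by fastforce
  qed
  have fin: "finite E" using Esub finite_subset by blast
  then have cardE: "card E > 0" using E0 card_gt_0_iff by blast
  have gE: "g ` {0..n} = E"
  proof
    show "g ` {0..n} \<subseteq> E"
    proof
      fix x assume "x \<in> g ` {0..n}"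
      then obtain i where "i \<in> {0..n}" "x = sorted_list_of_set E ! nat i" by (auto simp: g_def)
      then have "x \<in> set (sorted_list_of_set E)" by (auto simp: n_def)
      then show "x \<in> E" using fin by simp
    qed
    show "E \<subseteq> g ` {0..n}"
    proof
      fix x assume "x \<in> E"
      then have "x \<in> set (sorted_list_of_set E)" using fin by simp
      then obtain j where "j < card E" "x = sorted_list_of_set E ! j" by (auto simp: in_set_conv_nth)
      then show "x \<in> g ` {0..n}"
        by (intro image_eqI[of _ _ "int j"]) (auto simp: g_def n_def)
    qed
  qed
  have gless: "g i < g j" if "i \<in> {0..n}" "j \<in> {0..n}" "i < j" for i j
    unfolding g_def
    by (rule sorted_wrt_nth_less[OF strict_sorted_list_of_set]) (use that cardE in \<open>auto simp: n_def\<close>)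
  have gless_iff: "g i < g j \<longleftrightarrow> i < j" if "i \<in> {0..n}" "j \<in> {0..n}" for i j
    using gless[OF that] gless[OF that(2,1)] by (metis linorder_neqE order_less_asym)
  have geq: "i = j" if "i \<in> {0..n}" "j \<in> {0..n}" "g i = g j" for i j
    using gless_iff[of i j] gless_iff[of j i] that by (metis linorder_neqE order_less_irrefl)
  have n0: "n \<ge> 0" using cardE by (simp add: n_def)
  have g0: "g 0 = 0"
  proof -
    obtain i where i: "i \<in> {0..n}" "g i = 0" using gE E0 by force
    have "g 0 \<in> E" using gE n0 by force
    then have "\<not> g 0 < g i" using i Esub by auto
    then show ?thesis using gless_iff[of 0 i] i n0 by (cases "i = 0") auto
  qed
  have gn: "g n = K"
  proof -
    obtain i where i: "i \<in> {0..n}" "g i = K" using gE KE by force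
    have "g n \<in> E" using gE n0 by force
    then have "\<not> g i < g n" using i Esub by auto
    then show ?thesis using gless_iff[of i n] i n0 by (cases "i = n") auto
  qed
  have gK: "g i \<in> {0..K}" if "i \<in> {0..n}" for i using gE Esub that by blast
  have partner: "(\<exists>j\<in>{0..n}. arc (w s) (g i) (g j)) \<or> (\<exists>y>K. matched (w s) (g i) y) \<or> (\<exists>y<0. matched (w s) y (g i))"
    if i: "i \<in> {0..n}" for i s
  proof -
    obtain y where y: "arc (w s) (g i) y" using arc_exists by blast
    consider "y \<in> {0..K}" | "y > K" | "y < 0" by force
    then show ?thesis
    proof cases
      case 1
      then have "y \<in> g ` {0..n}" using Eclosed[of "g i" s y] gE i y by blast
      then show ?thesis using y by blast
    next
      case 2
      then show ?thesis using y gK[OF i] by (auto simp: matched_def)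
    next
      case 3
      then show ?thesis using y gK[OF i] by (auto simp: matched_def)
    qed
  qed
  \<comment> \<open>The candidate for P: arcs between points of E become pairs, and an arc leaving
    [0, K] becomes a singleton decorated by its direction. By \<open>partner\<close> there is no
    other possibility.\<close>
  define m where "m s = PMatching {{i, j} | i j. i \<in> {0..n} \<and> j \<in> {0..n} \<and> matched (w s) (g i) (g j)}
    (\<lambda>i. if i \<in> {0..n} \<and> (\<exists>y>K. matched (w s) (g i) y) then Some L
         else if i \<in> {0..n} \<and> (\<exists>y<0. matched (w s) y (g i)) then Some R else None)" for s
  have mp: "{i, j} \<in> pairs (m s) \<longleftrightarrow> i \<in> {0..n} \<and> j \<in> {0..n} \<and> arc (w s) (g i) (g j)" for s i j
    unfolding m_def by (auto simp: doubleton_eq_iff)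
  have mlt: "matched (w s) (g i) (g j)" if "{i, j} \<in> pairs (m s)" "i < j" for s i j
    using that gless[of i j] arc_matched[of "w s" "g i" "g j"] unfolding mp by blast
  have mL: "sing (m s) i = Some L \<longleftrightarrow> i \<in> {0..n} \<and> (\<exists>y>K. matched (w s) (g i) y)" for s i
    unfolding m_def by auto
  have mR: "sing (m s) i = Some R \<longleftrightarrow> i \<in> {0..n} \<and> (\<exists>y<0. matched (w s) y (g i))" for s i
    unfolding m_def by (auto dest: matched_not_both)
  have Pm: "P s = m s" and pm: "partial_matching {0..n} (m s)" and enc: "encoded_by {0..n} (\<lambda>i. w s (g i)) (m s)"
    and nc: "noncrossing (m s)" for s
  proof -
    show pm: "partial_matching {0..n} (m s)"
    proof (rule partial_matchingI)
      fix p assume "p \<in> pairs (m s)"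
      then obtain i j where ij: "p = {i, j}" "i \<in> {0..n}" "j \<in> {0..n}" "matched (w s) (g i) (g j)"
        unfolding m_def by auto
      then have "i \<noteq> j" by (auto simp: matched_def)
      then show "\<exists>i j. i \<noteq> j \<and> p = {i, j} \<and> i \<in> {0..n} \<and> j \<in> {0..n}" using ij by blast
    next
      show "j = j'" if "{i, j} \<in> pairs (m s)" "{i, j'} \<in> pairs (m s)" for i j j'
        using that geq arc_unique unfolding mp by blast
    next
      fix i assume "i \<in> {0..n}" "sing (m s) i = None"
      then show "\<exists>j. {i, j} \<in> pairs (m s)"
        using partner[of i s] mL[of s i] mR[of s i] mp by (metis option.distinct(1))
    next
      show "i \<in> {0..n}" if "sing (m s) i = Some a" for i a
        using that mL[of s i] mR[of s i] by (cases a) auto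
      show "{i, j} \<notin> pairs (m s)" if a: "sing (m s) i = Some a" for i j a
      proof
        assume "{i, j} \<in> pairs (m s)"
        then have j: "arc (w s) (g i) (g j)" "g j \<in> {0..K}" using mp gK by auto
        have "\<exists>y. arc (w s) (g i) y \<and> y \<notin> {0..K}"
          using a mL[of s i] mR[of s i] by (cases a) force+
        then show False using j arc_unique by blast
      qed
    qed
    show nc: "noncrossing (m s)" unfolding noncrossing_def
    proof (intro conjI notI; elim exE conjE)
      fix i j k' l assume h: "i < j" "j < k'" "k' < l" "{i, k'} \<in> pairs (m s)" "{j, l} \<in> pairs (m s)"
      then have n: "i \<in> {0..n}" "j \<in> {0..n}" "k' \<in> {0..n}" "l \<in> {0..n}" by (auto simp: mp)
      have lt: "g i < g j" "g j < g k'" "g k' < g l" using n h gless by auto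
      then have "matched (w s) (g i) (g k')" "matched (w s) (g j) (g l)"
        using h by (auto intro: mlt)
      then show False using lt matched_noncrossing by blast
    next
      fix i j k' assume h: "i < j" "j < k'" "{i, k'} \<in> pairs (m s)" "sing (m s) j \<noteq> None"
      then obtain a where a: "sing (m s) j = Some a" by auto
      have n: "i \<in> {0..n}" "j \<in> {0..n}" "k' \<in> {0..n}" using h by (auto simp: mp)
      have lt: "g i < g j" "g j < g k'" using n h gless by auto
      then have ik: "matched (w s) (g i) (g k')" using h by (auto intro: mlt)
      show False
      proof (cases a)
        case L
        then obtain y where y: "y > K" "matched (w s) (g j) y" using a mL by blast
        then have "g k' < y" using gK[OF n(3)] by simp
        then show False by (rule matched_noncrossing[OF ik y(2) lt])
      next
        case R
        then obtain y where y: "y < 0" "matched (w s) y (g j)" using a mR by blast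
        then have "y < g i" using gK[OF n(1)] by simp
        then show False by (rule matched_noncrossing[OF y(2) ik _ lt])
      qed
    next
      fix i j assume h: "i < j" "sing (m s) i = Some L" "sing (m s) j = Some R"
      then obtain y z where yz: "i \<in> {0..n}" "y > K" "matched (w s) (g i) y" "j \<in> {0..n}" "z < 0" "matched (w s) z (g j)"
        using mL mR by blast
      then show False
        using matched_noncrossing[OF yz(6,3)] gless[OF yz(1,4) h(1)] gK[OF yz(1)] gK[OF yz(4)] by auto
    qed
    show enc: "encoded_by {0..n} (\<lambda>i. w s (g i)) (m s)" unfolding encoded_by_def
    proof
      fix i assume i: "i \<in> {0..n}"
      show "w s (g i) = L \<longleftrightarrow> sing (m s) i = Some L \<or> (\<exists>j>i. {i, j} \<in> pairs (m s))"
      proof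
        assume wL: "w s (g i) = L"
        then have "\<not> matched (w s) y (g i)" for y by (simp add: matched_def)
        then consider j where "j \<in> {0..n}" "matched (w s) (g i) (g j)" | "\<exists>y>K. matched (w s) (g i) y"
          using partner[OF i, of s] by blast
        then show "sing (m s) i = Some L \<or> (\<exists>j>i. {i, j} \<in> pairs (m s))"
        proof cases
          case 1
          then have "i < j" using gless_iff[OF i 1(1)] by (simp add: matched_def)
          then show ?thesis using 1 i mp by blast
        next
          case 2
          then show ?thesis using i mL by blast
        qed
      next
        assume "sing (m s) i = Some L \<or> (\<exists>j>i. {i, j} \<in> pairs (m s))"
        then consider "\<exists>y>K. matched (w s) (g i) y" | j where "j > i" "{i, j} \<in> pairs (m s)" using mL by blast
        then show "w s (g i) = L"
        proof cases
          case 1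
          then show ?thesis by (auto simp: matched_def)
        next
          case 2
          then have "matched (w s) (g i) (g j)" using mlt by blast
          then show ?thesis by (simp add: matched_def)
        qed
      qed
    qed
    show "P s = m s" unfolding P by (rule decode_eqI[OF pm nc enc])
  qed
  \<comment> \<open>Both intervals are the ground set of the same matching, and a partition
    determines its ground set.\<close>
  have n: "n = 2 * int k"
  proof -
    have "{0..n} = {0..2 * int k}"
      using pm[of Upper] matching[of Upper] partition_onD1 unfolding Pm partial_matching_def by metis
    then show ?thesis using n0 by (auto simp: Icc_eq_Icc)
  qed
  \<comment> \<open>P is connected, so it suffices that each of its arcs preserves the parity of g i
    + i.\<close>
  have parity: "even (g i + i)" if "i \<in> {0..n}" for i
  proof -
    have "(0, i) \<in> (edge_rel P)\<^sup>*" using connected that n by simp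
    then show ?thesis
    proof (induction rule: rtrancl_induct)
      case base
      then show ?case by (simp add: g0)
    next
      case (step x y)
      then obtain s where s: "{x, y} \<in> pairs (m s)" by (auto simp: edge_rel_def Pm)
      \<comment> \<open>The pair is an excursion both of the word read along E and of the full word,
        so its length is odd in either numbering.\<close>
      have odd: "odd (d - c) \<and> odd (g d - g c)" if "{c, d} \<in> pairs (m s)" "c < d" for c d
      proof -
        have "matched (\<lambda>i. w s (g i)) c d"
          by (rule pair_matched[OF pm nc enc _ that]) auto
        moreover have "matched (w s) (g c) (g d)" using that by (rule mlt)
        ultimately show ?thesis using matched_odd by blast
      qed
      have "x \<noteq> y" using pair_distinct[OF pm s] .
      then consider "x < y" | "y < x" by linarith
      then show ?case
        using odd[of x y] odd[of y x] s step(3) by cases (auto simp: insert_commute)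
    qed
  qed
  \<comment> \<open>Half the number of integers skipped between consecutive points of E; the parity
    just shown makes the division exact.\<close>
  define l where "l i = (if i \<in> {0..n - 1} then nat ((g (i + 1) - g i - 1) div 2) else 0)" for i
  have gl: "embed l i = g i" if "i \<in> {0..n}" for i
  proof -
    have "int j \<le> n \<Longrightarrow> embed l (int j) = g (int j)" for j
    proof (induction j)
      case 0
      then show ?case by (simp add: g0)
    next
      case (Suc j)
      define i where "i = int j"
      have i: "i \<in> {0..n}" "i + 1 \<in> {0..n}" "i \<in> {0..n - 1}" using Suc.prems by (auto simp: i_def)
      have "even (g (i + 1) - g i - 1)" using parity[OF i(1)] parity[OF i(2)] by auto
      moreover have "g i < g (i + 1)" using gless[OF i(1,2)] by simp
      ultimately have "2 * int (l i) = g (i + 1) - g i - 1" using i(3) unfolding l_def by auto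
      moreover have "embed l i = g i" using Suc by (simp add: i_def)
      ultimately have "embed l (i + 1) = g (i + 1)" using embed_step[of i l] i(1) by simp
      then show ?case by (simp add: i_def add.commute)
    qed
    from this[of "nat i"] show ?thesis using that by simp
  qed
  have "realizes P k w l" unfolding realizes_iff
  proof (intro allI conjI impI; (elim conjE)?)
    fix s c d assume cd: "{c, d} \<in> pairs (P s)" "c < d"
    then show "matched (w s) (embed l c) (embed l d)"
      using gl[of c] gl[of d] mlt[of c d s] mp[of c d s] unfolding Pm by simp
  next
    fix s i assume "sing (P s) i = Some L"
    then show "\<exists>j>embed l (2 * int k). matched (w s) (embed l i) j"
      using gl[of n] gn n0 gl[of i] n mL[of s i] unfolding Pm by auto
  next
    fix s i assume "sing (P s) i = Some R"
    then show "\<exists>j<0. matched (w s) j (embed l i)"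
      using gl[of i] mR[of s i] unfolding Pm by auto
  qed
  moreover have "l \<in> ell_families k" by (auto simp: ell_families_def l_def n)
  ultimately show ?thesis by blast
qed

lemma partial_shape_iff: "partial_shape w = Some P \<longleftrightarrow> (\<exists>l\<in>ell_families k. realizes P k w l)"
  using realizes_of_shape shape_of_realizes(1) by blast

end

section \<open>Removing matched intervals\<close>

lemma rise_Int_split:
  assumes "finite J" "U \<subseteq> J"
  shows "rise w (J \<inter> I) = rise w ((J - U) \<inter> I) + rise w (U \<inter> I)"
proof -
  have "J \<inter> I = ((J - U) \<inter> I) \<union> (U \<inter> I)" using assms(2) by blast
  moreover have "finite U" using assms finite_subset by blast
  ultimately show ?thesis using assms(1) by (metis (no_types, lifting) Diff_disjoint Int_ac(3) Int_left_commute
      finite_Diff finite_Int inf_bot_right rise_Un_disjoint)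
qed

text \<open>Models a union of excursions: along U the walk stays nonnegative, and it is back at 0 at
  every cut outside U.\<close>

definition neutral :: "(int \<Rightarrow> letter) \<Rightarrow> int set \<Rightarrow> bool" where
  "neutral w U \<longleftrightarrow> finite U \<and> rise w U = 0 \<and> (\<forall>x. 0 \<le> rise w (U \<inter> {..x})) \<and>
     (\<forall>x. x \<notin> U \<longrightarrow> rise w (U \<inter> {..x}) = 0)"

lemma neutral_suffix:
  assumes "neutral w U"
  shows "rise w (U \<inter> {x..}) = - rise w (U \<inter> {..x - 1})"
proof -
  have "U = (U \<inter> {x..}) \<union> (U \<inter> {..x - 1})" by auto
  then have "rise w U = rise w (U \<inter> {x..}) + rise w (U \<inter> {..x - 1})"
    using assms rise_Un_disjoint[of "U \<inter> {x..}" "U \<inter> {..x - 1}" w] unfolding neutral_def by fastforce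
  then show ?thesis using assms by (simp add: neutral_def)
qed

text \<open>Adding U back only raises prefix sums. For the other direction, at a cut outside U the
  contribution of U is 0. A cut x inside U can be moved to x - 1 without changing the prefix of J -
  U, until it leaves U or no point of U remains to its left.\<close>

lemma nonneg_prefixes_remove:
  assumes "finite J" "U \<subseteq> J" "neutral w U"
  shows "nonneg_prefixes w J \<longleftrightarrow> nonneg_prefixes w (J - U)"
proof
  assume nn: "nonneg_prefixes w J"
  have "0 \<le> rise w ((J - U) \<inter> {..x})" for x
  proof (induction "card (U \<inter> {..x})" arbitrary: x rule: less_induct)
    case less
    show ?case
    proof (cases "x \<in> U")
      case True
      have "U \<inter> {..x - 1} \<subset> U \<inter> {..x}" using True by auto
      then have "card (U \<inter> {..x - 1}) < card (U \<inter> {..x})"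
        using assms(3) by (intro psubset_card_mono) (auto simp: neutral_def)
      moreover have "(J - U) \<inter> {..x} = (J - U) \<inter> {..x - 1}" using True by (auto simp: order_less_le)
      ultimately show ?thesis using less by metis
    next
      case False
      then have "rise w (U \<inter> {..x}) = 0" using assms(3) by (simp add: neutral_def)
      then show ?thesis using nn rise_Int_split[OF assms(1,2), of w "{..x}"]
        unfolding nonneg_prefixes_def by (metis add.right_neutral)
    qed
  qed
  then show "nonneg_prefixes w (J - U)" by (simp add: nonneg_prefixes_def)
next
  assume "nonneg_prefixes w (J - U)"
  then show "nonneg_prefixes w J"
    using rise_Int_split[OF assms(1,2), of w] assms(3) unfolding nonneg_prefixes_def neutral_def by simp
qed

lemma nonpos_suffixes_remove:
  assumes "finite J" "U \<subseteq> J" "neutral w U"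
  shows "nonpos_suffixes w J \<longleftrightarrow> nonpos_suffixes w (J - U)"
proof
  assume nn: "nonpos_suffixes w J"
  have "rise w ((J - U) \<inter> {x..}) \<le> 0" for x
  proof (induction "card (U \<inter> {x..})" arbitrary: x rule: less_induct)
    case less
    show ?case
    proof (cases "x \<in> U")
      case True
      have "x \<in> U \<inter> {x..}" "x \<notin> U \<inter> {x + 1..}" using True by auto
      moreover have "U \<inter> {x + 1..} \<subseteq> U \<inter> {x..}" by auto
      ultimately have "U \<inter> {x + 1..} \<subset> U \<inter> {x..}" by blast
      then have "card (U \<inter> {x + 1..}) < card (U \<inter> {x..})"
        using assms(3) by (intro psubset_card_mono) (auto simp: neutral_def)
      moreover have "y = x \<or> x + 1 \<le> y" if "x \<le> y" for y using that by linarith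
      then have "(J - U) \<inter> {x..} = (J - U) \<inter> {x + 1..}" using True by fastforce
      ultimately show ?thesis using less by metis
    next
      case False
      then have "U \<inter> {..x} = U \<inter> {..x - 1}" by (auto simp: order_less_le)
      then have "rise w (U \<inter> {x..}) = 0"
        using assms(3) False neutral_suffix[OF assms(3), of x] unfolding neutral_def by force
      then show ?thesis using nn rise_Int_split[OF assms(1,2), of w "{x..}"]
        unfolding nonpos_suffixes_def by (metis add.right_neutral)
    qed
  qed
  then show "nonpos_suffixes w (J - U)" by (simp add: nonpos_suffixes_def)
next
  assume J: "nonpos_suffixes w (J - U)"
  have "rise w (J \<inter> {x..}) \<le> 0" for x
  proof -
    have "rise w ((J - U) \<inter> {x..}) \<le> 0" using J by (simp add: nonpos_suffixes_def)
    moreover have "0 \<le> rise w (U \<inter> {..x - 1})" using assms(3) by (simp add: neutral_def)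
    ultimately show ?thesis
      using rise_Int_split[OF assms(1,2), of w "{x..}"] neutral_suffix[OF assms(3), of x] by simp
  qed
  then show "nonpos_suffixes w J" by (simp add: nonpos_suffixes_def)
qed

lemma balanced_remove:
  assumes "finite J" "U \<subseteq> J" "neutral w U"
  shows "balanced w J \<longleftrightarrow> balanced w (J - U)"
  using nonneg_prefixes_remove[OF assms] rise_Int_split[OF assms(1,2), of w UNIV] assms(3)
  unfolding balanced_def neutral_def by simp

text \<open>With both ends included, the interval starts from the height before c, stays at or above
  it and returns to it at d.\<close>

lemma matched_interval_neutral:
  assumes "matched w c d"
  shows "neutral w {c..d}"
proof -
  have cd: "c < d" and pot: "potential w d = potential w (c - 1)" "potential w c = potential w (c - 1) + 1"
    using assms by (auto simp: matched_iff_potential)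
  have rise: "rise w {c..x} = potential w x - potential w (c - 1)" if "c \<le> x" for x
  proof -
    have "{c..x} = {c - 1<..x}" by auto
    then show ?thesis using rise_interval[of "c - 1" x w] that by simp
  qed
  have int: "{c..d} \<inter> {..x} = (if x < d then {c..x} else {c..d})" for x by auto
  have "0 \<le> rise w {c..x}" if "x < d" for x
  proof (cases "c \<le> x")
    case True
    then show ?thesis using rise[of x] matched_potential_ge[OF assms True that] pot by simp
  qed simp
  then show ?thesis using cd pot rise[of d] unfolding neutral_def int by auto
qed

lemma matched_intervals_laminar:
  assumes "matched w c d" "matched w c' d'"
  shows "{c..d} \<inter> {c'..d'} = {} \<or> {c..d} \<subseteq> {c'..d'} \<or> {c'..d'} \<subseteq> {c..d}"
proof -
  have *: "{c..d} \<inter> {c'..d'} = {} \<or> {c'..d'} \<subseteq> {c..d}"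
    if m: "matched w c d" "matched w c' d'" and "c < c'" for c d c' d'
  proof -
    have "c < d" "c' < d'" using m by (auto simp: matched_def)
    moreover have "d \<noteq> c'" using m by (auto simp: matched_def)
    moreover have "\<not> (c' < d \<and> d < d')" using matched_noncrossing[OF m] \<open>c < c'\<close> by blast
    ultimately show ?thesis using \<open>c < c'\<close> by auto
  qed
  consider "c < c'" | "c = c'" | "c' < c" by linarith
  then show ?thesis
  proof cases
    case 1
    then show ?thesis using *[OF assms] by blast
  next
    case 2
    then show ?thesis using assms matched_unique_right by blast
  next
    case 3
    then show ?thesis using *[OF assms(2,1)] by blast
  qed
qed

text \<open>The given intervals may be nested. Keeping only the maximal ones does not change the
  union, and by laminarity they are disjoint, so the rises add up.\<close>

lemma Union_matched_neutral:
  assumes "finite \<S>" and S: "\<And>I. I \<in> \<S> \<Longrightarrow> \<exists>c d. I = {c..d} \<and> matched w c d"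
  shows "neutral w (\<Union>\<S>)"
proof -
  define T where "T = {I \<in> \<S>. \<forall>J\<in>\<S>. I \<subseteq> J \<longrightarrow> I = J}"
  have finT: "finite T" using assms(1) by (simp add: T_def)
  have "\<Union>\<S> \<subseteq> \<Union>T"
  proof
    fix x assume "x \<in> \<Union>\<S>"
    then obtain I where "I \<in> \<S>" "x \<in> I" by blast
    then obtain m where "m \<in> \<S>" "I \<subseteq> m" "\<forall>J\<in>\<S>. m \<subseteq> J \<longrightarrow> m = J"
      using finite_has_maximal2[OF assms(1)] by blast
    then show "x \<in> \<Union>T" using \<open>x \<in> I\<close> unfolding T_def by blast
  qed
  then have U: "\<Union>\<S> = \<Union>T" by (auto simp: T_def)
  have neut: "neutral w I" if I: "I \<in> T" for I
    using S[of I] I matched_interval_neutral unfolding T_def by blast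
  have disj: "I \<inter> J = {}" if "I \<in> T" "J \<in> T" "I \<noteq> J" for I J
  proof -
    have mem: "I \<in> \<S>" "J \<in> \<S>" using that by (simp_all add: T_def)
    obtain c d where cd: "I = {c..d}" "matched w c d" using S[OF mem(1)] by blast
    obtain c' d' where cd': "J = {c'..d'}" "matched w c' d'" using S[OF mem(2)] by blast
    have "\<not> I \<subseteq> J" "\<not> J \<subseteq> I" using that by (auto simp: T_def)
    then show ?thesis using matched_intervals_laminar[OF cd(2) cd'(2)] cd(1) cd'(1) by blast
  qed
  have sum: "rise w (\<Union>T \<inter> A) = (\<Sum>I\<in>T. rise w (I \<inter> A))" for A
  proof -
    have e: "\<Union>T \<inter> A = (\<Union>I\<in>T. I \<inter> A)" by blast
    have "\<forall>I\<in>T. finite (I \<inter> A)" using neut by (auto simp: neutral_def)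
    moreover have "\<forall>I\<in>T. \<forall>J\<in>T. I \<noteq> J \<longrightarrow> (I \<inter> A) \<inter> (J \<inter> A) = {}" using disj by blast
    ultimately show ?thesis unfolding rise_def e by (rule sum.UNION_disjoint[OF finT])
  qed
  show ?thesis unfolding U neutral_def
  proof (intro conjI allI impI)
    show "finite (\<Union>T)" using finT neut by (auto simp: neutral_def)
    show "rise w (\<Union>T) = 0" using sum[of UNIV] neut by (simp add: neutral_def)
    show "0 \<le> rise w (\<Union>T \<inter> {..x})" for x
      unfolding sum by (rule sum_nonneg) (use neut in \<open>simp add: neutral_def\<close>)
    show "rise w (\<Union>T \<inter> {..x}) = 0" if "x \<notin> \<Union>T" for x
      unfolding sum by (rule sum.neutral) (use neut that in \<open>auto simp: neutral_def\<close>)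
  qed
qed

section \<open>Faces and regions\<close>

definition arcs_on :: "nat \<Rightarrow> msystem \<Rightarrow> side \<Rightarrow> int set set" where
  "arcs_on k P s = {f. (s, f) \<in> all_faces k P}"

text \<open>All arcs nested in e are collected, at any depth: deeper ones contribute nothing new to
  the union of the intervals, and immediate children need not be singled out.\<close>

definition children :: "nat \<Rightarrow> msystem \<Rightarrow> side \<Rightarrow> int set \<Rightarrow> int set set" where
  "children k P s e = {f \<in> arcs_on k P s. Min e < Min f \<and> Max f < Max e}"

text \<open>These are the noodle positions skipped by the embedding along the boundary of the face,
  where the letters are not prescribed individually.\<close>

definition region :: "nat \<Rightarrow> msystem \<Rightarrow> (int \<Rightarrow> nat) \<Rightarrow> face \<Rightarrow> int set" where
  "region k P l F = (\<Union>t\<in>incident k P F. {embed l t<..<embed l (t + 1)})"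

definition word_of :: "pmatching \<Rightarrow> int \<Rightarrow> letter" where
  "word_of m i = (if sing m i = Some L \<or> (\<exists>j>i. {i, j} \<in> pairs m) then L else R)"

lemma incident_children:
  "incident k P (s, e) = {i. Min e \<le> i \<and> i < Max e \<and> (\<forall>f\<in>children k P s e. \<not> (Min f \<le> i \<and> i < Max f))}"
  unfolding incident_def children_def arcs_on_def by auto

text \<open>Naming the sides and positions of the two singletons treats both placements (L above or
  L below) at once.\<close>

locale marked_shape = shape +
  fixes sL sR :: side and s1 s2 :: int
  assumes sides: "sL \<noteq> sR"
    and sing_L: "sing (P sL) = [s1 \<mapsto> L]" and sing_R: "sing (P sR) = [s2 \<mapsto> R]"
begin

abbreviation N :: int where "N \<equiv> 2 * int k"

lemma side_cases: "s = sL \<or> s = sR"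
  using sides by (cases s; cases sL; cases sR) auto

lemma s1_in: "s1 \<in> {0..N}"
  by (rule sing_in[OF matching, of sL s1 L]) (simp add: sing_L)

lemma s2_in: "s2 \<in> {0..N}"
  by (rule sing_in[OF matching, of sR s2 R]) (simp add: sing_R)

lemma sing_eq_L: "sing (P s) i = Some L \<longleftrightarrow> s = sL \<and> i = s1"
  using side_cases[of s] sides by (auto simp: sing_L sing_R split: if_splits)

lemma sing_eq_R: "sing (P s) i = Some R \<longleftrightarrow> s = sR \<and> i = s2"
  using side_cases[of s] sides by (auto simp: sing_L sing_R split: if_splits)

lemma face_inf_eq: "face_inf k P = (sL, {s1, N + 1})"
proof -
  have "singleton_of L P = (sL, s1)"
    unfolding singleton_of_def by (rule the_equality) (auto simp: sing_eq_L)
  then show ?thesis by (simp add: face_inf_def)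
qed

lemma face_zero_eq: "face_zero P = (sR, {-1, s2})"
proof -
  have "singleton_of R P = (sR, s2)"
    unfolding singleton_of_def by (rule the_equality) (auto simp: sing_eq_R)
  then show ?thesis by (simp add: face_zero_def)
qed

lemma arcs_on_iff:
  "f \<in> arcs_on k P s \<longleftrightarrow> f \<in> pairs (P s) \<or> s = sL \<and> f = {s1, N + 1} \<or> s = sR \<and> f = {-1, s2}"
  by (auto simp: arcs_on_def all_faces_def faces_def face_inf_eq face_zero_eq)

lemma arc_ends:
  assumes "f \<in> arcs_on k P s"
  shows "f = {Min f, Max f}" "Min f < Max f" "-1 \<le> Min f" "Max f \<le> N + 1"
proof -
  have "\<exists>a b. f = {a, b} \<and> a < b \<and> -1 \<le> a \<and> b \<le> N + 1"
    using assms unfolding arcs_on_iff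
  proof (elim disjE conjE)
    assume f: "f \<in> pairs (P s)"
    then obtain a b where ab: "f = {a, b}" "a < b" using pair_elements[OF matching] by blast
    then have "a \<in> {0..N} \<and> b \<in> {0..N}" using pair_in[OF matching, of a b s] f by simp
    then show ?thesis using ab by (intro exI[of _ a] exI[of _ b]) auto
  next
    assume "f = {s1, N + 1}"
    then show ?thesis using s1_in by (intro exI[of _ s1] exI[of _ "N + 1"]) auto
  next
    assume "f = {-1, s2}"
    then show ?thesis using s2_in by (intro exI[of _ "-1"] exI[of _ s2]) auto
  qed
  then show "f = {Min f, Max f}" "Min f < Max f" "-1 \<le> Min f" "Max f \<le> N + 1" by auto
qed

text \<open>An added arc runs from a singleton to a point outside [0, 2k], so a pair crossing it
  would enclose the singleton. The two added arcs are on different sides.\<close>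

lemma arcs_noncrossing:
  assumes "f \<in> arcs_on k P s" "f' \<in> arcs_on k P s" "Min f < Min f'" "Min f' < Max f" "Max f < Max f'"
  shows False
proof -
  define a b c d where ab: "a = Min f" "b = Max f" "c = Min f'" "d = Max f'"
  have f: "f = {a, b}" and f': "f' = {c, d}" and lt: "a < c" "c < b" "b < d" "-1 \<le> a" "d \<le> N + 1"
    using arc_ends[OF assms(1)] arc_ends[OF assms(2)] assms by (simp_all add: ab)
  have nc: "noncrossing (P s)" by (rule noncross)
  \<comment> \<open>The arc f ends before f', so it cannot end at N + 1; likewise f' starts after f,
    so it cannot start at -1.\<close>
  have f_cases: "{a, b} \<in> pairs (P s) \<or> s = sR \<and> a = -1 \<and> b = s2"
    using assms(1) lt s1_in s2_in unfolding arcs_on_iff f by (auto simp: doubleton_eq_iff)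
  have f'_cases: "{c, d} \<in> pairs (P s) \<or> s = sL \<and> c = s1 \<and> d = N + 1"
    using assms(2) lt s1_in s2_in unfolding arcs_on_iff f' by (auto simp: doubleton_eq_iff)
  from f_cases f'_cases show False
  proof (elim disjE conjE)
    assume "{a, b} \<in> pairs (P s)" "{c, d} \<in> pairs (P s)"
    then show False using nc lt unfolding noncrossing_def by blast
  next
    assume "{a, b} \<in> pairs (P s)" "s = sL" "c = s1"
    then show False using nc lt sing_L unfolding noncrossing_def by fastforce
  next
    assume "s = sR" "b = s2" "{c, d} \<in> pairs (P s)"
    then show False using nc lt sing_R unfolding noncrossing_def by fastforce
  qed (use sides in simp)
qed

text \<open>One end of an added arc is a singleton and the other lies outside [0, 2k]; neither can
  be an end of a pair.\<close>

lemma arcs_share_end: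
  assumes "f \<in> arcs_on k P s" "f' \<in> arcs_on k P s" "x \<in> f" "x \<in> f'"
  shows "f = f'"
proof -
  have other: "\<exists>y. p = {x, y}" if p: "p \<in> pairs (P s)" "x \<in> p" for p
    using pair_elements[OF matching p(1)] p(2) by (auto simp: insert_commute)
  have pp: "p = q" if p: "p \<in> pairs (P s)" "x \<in> p" and q: "q \<in> pairs (P s)" "x \<in> q" for p q
  proof -
    obtain y z where yz: "p = {x, y}" "q = {x, z}" using other[OF p] other[OF q] by blast
    then show ?thesis using pair_unique[OF matching] p(1) q(1) by blast
  qed
  have pi: False if p: "p \<in> pairs (P s)" "x \<in> p" and "s = sL" "x \<in> {s1, N + 1}" for p
  proof -
    obtain y where y: "p = {x, y}" using other[OF p] by blast
    then have "x \<in> {0..N}" using pair_in[OF matching] p(1) by blast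
    then have "sing (P s) x = Some L" using that by (simp add: sing_eq_L)
    then show False using sing_unpaired[OF matching] p(1) y by blast
  qed
  have pz: False if p: "p \<in> pairs (P s)" "x \<in> p" and "s = sR" "x \<in> {-1, s2}" for p
  proof -
    obtain y where y: "p = {x, y}" using other[OF p] by blast
    then have "x \<in> {0..N}" using pair_in[OF matching] p(1) by blast
    then have "sing (P s) x = Some R" using that by (simp add: sing_eq_R)
    then show False using sing_unpaired[OF matching] p(1) y by blast
  qed
  from assms(1,2) show ?thesis unfolding arcs_on_iff
  proof (elim disjE conjE)
    assume "f \<in> pairs (P s)" "f' \<in> pairs (P s)"
    then show ?thesis using pp assms(3,4) by blast
  next
    assume "f \<in> pairs (P s)" "s = sL" "f' = {s1, N + 1}"
    then show ?thesis using pi assms(3,4) by blast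
  next
    assume "f \<in> pairs (P s)" "s = sR" "f' = {-1, s2}"
    then show ?thesis using pz assms(3,4) by blast
  next
    assume "f' \<in> pairs (P s)" "s = sL" "f = {s1, N + 1}"
    then show ?thesis using pi assms(3,4) by blast
  next
    assume "f' \<in> pairs (P s)" "s = sR" "f = {-1, s2}"
    then show ?thesis using pz assms(3,4) by blast
  qed (use sides in simp_all)
qed

lemma arcs_laminar:
  assumes "f \<in> arcs_on k P s" "f' \<in> arcs_on k P s" "f \<noteq> f'"
  shows "Max f < Min f' \<or> Max f' < Min f \<or> (Min f < Min f' \<and> Max f' < Max f) \<or> (Min f' < Min f \<and> Max f < Max f')"
proof -
  have "Min f \<in> f" "Max f \<in> f" "Min f' \<in> f'" "Max f' \<in> f'"
    using arc_ends(1)[OF assms(1)] arc_ends(1)[OF assms(2)] by blast+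
  then have "Min f \<noteq> Min f'" "Min f \<noteq> Max f'" "Max f \<noteq> Min f'" "Max f \<noteq> Max f'"
    using arcs_share_end[OF assms(1,2)] assms(3) by metis+
  then show ?thesis
    using arcs_noncrossing[OF assms(1,2)] arcs_noncrossing[OF assms(2,1)]
      arc_ends(2)[OF assms(1)] arc_ends(2)[OF assms(2)] by force
qed

text \<open>A child lies strictly inside e, hence cannot reach -1 or 2k + 1.\<close>

lemma children_pairs:
  assumes "e \<in> arcs_on k P s" "f \<in> children k P s e"
  shows "f \<in> pairs (P s)"
proof -
  have "f \<in> arcs_on k P s" "-1 < Min f" "Max f < N + 1"
    using assms arc_ends[OF assms(1)] by (auto simp: children_def)
  then show ?thesis unfolding arcs_on_iff using s1_in s2_in by auto
qed

lemma finite_arcs: "finite (pairs (P s))" "finite (children k P s e)"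
proof -
  have "pairs (P s) \<subseteq> Pow {0..N}"
    using pair_elements[OF matching] pair_in[OF matching] by fastforce
  then show fin: "finite (pairs (P s))" using finite_subset by blast
  have "arcs_on k P s \<subseteq> pairs (P s) \<union> {{s1, N + 1}, {-1, s2}}" by (auto simp: arcs_on_iff)
  then have "finite (arcs_on k P s)" using fin finite_subset by (metis finite.simps finite_UnI)
  then show "finite (children k P s e)" by (simp add: children_def)
qed

text \<open>A singleton cannot lie strictly under e, since its added arc would have to cross e. So
  an interior point belongs to a pair, which is nested in e by laminarity.\<close>

lemma interior_child:
  assumes e: "e \<in> arcs_on k P s" and i: "Min e < i" "i < Max e"
  shows "\<exists>f\<in>children k P s e. i \<in> f"
proof -
  have iN: "i \<in> {0..N}" using arc_ends(3,4)[OF e] i by auto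
  have "sing (P s) i = None"
  proof (rule ccontr)
    assume "sing (P s) i \<noteq> None"
    then consider "s = sL" "i = s1" | "s = sR" "i = s2"
      using sing_eq_L[of s i] sing_eq_R[of s i] by (metis letter.exhaust not_None_eq)
    then show False
    proof cases
      case 1
      then have "{s1, N + 1} \<in> arcs_on k P s" by (simp add: arcs_on_iff)
      moreover have "Min {s1, N + 1} = s1" "Max {s1, N + 1} = N + 1" using s1_in by auto
      ultimately show False
        using arcs_laminar[OF e, of "{s1, N + 1}"] i 1 arc_ends(4)[OF e] by (cases "e = {s1, N + 1}") auto
    next
      case 2
      then have "{-1, s2} \<in> arcs_on k P s" by (simp add: arcs_on_iff)
      moreover have "Min {-1, s2} = -1" "Max {-1, s2} = s2" using s2_in by auto
      ultimately show False
        using arcs_laminar[OF e, of "{-1, s2}"] i 2 arc_ends(3)[OF e] by (cases "e = {-1, s2}") auto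
    qed
  qed
  then obtain j where "{i, j} \<in> pairs (P s)" using pair_or_sing[OF matching iN, of s] by auto
  then have f: "{i, j} \<in> arcs_on k P s" by (simp add: arcs_on_iff)
  have "e \<noteq> {i, j}" using i arc_ends(1)[OF e] by force
  moreover have "Min {i, j} \<le> i" "i \<le> Max {i, j}" by auto
  ultimately have "{i, j} \<in> children k P s e"
    using arcs_laminar[OF e f] i f unfolding children_def by force
  then show ?thesis by blast
qed

text \<open>Rewrites the union of gaps as an interval with matched blocks removed, the form to which
  the removal lemmas apply.\<close>

lemma region_eq:
  assumes e: "e \<in> arcs_on k P s"
  shows "region k P l (s, e) = {embed l (Min e)<..<embed l (Max e)} -
    (\<Union>f\<in>children k P s e. {embed l (Min f)..embed l (Max f)})"
proof (intro set_eqI iffI)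
  fix x assume "x \<in> region k P l (s, e)"
  then obtain t where t: "t \<in> incident k P (s, e)" "embed l t < x" "x < embed l (t + 1)"
    by (auto simp: region_def)
  have et: "Min e \<le> t" "t + 1 \<le> Max e" using t(1) by (auto simp: incident_children)
  then have "embed l (Min e) \<le> embed l t" "embed l (t + 1) \<le> embed l (Max e)" by (simp_all only: embed_le_iff)
  then have "embed l (Min e) < x" "x < embed l (Max e)" using t by linarith+
  moreover have "x \<notin> {embed l (Min f)..embed l (Max f)}" if f: "f \<in> children k P s e" for f
  proof
    assume "x \<in> {embed l (Min f)..embed l (Max f)}"
    then have "embed l (Min f) < embed l (t + 1)" "embed l t < embed l (Max f)"
      using t unfolding atLeastAtMost_iff by linarith+
    then have "Min f \<le> t" "t < Max f" by simp_all
    then show False using t(1) f by (auto simp: incident_children)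
  qed
  ultimately show "x \<in> {embed l (Min e)<..<embed l (Max e)} - (\<Union>f\<in>children k P s e. {embed l (Min f)..embed l (Max f)})"
    unfolding greaterThanLessThan_iff Diff_iff UN_iff by blast
next
  fix x assume x: "x \<in> {embed l (Min e)<..<embed l (Max e)} - (\<Union>f\<in>children k P s e. {embed l (Min f)..embed l (Max f)})"
  \<comment> \<open>The maximum of T is the last embedded point at or before x; the gap containing x
    starts there.\<close>
  define T where "T = {t \<in> {Min e..<Max e}. embed l t \<le> x}"
  have "Min e \<in> T" using x arc_ends(2)[OF e] by (auto simp: T_def)
  moreover have fin: "finite T" by (rule finite_subset[of _ "{Min e..<Max e}"]) (auto simp: T_def)
  ultimately have mT: "Max T \<in> T" by (intro Max_in) auto
  define t where "t = Max T"
  have t: "Min e \<le> t" "t < Max e" "embed l t \<le> x" using mT by (auto simp: T_def t_def)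
  have t1: "x < embed l (t + 1)"
  proof (cases "t + 1 < Max e")
    case True
    have "t + 1 \<notin> T" using Max_ge[OF fin, of "t + 1"] by (auto simp: t_def)
    then show ?thesis using True t by (auto simp: T_def)
  next
    case False
    then have "t + 1 = Max e" using t by simp
    then show ?thesis using x by simp
  qed
  \<comment> \<open>An embedded point strictly under e is an end of a child, hence belongs to a
    removed block.\<close>
  have "embed l t \<noteq> x"
  proof
    assume eq: "embed l t = x"
    then have "embed l (Min e) < embed l t" using x by auto
    then obtain f where f: "f \<in> children k P s e" "t \<in> f" using interior_child[OF e, of t] t by auto
    then have "f \<in> arcs_on k P s" by (simp add: children_def)
    then have "t = Min f \<or> t = Max f" "Min f < Max f" using arc_ends(1,2) f(2) by blast+
    then have "embed l (Min f) \<le> x" "x \<le> embed l (Max f)" unfolding eq[symmetric] embed_le_iff by auto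
    then show False using x f(1) by auto
  qed
  then have tx: "embed l t < x" using t by simp
  have "t \<in> incident k P (s, e)" unfolding incident_children
  proof (intro CollectI conjI ballI notI)
    fix f assume f: "f \<in> children k P s e" "Min f \<le> t \<and> t < Max f"
    then have "embed l (Min f) \<le> embed l t" "embed l (t + 1) \<le> embed l (Max f)"
      unfolding embed_le_iff by linarith+
    then have "embed l (Min f) \<le> x" "x \<le> embed l (Max f)" using t t1 by linarith+
    then have "x \<in> {embed l (Min f)..embed l (Max f)}" by simp
    then show False using x f(1) by blast
  qed (use t in auto)
  then show "x \<in> region k P l (s, e)" using tx t1 by (auto simp: region_def)
qed

lemma finite_incident: "finite (incident k P (s, e))"
  by (rule finite_subset[of _ "{Min e..Max e}"]) (auto simp: incident_children)

lemma finite_region: "finite (region k P l F)"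
  unfolding region_def using finite_incident by (cases F) auto

lemma embed_less_zero: "i \<le> 0 \<Longrightarrow> embed l i = i"
  by (simp add: embed_def)

lemma card_region:
  assumes e: "e \<in> arcs_on k P s" and l: "l \<in> ell_families k"
  shows "card (region k P l (s, e)) = 2 * (\<Sum>i\<in>incident k P (s, e). l i)"
proof -
  have gap: "card {embed l t<..<embed l (t + 1)} = 2 * l t" if "t \<in> incident k P (s, e)" for t
  proof (cases "0 \<le> t")
    case True
    then show ?thesis using embed_step[OF True, of l] by simp
  next
    \<comment> \<open>This is the segment starting at -1: the gap is empty, in accordance with the
      convention that l vanishes there.\<close>
    case False
    then have "l t = 0" using l by (auto simp: ell_families_def)
    then show ?thesis using False embed_less_zero[of t l] embed_less_zero[of "t + 1" l] by simp
  qed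
  have "card (region k P l (s, e)) = (\<Sum>t\<in>incident k P (s, e). card {embed l t<..<embed l (t + 1)})"
    unfolding region_def
  proof (rule card_UN_disjoint[OF finite_incident], goal_cases)
    case 2
    have "{embed l t<..<embed l (t + 1)} \<inter> {embed l u<..<embed l (u + 1)} = {}" if "t < u" for t u
    proof -
      have "embed l (t + 1) \<le> embed l u" using that by simp
      then show ?thesis by auto
    qed
    then show ?case by (metis Int_commute linorder_neqE)
  qed simp
  then show ?thesis using gap by (simp add: sum_distrib_left)
qed

text \<open>By laminarity two arcs are separated or nested, and in the nested case the segments
  under the inner arc are not incident to the outer face.\<close>

lemma region_disjoint:
  assumes "e \<in> arcs_on k P s" "e' \<in> arcs_on k P s" "e \<noteq> e'"
  shows "region k P l (s, e) \<inter> region k P l (s, e') = {}"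
proof -
  have inc: "t \<noteq> u" if t: "t \<in> incident k P (s, e)" and u: "u \<in> incident k P (s, e')" for t u
  proof
    assume "t = u"
    then show False
      using arcs_laminar[OF assms] t u assms unfolding incident_children children_def by fastforce
  qed
  have "{embed l t<..<embed l (t + 1)} \<inter> {embed l u<..<embed l (u + 1)} = {}" if "t \<noteq> u" for t u
  proof -
    have "embed l (t + 1) \<le> embed l u \<or> embed l (u + 1) \<le> embed l t" using that by auto
    then show ?thesis by auto
  qed
  then show ?thesis unfolding region_def using inc by blast
qed

lemma embed_notin_region: "embed l i \<notin> region k P l F"
proof
  assume "embed l i \<in> region k P l F"
  then obtain t where "embed l t < embed l i" "embed l i < embed l (t + 1)" by (auto simp: region_def)
  then show False by simp
qed

lemma remove_children:
  assumes e: "e \<in> arcs_on k P s"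
    and m: "\<And>f. f \<in> children k P s e \<Longrightarrow> matched w (embed l (Min f)) (embed l (Max f))"
  shows "nonneg_prefixes w {embed l (Min e)<..<embed l (Max e)} \<longleftrightarrow> nonneg_prefixes w (region k P l (s, e))"
    and "nonpos_suffixes w {embed l (Min e)<..<embed l (Max e)} \<longleftrightarrow> nonpos_suffixes w (region k P l (s, e))"
    and "balanced w {embed l (Min e)<..<embed l (Max e)} \<longleftrightarrow> balanced w (region k P l (s, e))"
proof -
  let ?J = "{embed l (Min e)<..<embed l (Max e)}"
  let ?U = "\<Union>f\<in>children k P s e. {embed l (Min f)..embed l (Max f)}"
  have U: "neutral w ?U"
  proof (rule Union_matched_neutral)
    show "finite ((\<lambda>f. {embed l (Min f)..embed l (Max f)}) ` children k P s e)"
      using finite_arcs(2) by (rule finite_imageI)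
  qed (use m in blast)
  have sub: "?U \<subseteq> ?J"
  proof
    fix x assume "x \<in> ?U"
    then obtain f where f: "f \<in> children k P s e" "embed l (Min f) \<le> x" "x \<le> embed l (Max f)" by auto
    have "embed l (Min e) < embed l (Min f)" "embed l (Max f) < embed l (Max e)"
      using f(1) by (auto simp: children_def)
    then have "embed l (Min e) < x" "x < embed l (Max e)" using f by linarith+
    then show "x \<in> ?J" by simp
  qed
  note eq = region_eq[OF e, of l]
  show "nonneg_prefixes w ?J \<longleftrightarrow> nonneg_prefixes w (region k P l (s, e))"
    unfolding eq by (rule nonneg_prefixes_remove[OF _ sub U]) simp
  show "nonpos_suffixes w ?J \<longleftrightarrow> nonpos_suffixes w (region k P l (s, e))"
    unfolding eq by (rule nonpos_suffixes_remove[OF _ sub U]) simp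
  show "balanced w ?J \<longleftrightarrow> balanced w (region k P l (s, e))"
    unfolding eq by (rule balanced_remove[OF _ sub U]) simp
qed

lemma pair_Min_Max: "{c, d} \<in> pairs (P s) \<Longrightarrow> c < d \<Longrightarrow> Min {c, d} = c \<and> Max {c, d} = d"
  by simp

lemma word_of_pair:
  assumes "{c, d} \<in> pairs (P s)" "c < d"
  shows "word_of (P s) c = L" "word_of (P s) d = R"
proof -
  show "word_of (P s) c = L" using assms by (auto simp: word_of_def)
  have dc: "{d, c} \<in> pairs (P s)" using assms(1) by (simp add: insert_commute)
  have "sing (P s) d \<noteq> Some L" using sing_unpaired[OF matching] dc by blast
  moreover have "\<not> j > d" if "{d, j} \<in> pairs (P s)" for j
    using pair_unique[OF matching dc that] assms(2) by simp
  ultimately show "word_of (P s) d = R" by (auto simp: word_of_def)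
qed

lemma word_of_sing: "word_of (P sL) s1 = L" "word_of (P sR) s2 = R"
proof -
  show "word_of (P sL) s1 = L" by (simp add: word_of_def sing_L)
  have "sing (P sR) s2 = Some R" by (simp add: sing_R)
  then show "word_of (P sR) s2 = R" using sing_unpaired[OF matching, of sR s2 R] by (simp add: word_of_def)
qed

lemma realizes_iff_regions:
  assumes l: "l \<in> ell_families k"
  shows "realizes P k w l \<longleftrightarrow>
    (\<forall>s. \<forall>i\<in>{0..N}. w s (embed l i) = word_of (P s) i) \<and>
    (\<forall>(s, e)\<in>faces P. balanced (w s) (region k P l (s, e))) \<and>
    nonneg_prefixes (w sL) (region k P l (face_inf k P)) \<and>
    nonpos_suffixes (w sR) (region k P l (face_zero P))"
    (is "_ \<longleftrightarrow> ?letters \<and> ?faces \<and> ?inf \<and> ?zero")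
proof -
  have pair_arc: "f \<in> arcs_on k P s" if "f \<in> pairs (P s)" for f s using that by (simp add: arcs_on_iff)
  have inf_arc: "{s1, N + 1} \<in> arcs_on k P sL" and zero_arc: "{-1, s2} \<in> arcs_on k P sR"
    by (simp_all add: arcs_on_iff)
  have inf_ends: "Min {s1, N + 1} = s1" "Max {s1, N + 1} = N + 1" using s1_in by auto
  have zero_ends: "Min {-1, s2} = -1" "Max {-1, s2} = s2" using s2_in by auto
  \<comment> \<open>The vanishing entry at 2k makes the image of 2k + 1 the successor of that of 2k.
    So the open interval under the added arc is the half-open one in
    \<open>realizes\<close>.\<close>
  have "l N = 0" using l by (simp add: ell_families_def)
  then have inf_int: "{embed l s1<..<embed l (N + 1)} = {embed l s1<..embed l N}"
    using embed_step[of N l] by auto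
  have zero_int: "{embed l (-1)<..<embed l s2} = {0..<embed l s2}"
    using embed_less_zero[of "-1" l] by auto
  have sing_conds: "realizes P k w l \<longleftrightarrow>
      (\<forall>s c d. {c, d} \<in> pairs (P s) \<and> c < d \<longrightarrow> matched (w s) (embed l c) (embed l d)) \<and>
      w sL (embed l s1) = L \<and> nonneg_prefixes (w sL) {embed l s1<..embed l N} \<and>
      w sR (embed l s2) = R \<and> nonpos_suffixes (w sR) {0..<embed l s2}"
    unfolding realizes_def sing_eq_L sing_eq_R by blast
  have inf: "nonneg_prefixes (w sL) {embed l s1<..embed l N} \<longleftrightarrow> ?inf"
    and zero: "nonpos_suffixes (w sR) {0..<embed l s2} \<longleftrightarrow> ?zero"
    and face: "\<And>s e. e \<in> pairs (P s) \<Longrightarrow> balanced (w s) {embed l (Min e)<..<embed l (Max e)} \<longleftrightarrow>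
      balanced (w s) (region k P l (s, e))"
    if m: "\<And>s f. f \<in> pairs (P s) \<Longrightarrow> matched (w s) (embed l (Min f)) (embed l (Max f))"
  proof -
    show "nonneg_prefixes (w sL) {embed l s1<..embed l N} \<longleftrightarrow> ?inf"
      using remove_children(1)[OF inf_arc m[OF children_pairs[OF inf_arc]]]
      unfolding inf_ends inf_int face_inf_eq .
    show "nonpos_suffixes (w sR) {0..<embed l s2} \<longleftrightarrow> ?zero"
      using remove_children(2)[OF zero_arc m[OF children_pairs[OF zero_arc]]]
      unfolding zero_ends zero_int face_zero_eq .
    show "balanced (w s) {embed l (Min e)<..<embed l (Max e)} \<longleftrightarrow> balanced (w s) (region k P l (s, e))"
      if "e \<in> pairs (P s)" for s e
      by (rule remove_children(3)[OF pair_arc[OF that] m[OF children_pairs[OF pair_arc[OF that]]]])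
  qed
  have MinMax: "(\<forall>s c d. {c, d} \<in> pairs (P s) \<and> c < d \<longrightarrow> matched (w s) (embed l c) (embed l d)) \<longleftrightarrow>
      (\<forall>s. \<forall>f\<in>pairs (P s). matched (w s) (embed l (Min f)) (embed l (Max f)))" (is "?A \<longleftrightarrow> ?B")
  proof
    assume A: ?A
    show ?B
    proof (intro allI ballI)
      fix s f assume "f \<in> pairs (P s)"
      then show "matched (w s) (embed l (Min f)) (embed l (Max f))"
        using A arc_ends(1,2)[OF pair_arc[of f s]] by metis
    qed
  next
    assume B: ?B
    show ?A
    proof (intro allI impI, elim conjE)
      fix s c d assume cd: "{c, d} \<in> pairs (P s)" "c < d"
      then show "matched (w s) (embed l c) (embed l d)" using B pair_Min_Max[OF cd] by metis
    qed
  qed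
  show ?thesis
  proof
    assume r: "realizes P k w l"
    then have B: "\<And>s f. f \<in> pairs (P s) \<Longrightarrow> matched (w s) (embed l (Min f)) (embed l (Max f))"
      using sing_conds MinMax by blast
    have ?letters
    proof (intro allI ballI)
      fix s i assume i: "i \<in> {0..N}"
      show "w s (embed l i) = word_of (P s) i"
        using pair_or_sing[OF matching i, of s]
      proof (elim disjE exE)
        fix j assume j: "{i, j} \<in> pairs (P s)"
        show ?thesis
        proof (cases "i < j")
          case True
          then have "matched (w s) (embed l i) (embed l j)" using r j sing_conds by blast
          then show ?thesis using word_of_pair(1)[OF j True] by (simp add: matched_def)
        next
          case False
          then have lt: "j < i" using pair_distinct[OF matching j] by simp
          have ji: "{j, i} \<in> pairs (P s)" using j by (simp add: insert_commute)
          then have "matched (w s) (embed l j) (embed l i)" using r lt sing_conds by blast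
          then show ?thesis using word_of_pair(2)[OF ji lt] by (simp add: matched_def)
        qed
      next
        fix a assume a: "sing (P s) i = Some a"
        show ?thesis
        proof (cases a)
          case L
          then show ?thesis using a r sing_conds word_of_sing sing_eq_L by auto
        next
          case R
          then show ?thesis using a r sing_conds word_of_sing sing_eq_R by auto
        qed
      qed
    qed
    moreover have ?faces
    proof (intro ballI, clarify)
      fix s e assume "(s, e) \<in> faces P"
      then have e: "e \<in> pairs (P s)" by (simp add: faces_def)
      then show "balanced (w s) (region k P l (s, e))"
        using face[OF B e] B[OF e] by (simp add: matched_def)
    qed
    ultimately show "?letters \<and> ?faces \<and> ?inf \<and> ?zero"
      using r inf[OF B] zero[OF B] sing_conds by blast
  next
    assume asm: "?letters \<and> ?faces \<and> ?inf \<and> ?zero"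
    \<comment> \<open>Arcs are matched from the inside out: children are shorter, and once they are
      matched, balance on the region extends to the whole interval.\<close>
    have B: "f \<in> pairs (P s) \<Longrightarrow> matched (w s) (embed l (Min f)) (embed l (Max f))" for s f
    proof (induction "nat (Max f - Min f)" arbitrary: f rule: less_induct)
      case less
      note fa = pair_arc[OF less.prems]
      have ends: "{Min f, Max f} \<in> pairs (P s)" "Min f < Max f"
        using arc_ends(1,2)[OF fa] less.prems by simp_all
      have "balanced (w s) (region k P l (s, f))"
        using asm less.prems by (auto simp: faces_def)
      then have "balanced (w s) {embed l (Min f)<..<embed l (Max f)}"
      proof (subst remove_children(3)[OF fa])
        fix f' assume f': "f' \<in> children k P s f"
        show "matched (w s) (embed l (Min f')) (embed l (Max f'))"
        proof (rule less.hyps[OF _ children_pairs[OF fa f']])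
          have "Min f < Min f'" "Max f' < Max f" using f' by (auto simp: children_def)
          then show "nat (Max f' - Min f') < nat (Max f - Min f)" using ends(2) by simp
        qed
      qed
      moreover have "w s (embed l (Min f)) = L" "w s (embed l (Max f)) = R"
        using asm word_of_pair[OF ends] pair_in[OF matching ends(1)] by auto
      ultimately show ?case using ends(2) by (simp add: matched_def)
    qed
    have "w sL (embed l s1) = L" "w sR (embed l s2) = R"
      using asm s1_in s2_in word_of_sing by auto
    then show "realizes P k w l"
      unfolding sing_conds MinMax using B inf[OF B] zero[OF B] asm by blast
  qed
qed

end

section \<open>The law of the partial shape\<close>

lemma depends_on_matched: "depends_on (Pair s ` {i..j}) (\<lambda>v. matched (\<lambda>x. v (s, x)) i j)"
  unfolding depends_on_def
proof (intro allI impI)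
  fix v v' :: "'a \<times> int \<Rightarrow> letter" assume eq: "\<forall>p\<in>Pair s ` {i..j}. v p = v' p"
  have "balanced (\<lambda>x. v (s, x)) {i<..<j} \<longleftrightarrow> balanced (\<lambda>x. v' (s, x)) {i<..<j}"
    by (rule depends_onD[OF depends_on_prefixes(3)]) (use eq in auto)
  moreover have "v (s, i) = v' (s, i)" "v (s, j) = v' (s, j)" if "i < j" using eq that by auto
  ultimately show "matched (\<lambda>x. v (s, x)) i j \<longleftrightarrow> matched (\<lambda>x. v' (s, x)) i j"
    unfolding matched_def by (cases "i < j") simp_all
qed

lemma (in iid_letters) noodle_exists_event:
  "{\<omega> \<in> space M. noodle_exists (\<lambda>s i. X (s, i) \<omega>)} \<in> events"
proof -
  have m: "{\<omega> \<in> space M. matched (\<lambda>x. X (s, x) \<omega>) i j} \<in> events" for s i j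
    by (rule depends_on_event[OF _ depends_on_matched]) simp
  show ?thesis unfolding noodle_exists_iff
    by (intro sets.sets_Collect_countable_All sets.sets_Collect_countable_Ex sets.sets_Collect_disj m)
qed

text \<open>Countable additivity along a sequence, carried over by a bijection of the natural
  numbers with I; for nonnegative terms a convergent series is also an unordered sum.\<close>

lemma (in finite_measure) has_sum_measure_disjoint_UN:
  assumes "countable I" "infinite I" and A: "\<And>i. i \<in> I \<Longrightarrow> A i \<in> sets M" and disj: "disjoint_family_on A I"
  shows "((\<lambda>i. measure M (A i)) has_sum measure M (\<Union>i\<in>I. A i)) I"
proof -
  obtain f :: "nat \<Rightarrow> 'b" where bij: "bij_betw f UNIV I"
    using bij_betw_from_nat_into[OF assms(1,2)] by blast
  then have I: "range f = I" and inj: "inj f" by (auto simp: bij_betw_def)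
  have "(\<lambda>n. measure M (A (f n))) sums measure M (\<Union>n. A (f n))"
  proof (rule finite_measure_UNION)
    show "range (\<lambda>n. A (f n)) \<subseteq> sets M" using A I by blast
    show "disjoint_family (\<lambda>n. A (f n))" unfolding disjoint_family_on_def
    proof (intro ballI impI)
      fix m n :: nat assume "m \<noteq> n"
      then have "f m \<noteq> f n" "f m \<in> I" "f n \<in> I" using inj I by (auto dest: injD)
      then show "A (f m) \<inter> A (f n) = {}" using disj by (simp add: disjoint_family_on_def)
    qed
  qed
  moreover have "(\<Union>n. A (f n)) = (\<Union>i\<in>I. A i)" unfolding I[symmetric] by blast
  ultimately have "((\<lambda>n. measure M (A (f n))) has_sum measure M (\<Union>i\<in>I. A i)) UNIV"
    by (intro sums_nonneg_imp_has_sum) auto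
  then show ?thesis using has_sum_reindex_bij_betw[OF bij, of "\<lambda>i. measure M (A i)"] by simp
qed

lemma countable_ell_families: "countable (ell_families k)"
proof (rule countableI')
  show "inj_on (\<lambda>l. map l [0..2 * int k - 1]) (ell_families k)"
  proof (rule inj_onI)
    fix l l' assume l: "l \<in> ell_families k" "l' \<in> ell_families k"
      "map l [0..2 * int k - 1] = map l' [0..2 * int k - 1]"
    show "l = l'"
    proof
      fix i
      show "l i = l' i"
        using l by (cases "i \<in> {0..2 * int k - 1}") (auto simp: ell_families_def)
    qed
  qed
qed

lemma infinite_ell_families:
  assumes "k \<ge> 1"
  shows "infinite (ell_families k)"
proof
  assume "finite (ell_families k)"
  moreover have "range (\<lambda>n i. if i = 0 then n else 0) \<subseteq> ell_families k"
    using assms by (auto simp: ell_families_def)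
  ultimately have "finite (range (\<lambda>n (i :: int). if i = 0 then n else (0 :: nat)))"
    using finite_subset by blast
  moreover have "inj (\<lambda>n (i :: int). if i = 0 then n else (0 :: nat))"
    by (rule injI) (metis (full_types))
  ultimately show False using finite_imageD by blast
qed

locale random_shape = iid_letters M X + marked_shape P k sL sR s1 s2
  for M :: "'w measure" and X P k sL sR s1 s2
begin

text \<open>Indices of type \<open>Inl\<close> stand for the blocks of letters below the faces,
  those of type \<open>Inr\<close> for the single prescribed letters at embedded points.\<close>

definition coords :: "(int \<Rightarrow> nat) \<Rightarrow> face + side \<times> int \<Rightarrow> (side \<times> int) set" where
  "coords l j = (case j of Inl F \<Rightarrow> Pair (fst F) ` region k P l F | Inr (s, i) \<Rightarrow> {(s, embed l i)})"

definition condition :: "(int \<Rightarrow> nat) \<Rightarrow> face + side \<times> int \<Rightarrow> (side \<times> int \<Rightarrow> letter) \<Rightarrow> bool" where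
  "condition l j v = (case j of
     Inl F \<Rightarrow> (if F = face_inf k P then nonneg_prefixes else if F = face_zero P then nonpos_suffixes else balanced)
       (\<lambda>i. v (fst F, i)) (region k P l F)
   | Inr (s, i) \<Rightarrow> v (s, embed l i) = word_of (P s) i)"

abbreviation J :: "(face + side \<times> int) set" where
  "J \<equiv> all_faces k P <+> (UNIV \<times> {0..N})"

lemma faces_distinct: "face_inf k P \<notin> faces P" "face_zero P \<notin> faces P" "face_inf k P \<noteq> face_zero P"
proof -
  show "face_inf k P \<notin> faces P"
    using pair_in[OF matching, of s1 "N + 1" sL] by (auto simp: faces_def face_inf_eq)
  show "face_zero P \<notin> faces P"
    using pair_in[OF matching, of "-1" s2 sR] by (auto simp: faces_def face_zero_eq)
  show "face_inf k P \<noteq> face_zero P" using sides by (simp add: face_inf_eq face_zero_eq)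
qed

lemma finite_faces: "finite (faces P)"
proof -
  have "faces P = (SIGMA s:UNIV. pairs (P s))" by (auto simp: faces_def)
  then show ?thesis using finite_arcs(1) by (simp add: finite_SigmaI)
qed

lemma finite_J: "finite J"
  using finite_faces by (simp add: all_faces_def)

lemma arcs_onI: "F \<in> all_faces k P \<Longrightarrow> snd F \<in> arcs_on k P (fst F)"
  by (simp add: arcs_on_def)

lemma realizes_iff_conditions:
  assumes "l \<in> ell_families k"
  shows "realizes P k (\<lambda>s i. v (s, i)) l \<longleftrightarrow> (\<forall>j\<in>J. condition l j v)"
proof -
  have "(\<forall>j\<in>J. condition l j v) \<longleftrightarrow>
      (\<forall>F\<in>faces P. condition l (Inl F) v) \<and> condition l (Inl (face_inf k P)) v \<and>
      condition l (Inl (face_zero P)) v \<and> (\<forall>s. \<forall>i\<in>{0..N}. condition l (Inr (s, i)) v)"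
    unfolding all_faces_def by auto
  moreover have "(\<forall>F\<in>faces P. condition l (Inl F) v) \<longleftrightarrow>
      (\<forall>(s, e)\<in>faces P. balanced (\<lambda>i. v (s, i)) (region k P l (s, e)))"
    using faces_distinct by (intro ball_cong refl) (auto simp: condition_def)
  moreover have "condition l (Inl (face_inf k P)) v \<longleftrightarrow>
      nonneg_prefixes (\<lambda>i. v (sL, i)) (region k P l (face_inf k P))"
    by (simp add: condition_def face_inf_eq)
  moreover have "condition l (Inl (face_zero P)) v \<longleftrightarrow>
      nonpos_suffixes (\<lambda>i. v (sR, i)) (region k P l (face_zero P))"
    using faces_distinct(3) by (simp add: condition_def face_zero_eq)
  ultimately show ?thesis unfolding realizes_iff_regions[OF assms] by (simp add: condition_def) blast
qed

lemma condition_depends: "depends_on (coords l j) (condition l j)"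
proof (cases j)
  case (Inl F)
  then show ?thesis
    using depends_on_prefixes(1-3)[of "fst F" "region k P l F"]
    by (auto simp: coords_def condition_def[abs_def] face_inf_eq face_zero_eq)
next
  case (Inr p)
  then show ?thesis
    using depends_on_letter[of "(fst p, embed l (snd p))"]
    by (simp add: coords_def condition_def[abs_def] case_prod_beta)
qed

lemma finite_coords: "finite (coords l j)"
  using finite_region by (auto simp: coords_def split: sum.split)

text \<open>Blocks on one side are disjoint by laminarity, embedded points lie in no region, and
  different sides use different coordinates.\<close>

lemma coords_disjoint: "disjoint_family_on (coords l) J"
  unfolding disjoint_family_on_def
proof (intro ballI impI)
  have FI: "coords l (Inl F) \<inter> coords l (Inr p) = {}" for F p
    using embed_notin_region[of l "snd p" F] by (auto simp: coords_def split: prod.split)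
  fix i j assume ij: "i \<in> J" "j \<in> J" "i \<noteq> j"
  from ij(1,2) show "coords l i \<inter> coords l j = {}"
  proof (elim PlusE)
    fix F F' assume F: "F \<in> all_faces k P" "F' \<in> all_faces k P" "i = Inl F" "j = Inl F'"
    show ?thesis
    proof (cases "fst F = fst F'")
      case True
      then have "snd F \<noteq> snd F'" using F ij(3) by (auto simp: prod_eq_iff)
      then have "region k P l F \<inter> region k P l F' = {}"
        using region_disjoint[of "snd F" "fst F" "snd F'" l] arcs_onI[OF F(1)] arcs_onI[OF F(2)] True
        by (metis prod.collapse)
      then show ?thesis using F True by (auto simp: coords_def)
    next
      case False
      then show ?thesis using F by (auto simp: coords_def)
    qed
  next
    fix p q assume "i = Inr p" "j = Inr q"
    then show ?thesis using ij(3) by (auto simp: coords_def split: prod.splits)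
  qed (use FI in \<open>auto simp: Int_commute\<close>)
qed

lemma prob_condition:
  assumes l: "l \<in> ell_families k" and j: "j \<in> J"
  shows "prob {\<omega> \<in> space M. condition l j (letters \<omega>)} = (case j of
    Inl F \<Rightarrow> let n = \<Sum>i\<in>incident k P F. l i in
      (if F \<in> faces P then catalan n else real ((2 * n) choose n)) / 2 ^ (2 * n)
  | Inr _ \<Rightarrow> 1 / 2)"
  using j
proof (elim PlusE)
  fix F assume F: "F \<in> all_faces k P" "j = Inl F"
  define n where "n = (\<Sum>i\<in>incident k P F. l i)"
  have card: "card (region k P l F) = 2 * n"
    using card_region[OF arcs_onI[OF F(1)] l] by (simp add: n_def)
  note fin = finite_region[of l F]
  consider "F = face_inf k P" | "F = face_zero P" | "F \<in> faces P" using F by (auto simp: all_faces_def)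
  then show ?thesis
  proof cases
    case 1
    then show ?thesis
      using prob_nonneg_prefixes[OF fin card, of "fst F"] faces_distinct F
      by (simp add: condition_def n_def Let_def)
  next
    case 2
    then show ?thesis
      using prob_nonpos_suffixes[OF fin card, of "fst F"] faces_distinct F
      by (simp add: condition_def n_def Let_def)
  next
    case 3
    then have "F \<noteq> face_inf k P" "F \<noteq> face_zero P" using faces_distinct by auto
    then show ?thesis
      using prob_balanced[OF fin card, of "fst F"] F 3
      by (simp add: condition_def n_def Let_def)
  qed
next
  fix p assume "j = Inr p"
  then show ?thesis using prob_letter by (simp add: condition_def case_prod_beta)
qed

lemma prob_realizes:
  assumes l: "l \<in> ell_families k"
  shows "{\<omega> \<in> space M. realizes P k (\<lambda>s i. X (s, i) \<omega>) l} \<in> events"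
    and "prob {\<omega> \<in> space M. realizes P k (\<lambda>s i. X (s, i) \<omega>) l} =
      2 powi (- 4 * int k - 2) * shape_weight k P l"
proof -
  note iff = realizes_iff_conditions[OF l, of "letters _"]
  have ev: "{\<omega> \<in> space M. condition l j (letters \<omega>)} \<in> events" for j
    by (rule depends_on_event[OF finite_coords condition_depends])
  show "{\<omega> \<in> space M. realizes P k (\<lambda>s i. X (s, i) \<omega>) l} \<in> events"
    unfolding iff by (rule sets.sets_Collect_finite_All[OF ev finite_J])
  let ?p = "\<lambda>j. prob {\<omega> \<in> space M. condition l j (letters \<omega>)}"
  let ?n = "\<lambda>F. \<Sum>i\<in>incident k P F. l i"
  have p: "prob {\<omega> \<in> space M. realizes P k (\<lambda>s i. X (s, i) \<omega>) l} = (\<Prod>j\<in>J. ?p j)"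
    unfolding iff by (rule prob_all_disjoint[OF finite_J finite_coords condition_depends coords_disjoint])
  have J: "(\<Prod>j\<in>J. ?p j) = (\<Prod>F\<in>all_faces k P. ?p (Inl F)) * (\<Prod>p\<in>UNIV \<times> {0..N}. ?p (Inr p))"
    using finite_faces by (subst prod.Plus) (auto simp: all_faces_def)
  \<comment> \<open>There are 2k + 1 prescribed letters on each of the two sides, which gives the
    exponent 4k + 2.\<close>
  have letters: "(\<Prod>p\<in>UNIV \<times> {0..N}. ?p (Inr p)) = (1 / 2) ^ (4 * k + 2)"
  proof -
    have "(\<Prod>p\<in>UNIV \<times> {0..N}. ?p (Inr p)) = (\<Prod>p\<in>(UNIV :: side set) \<times> {0..N}. 1 / 2)"
      using prob_letter by (intro prod.cong) (auto simp: condition_def)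
    moreover have "card ((UNIV :: side set) \<times> {0..N}) = 4 * k + 2"
      by (simp add: card_cartesian_product UNIV_side)
    ultimately show ?thesis by simp
  qed
  have all: "(\<Prod>F\<in>all_faces k P. ?p (Inl F)) = (\<Prod>F\<in>faces P. ?p (Inl F)) * ?p (Inl (face_zero P)) * ?p (Inl (face_inf k P))"
    unfolding all_faces_def using finite_faces faces_distinct
    by (simp add: Un_insert_right)
  have inner: "(\<Prod>F\<in>faces P. ?p (Inl F)) = (\<Prod>F\<in>faces P. catalan (?n F) / 2 ^ (2 * ?n F))"
  proof (rule prod.cong[OF refl])
    fix F assume "F \<in> faces P"
    then show "?p (Inl F) = catalan (?n F) / 2 ^ (2 * ?n F)"
      using prob_condition[OF l InlI, of "F"] by (simp add: all_faces_def Let_def)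
  qed
  have zero: "?p (Inl (face_zero P)) = real ((2 * ?n (face_zero P)) choose ?n (face_zero P)) / 2 ^ (2 * ?n (face_zero P))"
    using prob_condition[OF l InlI, of "face_zero P"] faces_distinct by (simp add: all_faces_def Let_def)
  have inf: "?p (Inl (face_inf k P)) = real ((2 * ?n (face_inf k P)) choose ?n (face_inf k P)) / 2 ^ (2 * ?n (face_inf k P))"
    using prob_condition[OF l InlI, of "face_inf k P"] faces_distinct by (simp add: all_faces_def Let_def)
  have half: "(1 / 2 :: real) ^ (4 * k + 2) = 2 powi (- 4 * int k - 2)"
  proof -
    have "- 4 * int k - 2 = - int (4 * k + 2)" by simp
    then show ?thesis by (simp only: power_int_minus power_int_of_nat power_one_over inverse_eq_divide)
  qed
  show "prob {\<omega> \<in> space M. realizes P k (\<lambda>s i. X (s, i) \<omega>) l} =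
      2 powi (- 4 * int k - 2) * shape_weight k P l"
    unfolding p J letters all inner zero inf half shape_weight_def Let_def by (rule mult.commute)
qed

text \<open>The events \<open>?A\<close> include the existence of the noodle, without which
  realizing families need be neither unique nor tied to the partial shape.\<close>

lemma partial_shape_law:
  "((\<lambda>l. 2 powi (- 4 * int k - 2) * shape_weight k P l) has_sum
    prob {\<omega> \<in> space M. partial_shape (\<lambda>s i. X (s, i) \<omega>) = Some P}) (ell_families k)"
proof -
  let ?w = "\<lambda>\<omega> s i. X (s, i) \<omega>"
  let ?A = "\<lambda>l. {\<omega> \<in> space M. noodle_exists (?w \<omega>) \<and> realizes P k (?w \<omega>) l}"
  have ns: "noodle_shape P k (?w \<omega>)" if "noodle_exists (?w \<omega>)" for \<omega>
    using that by unfold_locales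
  have event: "{\<omega> \<in> space M. partial_shape (?w \<omega>) = Some P} = (\<Union>l\<in>ell_families k. ?A l)"
  proof -
    have "noodle_exists w" if "partial_shape w = Some P" for w
      using that unfolding partial_shape_def Let_def by (auto split: if_splits)
    then show ?thesis using noodle_shape.partial_shape_iff[OF ns] by blast
  qed
  have A: "?A l \<in> events" "prob (?A l) = 2 powi (- 4 * int k - 2) * shape_weight k P l"
    if l: "l \<in> ell_families k" for l
  proof -
    show ev: "?A l \<in> events"
      using noodle_exists_event prob_realizes(1)[OF l] by (rule sets.sets_Collect_conj[rotated])
    \<comment> \<open>The existence of the noodle has probability one, so dropping it does not
      change the probability.\<close>
    have "prob (?A l) = prob {\<omega> \<in> space M. realizes P k (?w \<omega>) l}"
      by (rule finite_measure_eq_AE[OF _ ev prob_realizes(1)[OF l]])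
        (use AE_noodle_exists in eventually_elim, auto)
    then show "prob (?A l) = 2 powi (- 4 * int k - 2) * shape_weight k P l"
      by (simp only: prob_realizes(2)[OF l])
  qed
  have "((\<lambda>l. prob (?A l)) has_sum prob (\<Union>l\<in>ell_families k. ?A l)) (ell_families k)"
  proof (rule has_sum_measure_disjoint_UN[OF countable_ell_families infinite_ell_families[OF k] A(1)])
    show "disjoint_family_on ?A (ell_families k)"
      unfolding disjoint_family_on_def using noodle_shape.realizes_unique[OF ns] by blast
  qed
  then show ?thesis unfolding event using A(2) by (simp cong: has_sum_cong)
qed

end

theorem proposition16:
  fixes M :: "'w measure" and W :: "side \<Rightarrow> int \<Rightarrow> 'w \<Rightarrow> letter"
    and k :: nat and P :: msystem
  assumes "prob_space M"
    and "prob_space.indep_vars M (\<lambda>_. count_space UNIV) (\<lambda>(s, i). W s i) UNIV"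
    and "\<And>s i. distr M (count_space UNIV) (W s i) = uniform_count_measure {L, R}"
    and "k \<ge> 1" and "P \<in> shapes k"
  shows "shape_weight k P summable_on ell_families k \<and>
    measure M {\<omega> \<in> space M. partial_shape (\<lambda>s i. W s i \<omega>) = Some P} =
      2 powi (- 4 * int k - 2) * (\<Sum>\<^sub>\<infinity>l\<in>ell_families k. shape_weight k P l)"
proof -
  interpret prob_space M by fact
  interpret shape P k using assms(4,5) by unfold_locales
  obtain sL sR s1 s2 where sing: "sL \<noteq> sR" "sing (P sL) = [s1 \<mapsto> L]" "sing (P sR) = [s2 \<mapsto> R]"
    by (rule singletons)
  interpret random_shape M "\<lambda>(s, i). W s i" P k sL sR s1 s2
    by unfold_locales (use assms(2,3) sing in auto)
  define c :: real where "c = 2 powi (- 4 * int k - 2)"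
  define p where "p = measure M {\<omega> \<in> space M. partial_shape (\<lambda>s i. W s i \<omega>) = Some P}"
  have "c > 0" by (simp add: c_def zero_less_power_int)
  have "((\<lambda>l. c * shape_weight k P l) has_sum p) (ell_families k)"
    using partial_shape_law by (simp add: c_def p_def)
  \<comment> \<open>Dividing by the positive constant gives the sum of the bare weights, and with it
    their summability.\<close>
  then have "((\<lambda>l. inverse c * (c * shape_weight k P l)) has_sum inverse c * p) (ell_families k)"
    by (rule has_sum_cmult_right)
  then have sum: "(shape_weight k P has_sum inverse c * p) (ell_families k)"
    using \<open>c > 0\<close> by (simp flip: mult.assoc)
  then have "infsum (shape_weight k P) (ell_families k) = inverse c * p" by (rule infsumI)
  then have "p = c * infsum (shape_weight k P) (ell_families k)" using \<open>c > 0\<close> by simp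
  then show ?thesis using has_sum_imp_summable[OF sum] unfolding c_def p_def by blast
qed

end
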